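(* Let $w$ be a weight structure on a triangulated category $\mathcal C$, let $A$ be an abelian category, let $H:\mathcal C\to A$ be a cohomological (contravariant) functor, and let $X\in\mathrm{Obj}\,\mathcal C$ with a fixed weight Postnikov tower and corresponding weight complex $(X^i,h^i)$. I. There exists a spectral sequence $T=T(H,X)$ with $E_1^{pq}=H^q(X^{-p})$ such that the map $E_1^{pq}\to E_1^{p+1,q}$ equals $H^q(h^{-1-p})$ (it comes from the exact couple with $D_1^{pq}=H^q(X^{w\le -p})$ obtained by applying $H$ to the distinguished triangles $X^{w\le k}[-1]\to X^{w\le k-1}\to X^k\to X^{w\le k}$). II. $T(H,X)$ converges to $H^{p+q}(X)$ in each of the following cases: (i) $X\in\mathcal C^b$; (ii) $H$ vanishes on $\mathcal C^{w\ge q}$ for $q$ large enough and on $\mathcal C^{w\le q}$ for $q$ small enough; (iii) $X\in\mathcal C^-$ (resp. $X\in\mathcal C^+$) and $H$ vanishes on $\mathcal C^{w\le q}$ for $q$ small enough (resp. on $\mathcal C^{w\ge q}$ for $q$ large enough). The corresponding filtration on $H^*(X)$ coincides with the weight filtration $W^i$ of the functors $H^*$. III. $T$ is functorial with respect to $H$: for any transformation of functors $H\to H'$ there is a morphism of spectral sequences $T(H,X)\to T(H',X)$. IV. $T$ is canonical (independent of the choice of the tower) and contravariantly functorial with respect to $X$ starting from $E_2$.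
   Context: For classes of objects, $D\perp E$ means $\mathcal C(X,Y)=0$ for all $X\in D$, $Y\in E$. A class is Karoubi-closed in $\mathcal C$ if it contains all retracts (in $\mathcal C$) of its objects. A weight structure $w$ on a triangulated category $\mathcal C$ is a pair of subclasses $\mathcal C^{w\le 0},\mathcal C^{w\ge 0}\subset\mathrm{Obj}\,\mathcal C$ such that: (i) both are additive and Karoubi-closed in $\mathcal C$; (ii) $\mathcal C^{w\ge 0}\subset \mathcal C^{w\ge 0}[1]$ and $\mathcal C^{w\le 0}[1]\subset \mathcal C^{w\le 0}$; (iii) $\mathcal C^{w\ge 0}\perp\mathcal C^{w\le 0}[1]$; (iv) for every $X$ there is a distinguished triangle $B[-1]\to X\to A\to B$ with $A\in\mathcal C^{w\le 0}$, $B\in\mathcal C^{w\ge 0}$ (a weight decomposition of $X$). Put $\mathcal C^{w\ge l}=\mathcal C^{w\ge 0}[-l]$, $\mathcal C^{w\le l}=\mathcal C^{w\le 0}[-l]$, $\mathcal C^{w=0}=\mathcal C^{w\ge 0}\cap \mathcal C^{w\le 0}$, $\mathcal C^-=\bigcup_i\mathcal C^{w\le i}$, $\mathcal C^+=\bigcup_i\mathcal C^{w\ge i}$, $\mathcal C^b=\mathcal C^+\cap\mathcal C^-$. Weight Postnikov tower of $X$: for each $k\in\mathbb Z$ choose a weight decomposition $X[k]\to X^{w\le k}\xrightarrow{f^k}X^{w\ge k+1}\to X[k+1]$ of $X[k]$. There are unique morphisms $X^{w\le k}[-1]\to X^{w\le k-1}$ and $X^{w\ge k+1}[-1]\to X^{w\ge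 k}$ compatible with these triangles and $\mathrm{id}_X$, and there are objects $X^k\in\mathcal C^{w=0}$ and distinguished triangles $X^{w\le k}[-1]\to X^{w\le k-1}\xrightarrow{c^k}X^k\xrightarrow{d^k}X^{w\le k}$ and $X^k[-1]\xrightarrow{x^k}X^{w\ge k+1}[-1]\to X^{w\ge k}\xrightarrow{y^k}X^k$ with $c^k=y^k\circ f^{k-1}$, $x^k=(f^k\circ d^k)[-1]$. All this data is a weight Postnikov tower of $X$. The weight complex of $X$ is $(X^i,h^i)$ with $h^i=c^{i+1}\circ d^i:X^i\to X^{i+1}$. Write $w_{\ge i}X=X^{w\ge i}[-i]$ and $w_{\le i}X=X^{w\le i}[-i]$. A cohomological functor $\mathcal C\to A$ is a contravariant additive functor sending distinguished triangles to long exact sequences. $H^p(Y)=H(Y[-p])$. The weight filtration of a contravariant $H$ is $W^i(H)(X)=\mathrm{Im}(H(w_{\le i}X)\to H(X))$ (it does not depend on choices). *)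

theory Defs
  imports "HOL-Algebra.Group"
begin

section \<open>Categories\<close>

text \<open>
  A category is given on a type of objects and a type of morphisms; its objects and morphisms are
  all elements of these types. Composition is written in the usual order (\<open>g \<cdot> f\<close> is
  ``first \<open>f\<close>, then \<open>g\<close>'') and is only meaningful if the target of \<open>f\<close> is the source of \<open>g\<close>.
\<close>

record ('o, 'm) cat_struct =
  Src :: "'m \<Rightarrow> 'o"
  Trg :: "'m \<Rightarrow> 'o"
  Idm :: "'o \<Rightarrow> 'm"
  Cmp :: "'m \<Rightarrow> 'm \<Rightarrow> 'm"  (infixl "\<cdot>\<index>" 70)

definition Mor :: "('o, 'm, 'z) cat_struct_scheme \<Rightarrow> 'o \<Rightarrow> 'o \<Rightarrow> 'm set" where
  "Mor C X Y = {f. Src C f = X \<and> Trg C f = Y}"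

locale category =
  fixes C (structure)
  assumes id_mor: "Idm C X \<in> Mor C X X"
    and comp_mor: "\<lbrakk>f \<in> Mor C X Y; g \<in> Mor C Y Z\<rbrakk> \<Longrightarrow> g \<cdot> f \<in> Mor C X Z"
    and comp_id_right: "f \<in> Mor C X Y \<Longrightarrow> f \<cdot> Idm C X = f"
    and comp_id_left: "f \<in> Mor C X Y \<Longrightarrow> Idm C Y \<cdot> f = f"
    and comp_assoc: "\<lbrakk>f \<in> Mor C W X; g \<in> Mor C X Y; h \<in> Mor C Y Z\<rbrakk>
      \<Longrightarrow> h \<cdot> (g \<cdot> f) = (h \<cdot> g) \<cdot> f"

definition is_isomorphism :: "('o, 'm, 'z) cat_struct_scheme \<Rightarrow> 'm \<Rightarrow> bool" where
  "is_isomorphism C f \<longleftrightarrow> (\<exists>g \<in> Mor C (Trg C f) (Src C f).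
     g \<cdot>\<^bsub>C\<^esub> f = Idm C (Src C f) \<and> f \<cdot>\<^bsub>C\<^esub> g = Idm C (Trg C f))"

definition is_mono :: "('o, 'm, 'z) cat_struct_scheme \<Rightarrow> 'm \<Rightarrow> bool" where
  "is_mono C f \<longleftrightarrow> (\<forall>W. \<forall>g \<in> Mor C W (Src C f). \<forall>h \<in> Mor C W (Src C f).
     f \<cdot>\<^bsub>C\<^esub> g = f \<cdot>\<^bsub>C\<^esub> h \<longrightarrow> g = h)"

definition is_epi :: "('o, 'm, 'z) cat_struct_scheme \<Rightarrow> 'm \<Rightarrow> bool" where
  "is_epi C f \<longleftrightarrow> (\<forall>W. \<forall>g \<in> Mor C (Trg C f) W. \<forall>h \<in> Mor C (Trg C f) W.
     g \<cdot>\<^bsub>C\<^esub> f = h \<cdot>\<^bsub>C\<^esub> f \<longrightarrow> g = h)"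

definition is_zero_object :: "('o, 'm, 'z) cat_struct_scheme \<Rightarrow> 'o \<Rightarrow> bool" where
  "is_zero_object C Z \<longleftrightarrow> (\<forall>Y. (\<exists>!f. f \<in> Mor C Z Y) \<and> (\<exists>!f. f \<in> Mor C Y Z))"

definition is_retract_of :: "('o, 'm, 'z) cat_struct_scheme \<Rightarrow> 'o \<Rightarrow> 'o \<Rightarrow> bool" where
  "is_retract_of C Y X \<longleftrightarrow>
     (\<exists>i \<in> Mor C Y X. \<exists>p \<in> Mor C X Y. p \<cdot>\<^bsub>C\<^esub> i = Idm C Y)"


section \<open>Additive and abelian categories\<close>

record ('o, 'm) preadd_struct = "('o, 'm) cat_struct" +
  Zro :: "'o \<Rightarrow> 'o \<Rightarrow> 'm"
  Add :: "'m \<Rightarrow> 'm \<Rightarrow> 'm"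

definition mor_group :: "('o, 'm, 'z) preadd_struct_scheme \<Rightarrow> 'o \<Rightarrow> 'o \<Rightarrow> 'm monoid" where
  "mor_group C X Y = \<lparr>carrier = Mor C X Y, mult = Add C, one = Zro C X Y\<rparr>"

definition Neg :: "('o, 'm, 'z) preadd_struct_scheme \<Rightarrow> 'm \<Rightarrow> 'm" where
  "Neg C f = inv\<^bsub>mor_group C (Src C f) (Trg C f)\<^esub> f"

locale preadditive_category = category C for C (structure) +
  assumes mor_comm_group: "comm_group (mor_group C X Y)"
    and add_comp: "\<lbrakk>f \<in> Mor C X Y; g \<in> Mor C Y Z; g' \<in> Mor C Y Z\<rbrakk>
      \<Longrightarrow> Add C g g' \<cdot> f = Add C (g \<cdot> f) (g' \<cdot> f)"
    and comp_add: "\<lbrakk>f \<in> Mor C X Y; f' \<in> Mor C X Y; g \<in> Mor C Y Z\<rbrakk>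
      \<Longrightarrow> g \<cdot> Add C f f' = Add C (g \<cdot> f) (g \<cdot> f')"

definition is_biproduct :: "('o, 'm, 'z) preadd_struct_scheme \<Rightarrow> 'o \<Rightarrow> 'o \<Rightarrow> 'o \<Rightarrow> bool" where
  "is_biproduct C X Y S \<longleftrightarrow>
     (\<exists>i \<in> Mor C X S. \<exists>j \<in> Mor C Y S. \<exists>p \<in> Mor C S X. \<exists>q \<in> Mor C S Y.
        p \<cdot>\<^bsub>C\<^esub> i = Idm C X \<and> q \<cdot>\<^bsub>C\<^esub> j = Idm C Y \<and>
        p \<cdot>\<^bsub>C\<^esub> j = Zro C Y X \<and> q \<cdot>\<^bsub>C\<^esub> i = Zro C X Y \<and>
        Add C (i \<cdot>\<^bsub>C\<^esub> p) (j \<cdot>\<^bsub>C\<^esub> q) = Idm C S)"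

locale additive_category = preadditive_category C for C (structure) +
  assumes ex_zero_object: "\<exists>Z. is_zero_object C Z"
    and ex_biproduct: "\<exists>S. is_biproduct C X Y S"

definition is_kernel :: "('o, 'm, 'z) preadd_struct_scheme \<Rightarrow> 'm \<Rightarrow> 'm \<Rightarrow> bool" where
  "is_kernel C k f \<longleftrightarrow> Trg C k = Src C f \<and> f \<cdot>\<^bsub>C\<^esub> k = Zro C (Src C k) (Trg C f) \<and>
     (\<forall>W. \<forall>h \<in> Mor C W (Src C f). f \<cdot>\<^bsub>C\<^esub> h = Zro C W (Trg C f) \<longrightarrow>
        (\<exists>!l. l \<in> Mor C W (Src C k) \<and> k \<cdot>\<^bsub>C\<^esub> l = h))"

definition is_cokernel :: "('o, 'm, 'z) preadd_struct_scheme \<Rightarrow> 'm \<Rightarrow> 'm \<Rightarrow> bool" where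
  "is_cokernel C c f \<longleftrightarrow> Src C c = Trg C f \<and> c \<cdot>\<^bsub>C\<^esub> f = Zro C (Src C f) (Trg C c) \<and>
     (\<forall>W. \<forall>h \<in> Mor C (Trg C f) W. h \<cdot>\<^bsub>C\<^esub> f = Zro C (Src C f) W \<longrightarrow>
        (\<exists>!l. l \<in> Mor C (Trg C c) W \<and> l \<cdot>\<^bsub>C\<^esub> c = h))"

locale abelian_category = additive_category C for C (structure) +
  assumes ex_kernel: "\<exists>k. is_kernel C k f"
    and ex_cokernel: "\<exists>c. is_cokernel C c f"
    and mono_is_kernel: "is_mono C m \<Longrightarrow> \<exists>f. is_kernel C m f"
    and epi_is_cokernel: "is_epi C e \<Longrightarrow> \<exists>f. is_cokernel C e f"

text \<open>The image of a morphism of an abelian category, as a subobject \<open>m\<close> of its target.\<close>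

definition is_image :: "('o, 'm, 'z) cat_struct_scheme \<Rightarrow> 'm \<Rightarrow> 'm \<Rightarrow> bool" where
  "is_image A m f \<longleftrightarrow> is_mono A m \<and> Trg A m = Trg A f \<and>
     (\<exists>e \<in> Mor A (Src A f) (Src A m). is_epi A e \<and> f = m \<cdot>\<^bsub>A\<^esub> e)"

text \<open>Exactness of \<open>f\<close>, \<open>g\<close> at the target of \<open>f\<close>: the image of \<open>f\<close> is the kernel of \<open>g\<close>.\<close>

definition exact_at :: "('o, 'm, 'z) preadd_struct_scheme \<Rightarrow> 'm \<Rightarrow> 'm \<Rightarrow> bool" where
  "exact_at A f g \<longleftrightarrow> Trg A f = Src A g \<and> (\<exists>m. is_image A m f \<and> is_kernel A m g)"


section \<open>Triangulated categories\<close>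

text \<open>
  \<open>ShO C n X\<close> is \<open>X[n]\<close> and \<open>ShM C n f\<close> is \<open>f[n]\<close>; the shift is an automorphism, so that its
  powers form an action of the integers. A triangle \<open>X \<rightarrow> Y \<rightarrow> Z \<rightarrow> X[1]\<close> is the triple of its
  three morphisms.
\<close>

record ('o, 'm) tri_struct = "('o, 'm) preadd_struct" +
  ShO :: "int \<Rightarrow> 'o \<Rightarrow> 'o"
  ShM :: "int \<Rightarrow> 'm \<Rightarrow> 'm"
  Dist :: "('m \<times> 'm \<times> 'm) set"

definition is_triangle :: "('o, 'm, 'z) tri_struct_scheme \<Rightarrow> 'm \<times> 'm \<times> 'm \<Rightarrow> bool" where
  "is_triangle C = (\<lambda>(u, v, w).
     Trg C u = Src C v \<and> Trg C v = Src C w \<and> Trg C w = ShO C 1 (Src C u))"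

locale triangulated_category = additive_category C for C (structure) +
  assumes shift_mor: "f \<in> Mor C X Y \<Longrightarrow> ShM C n f \<in> Mor C (ShO C n X) (ShO C n Y)"
    and shift_id: "ShM C n (Idm C X) = Idm C (ShO C n X)"
    and shift_comp: "\<lbrakk>f \<in> Mor C X Y; g \<in> Mor C Y Z\<rbrakk>
      \<Longrightarrow> ShM C n (g \<cdot> f) = ShM C n g \<cdot> ShM C n f"
    and shift_add: "\<lbrakk>f \<in> Mor C X Y; g \<in> Mor C X Y\<rbrakk>
      \<Longrightarrow> ShM C n (Add C f g) = Add C (ShM C n f) (ShM C n g)"
    and shift_obj_0: "ShO C 0 X = X"
    and shift_obj_plus: "ShO C m (ShO C n X) = ShO C (m + n) X"
    and shift_mor_0: "ShM C 0 f = f"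
    and shift_mor_plus: "ShM C m (ShM C n f) = ShM C (m + n) f"
    and dist_triangle: "t \<in> Dist C \<Longrightarrow> is_triangle C t"
    and TR1_id: "is_zero_object C Z \<Longrightarrow> (Idm C X, Zro C X Z, Zro C Z (ShO C 1 X)) \<in> Dist C"
    and TR1_cone: "\<exists>v w. (u, v, w) \<in> Dist C"
    and TR1_iso: "\<lbrakk>(u, v, w) \<in> Dist C; is_triangle C (u', v', w');
        \<alpha> \<in> Mor C (Src C u) (Src C u'); \<beta> \<in> Mor C (Src C v) (Src C v');
        \<gamma> \<in> Mor C (Src C w) (Src C w'); is_isomorphism C \<alpha>; is_isomorphism C \<beta>; is_isomorphism C \<gamma>;
        \<beta> \<cdot> u = u' \<cdot> \<alpha>; \<gamma> \<cdot> v = v' \<cdot> \<beta>; ShM C 1 \<alpha> \<cdot> w = w' \<cdot> \<gamma>\<rbrakk>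
      \<Longrightarrow> (u', v', w') \<in> Dist C"
    and TR2: "is_triangle C (u, v, w)
      \<Longrightarrow> (u, v, w) \<in> Dist C \<longleftrightarrow> (v, w, Neg C (ShM C 1 u)) \<in> Dist C"
    and TR3: "\<lbrakk>(u, v, w) \<in> Dist C; (u', v', w') \<in> Dist C;
        \<alpha> \<in> Mor C (Src C u) (Src C u'); \<beta> \<in> Mor C (Src C v) (Src C v');
        \<beta> \<cdot> u = u' \<cdot> \<alpha>\<rbrakk>
      \<Longrightarrow> \<exists>\<gamma> \<in> Mor C (Src C w) (Src C w'). \<gamma> \<cdot> v = v' \<cdot> \<beta> \<and> ShM C 1 \<alpha> \<cdot> w = w' \<cdot> \<gamma>"
    and TR4: "\<lbrakk>u \<in> Mor C X Y; v \<in> Mor C Y Z;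
        (u, i, i') \<in> Dist C; (v \<cdot> u, k, k') \<in> Dist C; (v, j, j') \<in> Dist C\<rbrakk>
      \<Longrightarrow> \<exists>f \<in> Mor C (Trg C i) (Trg C k). \<exists>g \<in> Mor C (Trg C k) (Trg C j).
            (f, g, ShM C 1 i \<cdot> j') \<in> Dist C \<and>
            f \<cdot> i = k \<cdot> v \<and> k' \<cdot> f = i' \<and> g \<cdot> k = j \<and> j' \<cdot> g = ShM C 1 u \<cdot> k'"


section \<open>Weight structures\<close>

definition perp :: "('o, 'm, 'z) preadd_struct_scheme \<Rightarrow> 'o set \<Rightarrow> 'o set \<Rightarrow> bool" where
  "perp C D E \<longleftrightarrow> (\<forall>X \<in> D. \<forall>Y \<in> E. Mor C X Y = {Zro C X Y})"

definition additive_class :: "('o, 'm, 'z) preadd_struct_scheme \<Rightarrow> 'o set \<Rightarrow> bool" where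
  "additive_class C D \<longleftrightarrow> (\<forall>Z. is_zero_object C Z \<longrightarrow> Z \<in> D) \<and>
     (\<forall>X \<in> D. \<forall>Y \<in> D. \<forall>S. is_biproduct C X Y S \<longrightarrow> S \<in> D)"

definition Karoubi_closed :: "('o, 'm, 'z) cat_struct_scheme \<Rightarrow> 'o set \<Rightarrow> bool" where
  "Karoubi_closed C D \<longleftrightarrow> (\<forall>X \<in> D. \<forall>Y. is_retract_of C Y X \<longrightarrow> Y \<in> D)"

text \<open>\<open>Wle\<close> and \<open>Wge\<close> are the classes of weight \<open>\<le> 0\<close> and \<open>\<ge> 0\<close> (cohomological convention).\<close>

locale weight_structure = triangulated_category C for C (structure) +
  fixes Wle Wge :: "'a set"
  assumes additive_le: "additive_class C Wle"
    and additive_ge: "additive_class C Wge"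
    and Karoubi_le: "Karoubi_closed C Wle"
    and Karoubi_ge: "Karoubi_closed C Wge"
    and semi_invariance_ge: "Wge \<subseteq> ShO C 1 ` Wge"
    and semi_invariance_le: "ShO C 1 ` Wle \<subseteq> Wle"
    and orthogonality: "perp C Wge (ShO C 1 ` Wle)"
    and ex_weight_decomposition: "\<exists>A \<in> Wle. \<exists>B \<in> Wge.
      \<exists>u \<in> Mor C (ShO C (-1) B) X. \<exists>v \<in> Mor C X A. \<exists>w \<in> Mor C A B. (u, v, w) \<in> Dist C"

text \<open>
  For \<open>W\<close> one of the two classes, \<open>W[-l]\<close> is the class of objects of weight \<open>\<le> l\<close> respectively
  \<open>\<ge> l\<close>.
\<close>

definition weight_class :: "('o, 'm, 'z) tri_struct_scheme \<Rightarrow> 'o set \<Rightarrow> int \<Rightarrow> 'o set" where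
  "weight_class C W l = ShO C (- l) ` W"

definition weight_bounded :: "('o, 'm, 'z) tri_struct_scheme \<Rightarrow> 'o set \<Rightarrow> 'o set" where
  "weight_bounded C W = (\<Union>i. weight_class C W i)"


section \<open>Weight Postnikov towers\<close>

text \<open>
  For an object \<open>X\<close>, the components of a tower \<open>P\<close> are
  \<^item> objects \<open>LE P k\<close>, \<open>GE P k\<close>, \<open>GR P k\<close>, i.e. \<open>X\<^sup>w\<^sup>\<le>\<^sup>k\<close>, \<open>X\<^sup>w\<^sup>\<ge>\<^sup>k\<close> and \<open>X\<^sup>k\<close>;
  \<^item> \<open>aT P k : X[k] \<rightarrow> LE P k\<close>, \<open>fT P k : LE P k \<rightarrow> GE P (k+1)\<close> and
    \<open>bT P (k+1) : GE P (k+1) \<rightarrow> X[k+1]\<close>, the weight decomposition of \<open>X[k]\<close>;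
  \<^item> the connecting morphisms \<open>sT P k : LE P k [-1] \<rightarrow> LE P (k-1)\<close> and
    \<open>tT P k : GE P (k+1) [-1] \<rightarrow> GE P k\<close>;
  \<^item> \<open>cT P k : LE P (k-1) \<rightarrow> GR P k\<close>, \<open>dT P k : GR P k \<rightarrow> LE P k\<close>,
    \<open>xT P k : GR P k [-1] \<rightarrow> GE P (k+1) [-1]\<close>, \<open>yT P k : GE P k \<rightarrow> GR P k\<close>.
\<close>

record ('o, 'm) tower =
  LE :: "int \<Rightarrow> 'o"
  GE :: "int \<Rightarrow> 'o"
  GR :: "int \<Rightarrow> 'o"
  aT :: "int \<Rightarrow> 'm"
  fT :: "int \<Rightarrow> 'm"
  bT :: "int \<Rightarrow> 'm"
  sT :: "int \<Rightarrow> 'm"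
  tT :: "int \<Rightarrow> 'm"
  cT :: "int \<Rightarrow> 'm"
  dT :: "int \<Rightarrow> 'm"
  xT :: "int \<Rightarrow> 'm"
  yT :: "int \<Rightarrow> 'm"

text \<open>
  A weight decomposition of \<open>X[k]\<close> appears here in its rotated form
  \<open>X[k] \<rightarrow> A \<rightarrow> B \<rightarrow> X[k+1]\<close>. Compatibility of \<open>sT\<close>, \<open>tT\<close> with the decompositions and the identity
  of \<open>X\<close> means that they commute with the morphisms from and to the shifts of \<open>X\<close>. The sign in the
  remaining square is the one of the shift \<open>(a[-1], -f[-1], b[-1])\<close> of a distinguished triangle
  \<open>(a, f, b)\<close>; the triple \<open>(a[-1], f[-1], b[-1])\<close> need not be distinguished. The equation for
  \<open>xT\<close>, which carries no sign, relies on this choice.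
\<close>

definition weight_postnikov_tower ::
  "('o, 'm, 'z) tri_struct_scheme \<Rightarrow> 'o set \<Rightarrow> 'o set \<Rightarrow> 'o \<Rightarrow> ('o, 'm) tower \<Rightarrow> bool" where
  "weight_postnikov_tower C Wle Wge X P \<longleftrightarrow> (\<forall>k.
     LE P k \<in> Wle \<and> GE P k \<in> Wge \<and> GR P k \<in> Wle \<inter> Wge \<and>
     aT P k \<in> Mor C (ShO C k X) (LE P k) \<and>
     fT P k \<in> Mor C (LE P k) (GE P (k + 1)) \<and>
     bT P k \<in> Mor C (GE P k) (ShO C k X) \<and>
     (aT P k, fT P k, bT P (k + 1)) \<in> Dist C \<and>
     sT P k \<in> Mor C (ShO C (-1) (LE P k)) (LE P (k - 1)) \<and>
     tT P k \<in> Mor C (ShO C (-1) (GE P (k + 1))) (GE P k) \<and>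
     sT P k \<cdot>\<^bsub>C\<^esub> ShM C (-1) (aT P k) = aT P (k - 1) \<and>
     bT P k \<cdot>\<^bsub>C\<^esub> tT P k = ShM C (-1) (bT P (k + 1)) \<and>
     tT P k \<cdot>\<^bsub>C\<^esub> Neg C (ShM C (-1) (fT P k)) = fT P (k - 1) \<cdot>\<^bsub>C\<^esub> sT P k \<and>
     cT P k \<in> Mor C (LE P (k - 1)) (GR P k) \<and>
     dT P k \<in> Mor C (GR P k) (LE P k) \<and>
     xT P k \<in> Mor C (ShO C (-1) (GR P k)) (ShO C (-1) (GE P (k + 1))) \<and>
     yT P k \<in> Mor C (GE P k) (GR P k) \<and>
     (sT P k, cT P k, dT P k) \<in> Dist C \<and>
     (xT P k, tT P k, yT P k) \<in> Dist C \<and>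
     cT P k = yT P k \<cdot>\<^bsub>C\<^esub> fT P (k - 1) \<and>
     xT P k = ShM C (-1) (fT P k \<cdot>\<^bsub>C\<^esub> dT P k))"

text \<open>The differential \<open>X\<^sup>i \<rightarrow> X\<^sup>i\<^sup>+\<^sup>1\<close> of the weight complex, whose terms are \<open>GR P i\<close>.\<close>

definition weight_complex_diff ::
  "('o, 'm, 'z) tri_struct_scheme \<Rightarrow> ('o, 'm) tower \<Rightarrow> int \<Rightarrow> 'm" where
  "weight_complex_diff C P i = cT P (i + 1) \<cdot>\<^bsub>C\<^esub> dT P i"

text \<open>
  A lift of \<open>g : X \<rightarrow> X'\<close> to the parts of towers \<open>P\<close> of \<open>X\<close> and \<open>P'\<close> of \<open>X'\<close> from which the exact
  couple below is formed: \<open>u k : LE P k \<rightarrow> LE P' k\<close> and \<open>m k : GR P k \<rightarrow> GR P' k\<close>.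
\<close>

definition tower_lift ::
  "('o, 'm, 'z) tri_struct_scheme \<Rightarrow> ('o, 'm) tower \<Rightarrow> ('o, 'm) tower \<Rightarrow> 'm
    \<Rightarrow> (int \<Rightarrow> 'm) \<Rightarrow> (int \<Rightarrow> 'm) \<Rightarrow> bool" where
  "tower_lift C P P' g u m \<longleftrightarrow> (\<forall>k.
     u k \<in> Mor C (LE P k) (LE P' k) \<and>
     m k \<in> Mor C (GR P k) (GR P' k) \<and>
     u k \<cdot>\<^bsub>C\<^esub> aT P k = aT P' k \<cdot>\<^bsub>C\<^esub> ShM C k g \<and>
     u (k - 1) \<cdot>\<^bsub>C\<^esub> sT P k = sT P' k \<cdot>\<^bsub>C\<^esub> ShM C (-1) (u k) \<and>
     m k \<cdot>\<^bsub>C\<^esub> cT P k = cT P' k \<cdot>\<^bsub>C\<^esub> u (k - 1) \<and>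
     u k \<cdot>\<^bsub>C\<^esub> dT P k = dT P' k \<cdot>\<^bsub>C\<^esub> m k)"


section \<open>Cohomological functors\<close>

record ('o, 'm, 'a, 'b) functor_data =
  FO :: "'o \<Rightarrow> 'a"
  FM :: "'m \<Rightarrow> 'b"

definition contravariant_additive_functor ::
  "('o, 'm, 'z) preadd_struct_scheme \<Rightarrow> ('a, 'b, 'y) preadd_struct_scheme
    \<Rightarrow> ('o, 'm, 'a, 'b) functor_data \<Rightarrow> bool" where
  "contravariant_additive_functor C A H \<longleftrightarrow>
     (\<forall>X Y. \<forall>f \<in> Mor C X Y. FM H f \<in> Mor A (FO H Y) (FO H X)) \<and>
     (\<forall>X. FM H (Idm C X) = Idm A (FO H X)) \<and>
     (\<forall>X Y Z. \<forall>f \<in> Mor C X Y. \<forall>g \<in> Mor C Y Z.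
        FM H (g \<cdot>\<^bsub>C\<^esub> f) = FM H f \<cdot>\<^bsub>A\<^esub> FM H g) \<and>
     (\<forall>X Y. \<forall>f \<in> Mor C X Y. \<forall>g \<in> Mor C X Y.
        FM H (Add C f g) = Add A (FM H f) (FM H g))"

text \<open>
  The long sequence of a triangle is
  \<open>\<dots> \<rightarrow> H(X[n+1]) \<rightarrow> H(Z[n]) \<rightarrow> H(Y[n]) \<rightarrow> H(X[n]) \<rightarrow> \<dots>\<close>.
\<close>

definition cohomological_functor ::
  "('o, 'm, 'z) tri_struct_scheme \<Rightarrow> ('a, 'b, 'y) preadd_struct_scheme
    \<Rightarrow> ('o, 'm, 'a, 'b) functor_data \<Rightarrow> bool" where
  "cohomological_functor C A H \<longleftrightarrow> contravariant_additive_functor C A H \<and>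
     (\<forall>(u, v, w) \<in> Dist C. \<forall>n.
        exact_at A (FM H (ShM C n v)) (FM H (ShM C n u)) \<and>
        exact_at A (FM H (ShM C n w)) (FM H (ShM C n v)) \<and>
        exact_at A (FM H (ShM C (n + 1) u)) (FM H (ShM C n w)))"

text \<open>The functor \<open>H\<^sup>n\<close>, i.e. \<open>Y \<mapsto> H(Y[-n])\<close>.\<close>

definition coh_shift ::
  "('o, 'm, 'z) tri_struct_scheme \<Rightarrow> ('o, 'm, 'a, 'b) functor_data \<Rightarrow> int
    \<Rightarrow> ('o, 'm, 'a, 'b) functor_data" where
  "coh_shift C H n = \<lparr>FO = (\<lambda>Y. FO H (ShO C (- n) Y)), FM = (\<lambda>f. FM H (ShM C (- n) f))\<rparr>"

definition vanishes_on ::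
  "('a, 'b, 'y) cat_struct_scheme \<Rightarrow> ('o, 'm, 'a, 'b) functor_data \<Rightarrow> 'o set \<Rightarrow> bool" where
  "vanishes_on A H D \<longleftrightarrow> (\<forall>Y \<in> D. is_zero_object A (FO H Y))"

definition natural_transformation ::
  "('o, 'm, 'z) cat_struct_scheme \<Rightarrow> ('a, 'b, 'y) cat_struct_scheme
    \<Rightarrow> ('o, 'm, 'a, 'b) functor_data \<Rightarrow> ('o, 'm, 'a, 'b) functor_data \<Rightarrow> ('o \<Rightarrow> 'b) \<Rightarrow> bool" where
  "natural_transformation C A H H' \<tau> \<longleftrightarrow>
     (\<forall>Y. \<tau> Y \<in> Mor A (FO H Y) (FO H' Y)) \<and>
     (\<forall>X Y. \<forall>f \<in> Mor C X Y. \<tau> X \<cdot>\<^bsub>A\<^esub> FM H f = FM H' f \<cdot>\<^bsub>A\<^esub> \<tau> Y)"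

text \<open>
  \<open>m\<close> represents the subobject \<open>W\<^sup>i(H)(X)\<close> of \<open>H(X)\<close>: the image of \<open>H\<close> applied to the morphism
  \<open>aT P i [-i]\<close> from \<open>X\<close> to \<open>w\<^sub>\<le>\<^sub>i X = LE P i [-i]\<close>.
\<close>

definition is_weight_filtration ::
  "('o, 'm, 'z) tri_struct_scheme \<Rightarrow> ('a, 'b, 'y) preadd_struct_scheme
    \<Rightarrow> ('o, 'm, 'a, 'b) functor_data \<Rightarrow> ('o, 'm) tower \<Rightarrow> int \<Rightarrow> 'b \<Rightarrow> bool" where
  "is_weight_filtration C A H P i m \<longleftrightarrow> is_image A m (FM H (ShM C (- i) (aT P i)))"


section \<open>Spectral sequences\<close>

text \<open>
  \<open>Eo T r p q\<close> is the term \<open>E\<^sub>r\<^sup>p\<^sup>q\<close> and \<open>dm T r p q : E\<^sub>r\<^sup>p\<^sup>q \<rightarrow> E\<^sub>r\<^sup>p\<^sup>+\<^sup>r\<^sup>,\<^sup>q\<^sup>-\<^sup>r\<^sup>+\<^sup>1\<close> its differential,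
  for \<open>r \<ge> 1\<close> (values at \<open>r = 0\<close> are irrelevant). The identification of the next page with the
  cohomology of \<open>dm\<close> is part of the data: \<open>zm T r p q\<close> is the inclusion into \<open>E\<^sub>r\<^sup>p\<^sup>q\<close> of the
  cycles, and \<open>em T r p q\<close> is the quotient map from the cycles to \<open>Eo T (r + 1) p q\<close>.
\<close>

record ('a, 'b) spec_seq =
  Eo :: "nat \<Rightarrow> int \<Rightarrow> int \<Rightarrow> 'a"
  dm :: "nat \<Rightarrow> int \<Rightarrow> int \<Rightarrow> 'b"
  zm :: "nat \<Rightarrow> int \<Rightarrow> int \<Rightarrow> 'b"
  em :: "nat \<Rightarrow> int \<Rightarrow> int \<Rightarrow> 'b"

definition spectral_sequence ::
  "('a, 'b, 'y) preadd_struct_scheme \<Rightarrow> ('a, 'b) spec_seq \<Rightarrow> bool" where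
  "spectral_sequence A T \<longleftrightarrow> (\<forall>r \<ge> 1. \<forall>p q.
     dm T r p q \<in> Mor A (Eo T r p q) (Eo T r (p + int r) (q - int r + 1)) \<and>
     dm T r (p + int r) (q - int r + 1) \<cdot>\<^bsub>A\<^esub> dm T r p q =
       Zro A (Eo T r p q) (Eo T r (p + 2 * int r) (q - 2 * int r + 2)) \<and>
     is_kernel A (zm T r p q) (dm T r p q) \<and>
     Trg A (em T r p q) = Eo T (r + 1) p q \<and>
     (\<exists>l \<in> Mor A (Eo T r (p - int r) (q + int r - 1)) (Src A (zm T r p q)).
        zm T r p q \<cdot>\<^bsub>A\<^esub> l = dm T r (p - int r) (q + int r - 1) \<and>
        is_cokernel A (em T r p q) l))"

text \<open>
  \<open>f : E\<^sub>r\<^sup>p\<^sup>q(T) \<rightarrow> E\<^sub>r\<^sup>p\<^sup>q(T')\<close> restricts to cycles and induces \<open>f'\<close> on the next page.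
\<close>

definition induces_on_next_page ::
  "('a, 'b, 'y) cat_struct_scheme \<Rightarrow> ('a, 'b) spec_seq \<Rightarrow> ('a, 'b) spec_seq
    \<Rightarrow> nat \<Rightarrow> int \<Rightarrow> int \<Rightarrow> 'b \<Rightarrow> 'b \<Rightarrow> bool" where
  "induces_on_next_page A T T' r p q f f' \<longleftrightarrow>
     f \<in> Mor A (Eo T r p q) (Eo T' r p q) \<and>
     f' \<in> Mor A (Eo T (r + 1) p q) (Eo T' (r + 1) p q) \<and>
     (\<exists>l \<in> Mor A (Src A (zm T r p q)) (Src A (zm T' r p q)).
        zm T' r p q \<cdot>\<^bsub>A\<^esub> l = f \<cdot>\<^bsub>A\<^esub> zm T r p q \<and>
        f' \<cdot>\<^bsub>A\<^esub> em T r p q = em T' r p q \<cdot>\<^bsub>A\<^esub> l)"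

text \<open>Morphisms of spectral sequences that are defined from the page \<open>E\<^sub>s\<close> on.\<close>

definition spec_seq_morphism ::
  "('a, 'b, 'y) cat_struct_scheme \<Rightarrow> nat \<Rightarrow> ('a, 'b) spec_seq \<Rightarrow> ('a, 'b) spec_seq
    \<Rightarrow> (nat \<Rightarrow> int \<Rightarrow> int \<Rightarrow> 'b) \<Rightarrow> bool" where
  "spec_seq_morphism A s T T' F \<longleftrightarrow> (\<forall>r \<ge> s. \<forall>p q.
     F r p q \<in> Mor A (Eo T r p q) (Eo T' r p q) \<and>
     F r (p + int r) (q - int r + 1) \<cdot>\<^bsub>A\<^esub> dm T r p q = dm T' r p q \<cdot>\<^bsub>A\<^esub> F r p q \<and>
     induces_on_next_page A T T' r p q (F r p q) (F (r + 1) p q))"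

text \<open>
  Convergence of \<open>T\<close> to the graded object \<open>L\<close>, with respect to a decreasing filtration of each
  \<open>L n\<close> by subobjects \<open>F n p\<close>: the filtrations are finite, and for all \<open>p\<close>, \<open>q\<close> the differentials
  into and out of \<open>E\<^sub>r\<^sup>p\<^sup>q\<close> vanish for all \<open>r \<ge> R\<close>, with stable value \<open>E\<^sub>R\<^sup>p\<^sup>q\<close> the quotient
  of \<open>F (p+q) p\<close> by \<open>F (p+q) (p+1)\<close>.
\<close>

definition converges_to ::
  "('a, 'b, 'y) preadd_struct_scheme \<Rightarrow> ('a, 'b) spec_seq \<Rightarrow> (int \<Rightarrow> 'a)
    \<Rightarrow> (int \<Rightarrow> int \<Rightarrow> 'b) \<Rightarrow> bool" where
  "converges_to A T L F \<longleftrightarrow>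
     (\<forall>n p. is_mono A (F n p) \<and> Trg A (F n p) = L n) \<and>
     (\<forall>n. \<exists>p0 p1. (\<forall>p \<le> p0. is_isomorphism A (F n p)) \<and> (\<forall>p \<ge> p1. is_zero_object A (Src A (F n p)))) \<and>
     (\<forall>p q. \<exists>R \<ge> 1.
        (\<forall>r \<ge> R.
           dm T r p q = Zro A (Eo T r p q) (Eo T r (p + int r) (q - int r + 1)) \<and>
           dm T r (p - int r) (q + int r - 1) =
             Zro A (Eo T r (p - int r) (q + int r - 1)) (Eo T r p q)) \<and>
        (\<exists>l \<in> Mor A (Src A (F (p + q) (p + 1))) (Src A (F (p + q) p)).
           F (p + q) p \<cdot>\<^bsub>A\<^esub> l = F (p + q) (p + 1) \<and>
           (\<exists>c \<in> Mor A (Src A (F (p + q) p)) (Eo T R p q). is_cokernel A c l)))"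


section \<open>Exact couples\<close>

text \<open>
  A bigraded exact couple of degree \<open>n\<close>, with \<open>jc K \<cdot> kc K\<close> of bidegree \<open>(n, 1 - n)\<close>:
  \<open>ic K p q : D\<^sup>p\<^sup>q \<rightarrow> D\<^sup>p\<^sup>-\<^sup>1\<^sup>,\<^sup>q\<^sup>+\<^sup>1\<close>, \<open>jc K p q : D\<^sup>p\<^sup>q \<rightarrow> E\<^sup>p\<^sup>+\<^sup>n\<^sup>-\<^sup>1\<^sup>,\<^sup>q\<^sup>-\<^sup>n\<^sup>+\<^sup>1\<close> and
  \<open>kc K p q : E\<^sup>p\<^sup>q \<rightarrow> D\<^sup>p\<^sup>+\<^sup>1\<^sup>,\<^sup>q\<close>.
\<close>

record ('a, 'b) couple =
  Dc :: "int \<Rightarrow> int \<Rightarrow> 'a"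
  Ec :: "int \<Rightarrow> int \<Rightarrow> 'a"
  ic :: "int \<Rightarrow> int \<Rightarrow> 'b"
  jc :: "int \<Rightarrow> int \<Rightarrow> 'b"
  kc :: "int \<Rightarrow> int \<Rightarrow> 'b"

definition exact_couple ::
  "('a, 'b, 'y) preadd_struct_scheme \<Rightarrow> int \<Rightarrow> ('a, 'b) couple \<Rightarrow> bool" where
  "exact_couple A n K \<longleftrightarrow> (\<forall>p q.
     ic K p q \<in> Mor A (Dc K p q) (Dc K (p - 1) (q + 1)) \<and>
     jc K p q \<in> Mor A (Dc K p q) (Ec K (p + n - 1) (q - n + 1)) \<and>
     kc K p q \<in> Mor A (Ec K p q) (Dc K (p + 1) q) \<and>
     exact_at A (ic K (p + 1) (q - 1)) (jc K p q) \<and>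
     exact_at A (jc K (p - n + 1) (q + n - 1)) (kc K p q) \<and>
     exact_at A (kc K (p - 1) q) (ic K p q))"

text \<open>
  \<open>K'\<close> is the derived couple of the couple \<open>K\<close> of degree \<open>n\<close>, where \<open>z\<close> and \<open>e\<close> exhibit \<open>Ec K'\<close>
  as the cohomology of \<open>jc K \<cdot> kc K\<close>. The object \<open>Dc K' p q\<close> is the image in \<open>Dc K p q\<close> of \<open>ic K\<close>,
  via the factorisation \<open>ic K = \<mu> \<cdot> \<pi>\<close>; \<open>ic K'\<close> is the restriction of \<open>ic K\<close>, \<open>jc K'\<close> maps the
  class \<open>\<pi>(x)\<close> to the class of \<open>jc K (x)\<close>, and \<open>kc K'\<close> maps the class of a cycle \<open>x\<close> to \<open>kc K (x)\<close>.
\<close>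

definition derived_couple ::
  "('a, 'b, 'y) cat_struct_scheme \<Rightarrow> int \<Rightarrow> ('a, 'b) couple
    \<Rightarrow> (int \<Rightarrow> int \<Rightarrow> 'b) \<Rightarrow> (int \<Rightarrow> int \<Rightarrow> 'b) \<Rightarrow> ('a, 'b) couple \<Rightarrow> bool" where
  "derived_couple A n K z e K' \<longleftrightarrow> (\<exists>\<pi> \<mu>. \<forall>p q.
     \<pi> p q \<in> Mor A (Dc K p q) (Dc K' (p - 1) (q + 1)) \<and> is_epi A (\<pi> p q) \<and>
     \<mu> p q \<in> Mor A (Dc K' p q) (Dc K p q) \<and> is_mono A (\<mu> p q) \<and>
     ic K p q = \<mu> (p - 1) (q + 1) \<cdot>\<^bsub>A\<^esub> \<pi> p q \<and>
     ic K' p q = \<pi> p q \<cdot>\<^bsub>A\<^esub> \<mu> p q \<and>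
     kc K' p q \<in> Mor A (Ec K' p q) (Dc K' (p + 1) q) \<and>
     \<mu> (p + 1) q \<cdot>\<^bsub>A\<^esub> (kc K' p q \<cdot>\<^bsub>A\<^esub> e p q) = kc K p q \<cdot>\<^bsub>A\<^esub> z p q \<and>
     jc K' p q \<in> Mor A (Dc K' p q) (Ec K' (p + n) (q - n)) \<and>
     (\<exists>l \<in> Mor A (Dc K p q) (Src A (z (p + n - 1) (q - n + 1))).
        z (p + n - 1) (q - n + 1) \<cdot>\<^bsub>A\<^esub> l = jc K p q \<and>
        jc K' (p - 1) (q + 1) \<cdot>\<^bsub>A\<^esub> \<pi> p q = e (p + n - 1) (q - n + 1) \<cdot>\<^bsub>A\<^esub> l))"

definition spec_seq_of_couple ::
  "('a, 'b, 'y) preadd_struct_scheme \<Rightarrow> ('a, 'b) couple \<Rightarrow> ('a, 'b) spec_seq \<Rightarrow> bool" where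
  "spec_seq_of_couple A K T \<longleftrightarrow> spectral_sequence A T \<and>
     (\<exists>Ks :: nat \<Rightarrow> ('a, 'b) couple. Ks 1 = K \<and> (\<forall>r \<ge> 1.
        exact_couple A (int r) (Ks r) \<and>
        Eo T r = Ec (Ks r) \<and>
        (\<forall>p q. dm T r p q = jc (Ks r) (p + 1) q \<cdot>\<^bsub>A\<^esub> kc (Ks r) p q) \<and>
        derived_couple A (int r) (Ks r) (zm T r) (em T r) (Ks (r + 1))))"

text \<open>
  The couple obtained by applying \<open>H\<close> to the distinguished triangles \<open>(sT P k, cT P k, dT P k)\<close>,
  with \<open>D\<^sup>p\<^sup>q = H\<^sup>q(LE P (-p))\<close> and \<open>E\<^sup>p\<^sup>q = H\<^sup>q(GR P (-p))\<close>. Note that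
  \<open>H\<^sup>q(LE P k [-1]) = H\<^sup>q\<^sup>+\<^sup>1(LE P k)\<close>.
\<close>

definition weight_couple ::
  "('o, 'm, 'z) tri_struct_scheme \<Rightarrow> ('o, 'm, 'a, 'b) functor_data \<Rightarrow> ('o, 'm) tower
    \<Rightarrow> ('a, 'b) couple" where
  "weight_couple C H P = \<lparr>
     Dc = (\<lambda>p q. FO (coh_shift C H q) (LE P (- p))),
     Ec = (\<lambda>p q. FO (coh_shift C H q) (GR P (- p))),
     ic = (\<lambda>p q. FM (coh_shift C H q) (sT P (1 - p))),
     jc = (\<lambda>p q. FM (coh_shift C H q) (dT P (- p))),
     kc = (\<lambda>p q. FM (coh_shift C H q) (cT P (- p)))\<rparr>"

definition weight_spec_seq ::
  "('o, 'm, 'z) tri_struct_scheme \<Rightarrow> ('a, 'b, 'y) preadd_struct_scheme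
    \<Rightarrow> ('o, 'm, 'a, 'b) functor_data \<Rightarrow> ('o, 'm) tower \<Rightarrow> ('a, 'b) spec_seq \<Rightarrow> bool" where
  "weight_spec_seq C A H P T \<longleftrightarrow> spec_seq_of_couple A (weight_couple C H P) T"

end

theory Submission
  imports Defs
begin

text \<open>
  Applying \<open>H\<close> to the triangles \<open>LE P k [-1] \<rightarrow> LE P (k - 1) \<rightarrow> GR P k \<rightarrow> LE P k\<close> gives an exact couple,
  and iterated derivation gives the spectral sequence.

  For convergence, the maps \<open>X \<rightarrow> LE P k [-k]\<close> induce maps \<open>\<alpha>\<close> from the \<open>D\<close>-terms to \<open>H\<^sup>n(X)\<close> whose
  images are the weight filtration. In each of the listed cases \<open>i\<close> and \<open>\<alpha>\<close> vanish at one end of each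
  diagonal, and at the other end \<open>\<alpha>\<close> is epi and its kernel is killed by \<open>i\<close>. If the boundedness
  comes from \<open>X\<close>, the objects \<open>LE P k\<close> (respectively \<open>GE P k\<close>) need not be eventually trivial, but
  they are eventually retracts of \<open>GE P (k + 1)\<close> (of \<open>LE P (k - 1)\<close>), hence of weight \<open>0\<close>, and
  orthogonality forces \<open>sT P k = 0\<close> (\<open>tT P k = 0\<close>). So for large \<open>r\<close> the map \<open>k\<close> of the derived couple vanishes at \<open>E\<^sub>r\<^sup>p\<^sup>q\<close>, and \<open>E\<^sub>r\<^sup>p\<^sup>q\<close> is the cokernel of the
  map \<open>i\<close> of the derived couple, which is identified with the inclusion of \<open>F\<^sup>p\<^sup>+\<^sup>1\<close> into \<open>F\<^sup>p\<close>.

  Functoriality in \<open>X\<close> comes from lifting \<open>g\<close> to the towers. By orthogonality the maps \<open>LE P k \<rightarrow> LE P' k\<close>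
  exist and commute with \<open>sT\<close>, and two lifts differ on \<open>GR P k\<close> by a null-homotopic term, so that the
  induced map on \<open>E\<^sub>2\<close> is independent of the lift.
\<close>

section \<open>Preadditive categories\<close>

text \<open>Derived couples are determined only up to isomorphism, so a weight spectral sequence is
  any \<open>T\<close> that admits some chain of derived couples, and maps between two such must not
  depend on the chains. They do not: cycles include into a page by a mono and project onto the next
  page by an epi, so the map on one page forces the map on the next, and a morphism is known as soon
  as one of its pages is known. For transformations of functors that page is E_1. For morphisms of
  objects it is E_2, because a lift to towers is unique only up to homotopy. Identities, composites
  and independence of the tower are all checked on this single page.

  Convergence is proved for an arbitrary couple with maps \<alpha> from its \<open>D\<close>-terms
  to a graded object that are compatible with \<open>i\<close>. Each end of the diagonals needs one
  condition, and the two are independent of each other: either one may be supplied by a bound on the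
  weights of \<open>X\<close> or by vanishing of \<open>H\<close>. The listed cases are the four
  combinations.\<close>

lemma mem_Mor: "f \<in> Mor C X Y \<longleftrightarrow> Src C f = X \<and> Trg C f = Y"
  by (simp add: Mor_def)

context category
begin

lemma src_trg_id [simp]: "Src C (Idm C X) = X" "Trg C (Idm C X) = X"
  using id_mor[of X] by (simp_all add: mem_Mor)

lemma src_trg_comp [simp]:
  assumes "Trg C f = Src C g"
  shows "Src C (g \<cdot> f) = Src C f" "Trg C (g \<cdot> f) = Trg C g"
  using comp_mor[of f "Src C f" "Trg C f" g "Trg C g"] assms by (simp_all add: mem_Mor)

lemma comp_assoc' [simp]:
  "\<lbrakk>Trg C f = Src C g; Trg C g = Src C h\<rbrakk> \<Longrightarrow> (h \<cdot> g) \<cdot> f = h \<cdot> (g \<cdot> f)"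
  using comp_assoc[of f "Src C f" "Trg C f" g "Trg C g" h "Trg C h"] by (simp add: mem_Mor)

lemma comp_id [simp]:
  "Src C f = X \<Longrightarrow> f \<cdot> Idm C X = f" "Trg C f = X \<Longrightarrow> Idm C X \<cdot> f = f"
  using comp_id_right[of f X "Trg C f"] comp_id_left[of f "Src C f" X] by (simp_all add: mem_Mor)

text \<open>Simplification associates composites to the right, so an equation for
  \<open>g \<cdot> f\<close> no longer matches inside \<open>g \<cdot> (f \<cdot> x)\<close>. This
  form makes it applicable there and is used in most computations below.\<close>

lemma comp_eq_left:
  "\<lbrakk>g \<cdot> f = h; Trg C f = Src C g; Trg C x = Src C f\<rbrakk> \<Longrightarrow> g \<cdot> (f \<cdot> x) = h \<cdot> x"
  by (metis comp_assoc')

lemma is_mono_iff: "is_mono C m \<longleftrightarrow>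
    (\<forall>g h. Trg C g = Src C m \<longrightarrow> Trg C h = Src C m \<longrightarrow> Src C g = Src C h \<longrightarrow> m \<cdot> g = m \<cdot> h \<longrightarrow> g = h)"
  by (simp add: is_mono_def Ball_def mem_Mor) metis

lemma is_epi_iff: "is_epi C e \<longleftrightarrow>
    (\<forall>g h. Src C g = Trg C e \<longrightarrow> Src C h = Trg C e \<longrightarrow> Trg C g = Trg C h \<longrightarrow> g \<cdot> e = h \<cdot> e \<longrightarrow> g = h)"
  by (simp add: is_epi_def Ball_def mem_Mor) metis

lemma monoD:
  "\<lbrakk>is_mono C m; m \<cdot> g = m \<cdot> h; Trg C g = Src C m; Trg C h = Src C m; Src C g = Src C h\<rbrakk>
    \<Longrightarrow> g = h"
  by (simp add: is_mono_iff)

lemma epiD: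
  "\<lbrakk>is_epi C e; g \<cdot> e = h \<cdot> e; Src C g = Trg C e; Src C h = Trg C e; Trg C g = Trg C h\<rbrakk>
    \<Longrightarrow> g = h"
  by (simp add: is_epi_iff)

lemma id_mono [simp]: "is_mono C (Idm C X)"
  and id_epi [simp]: "is_epi C (Idm C X)"
  by (simp_all add: is_mono_iff is_epi_iff)

lemma mono_comp:
  assumes "is_mono C m" "is_mono C n" "Trg C n = Src C m"
  shows "is_mono C (m \<cdot> n)"
  unfolding is_mono_iff
proof (intro allI impI)
  fix g h assume "Trg C g = Src C (m \<cdot> n)" "Trg C h = Src C (m \<cdot> n)" "Src C g = Src C h"
    "(m \<cdot> n) \<cdot> g = (m \<cdot> n) \<cdot> h"
  then show "g = h"
    using assms(3) monoD[OF assms(1), of "n \<cdot> g" "n \<cdot> h"] monoD[OF assms(2), of g h] by simp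
qed

lemma epi_comp:
  assumes "is_epi C e" "is_epi C f" "Trg C f = Src C e"
  shows "is_epi C (e \<cdot> f)"
  unfolding is_epi_iff
proof (intro allI impI)
  fix g h assume "Src C g = Trg C (e \<cdot> f)" "Src C h = Trg C (e \<cdot> f)" "Trg C g = Trg C h"
    "g \<cdot> (e \<cdot> f) = h \<cdot> (e \<cdot> f)"
  then show "g = h"
    using assms(3) epiD[OF assms(2), of "g \<cdot> e" "h \<cdot> e"] epiD[OF assms(1), of g h] by simp
qed

lemma epi_cancel:
  assumes "is_epi C (e \<cdot> f)" "Trg C f = Src C e"
  shows "is_epi C e"
  unfolding is_epi_iff
proof (intro allI impI)
  fix g h assume "Src C g = Trg C e" "Src C h = Trg C e" "Trg C g = Trg C h" "g \<cdot> e = h \<cdot> e"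
  then show "g = h"
    using assms(2) epiD[OF assms(1), of g h] by (simp flip: comp_assoc')
qed

end

context preadditive_category
begin

lemma mor_group_simps [simp]:
  "carrier (mor_group C X Y) = Mor C X Y"
  "f \<otimes>\<^bsub>mor_group C X Y\<^esub> g = Add C f g"
  "\<one>\<^bsub>mor_group C X Y\<^esub> = Zro C X Y"
  by (simp_all add: mor_group_def)

lemma src_trg_zero [simp]: "Src C (Zro C X Y) = X" "Trg C (Zro C X Y) = Y"
proof -
  interpret comm_group "mor_group C X Y" by (rule mor_comm_group)
  show "Src C (Zro C X Y) = X" "Trg C (Zro C X Y) = Y"
    using one_closed by (simp_all add: mem_Mor)
qed

lemma src_trg_add [simp]:
  assumes "Src C f = Src C g" "Trg C f = Trg C g"
  shows "Src C (Add C f g) = Src C g" "Trg C (Add C f g) = Trg C g"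
proof -
  interpret comm_group "mor_group C (Src C g) (Trg C g)" by (rule mor_comm_group)
  show "Src C (Add C f g) = Src C g" "Trg C (Add C f g) = Trg C g"
    using m_closed[of f g] assms by (simp_all add: mem_Mor)
qed

lemma src_trg_neg [simp]: "Src C (Neg C f) = Src C f" "Trg C (Neg C f) = Trg C f"
proof -
  interpret comm_group "mor_group C (Src C f) (Trg C f)" by (rule mor_comm_group)
  show "Src C (Neg C f) = Src C f" "Trg C (Neg C f) = Trg C f"
    using inv_closed[of f] by (simp_all add: mem_Mor Neg_def)
qed

lemma add_zero [simp]:
  "\<lbrakk>Src C f = X; Trg C f = Y\<rbrakk> \<Longrightarrow> Add C f (Zro C X Y) = f"
  "\<lbrakk>Src C f = X; Trg C f = Y\<rbrakk> \<Longrightarrow> Add C (Zro C X Y) f = f"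
proof -
  interpret comm_group "mor_group C X Y" by (rule mor_comm_group)
  assume "Src C f = X" "Trg C f = Y"
  then show "Add C f (Zro C X Y) = f" "Add C (Zro C X Y) f = f"
    using r_one[of f] l_one[of f] by (simp_all add: mem_Mor)
qed

lemma add_neg [simp]:
  "\<lbrakk>Src C f = X; Trg C f = Y\<rbrakk> \<Longrightarrow> Add C f (Neg C f) = Zro C X Y"
  "\<lbrakk>Src C f = X; Trg C f = Y\<rbrakk> \<Longrightarrow> Add C (Neg C f) f = Zro C X Y"
proof -
  interpret comm_group "mor_group C X Y" by (rule mor_comm_group)
  assume "Src C f = X" "Trg C f = Y"
  then show "Add C f (Neg C f) = Zro C X Y" "Add C (Neg C f) f = Zro C X Y"
    using r_inv[of f] l_inv[of f] by (simp_all add: mem_Mor Neg_def)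
qed

lemma add_assoc:
  "\<lbrakk>Src C f = Src C g; Trg C f = Trg C g; Src C g = Src C h; Trg C g = Trg C h\<rbrakk>
    \<Longrightarrow> Add C (Add C f g) h = Add C f (Add C g h)"
proof -
  interpret comm_group "mor_group C (Src C h) (Trg C h)" by (rule mor_comm_group)
  assume "Src C f = Src C g" "Trg C f = Trg C g" "Src C g = Src C h" "Trg C g = Trg C h"
  then show ?thesis using m_assoc[of f g h] by (simp add: mem_Mor)
qed

lemma add_commute:
  "\<lbrakk>Src C f = Src C g; Trg C f = Trg C g\<rbrakk> \<Longrightarrow> Add C f g = Add C g f"
proof -
  interpret comm_group "mor_group C (Src C g) (Trg C g)" by (rule mor_comm_group)
  assume "Src C f = Src C g" "Trg C f = Trg C g"
  then show ?thesis using m_comm[of f g] by (simp add: mem_Mor)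
qed

lemma add_left_cancel:
  assumes "Add C f g = Add C f h" "Src C f = Src C g" "Trg C f = Trg C g"
    "Src C f = Src C h" "Trg C f = Trg C h"
  shows "g = h"
proof -
  interpret comm_group "mor_group C (Src C f) (Trg C f)" by (rule mor_comm_group)
  have "Add C g f = Add C h f"
    using add_commute[of f g] add_commute[of f h] assms by metis
  then show ?thesis using right_cancel[of f g h] assms(2-) by (simp add: mem_Mor)
qed

text \<open>Cancelling one copy of \<open>f\<close>. Preservation of zero morphisms by composition,
  by the shift and by \<open>H\<close> is deduced from additivity in this way.\<close>

lemma zero_if_double: "Add C f f = f \<Longrightarrow> f = Zro C (Src C f) (Trg C f)"
  by (rule add_left_cancel[of f]) simp_all

lemma comp_add' [simp]:
  "\<lbrakk>Src C f = Src C f'; Trg C f = Src C g; Trg C f' = Src C g\<rbrakk>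
    \<Longrightarrow> g \<cdot> Add C f f' = Add C (g \<cdot> f) (g \<cdot> f')"
  using comp_add[of f "Src C f" "Trg C f" f' g "Trg C g"] by (simp add: mem_Mor)

lemma add_comp' [simp]:
  "\<lbrakk>Trg C g = Trg C g'; Src C g = Trg C f; Src C g' = Trg C f\<rbrakk>
    \<Longrightarrow> Add C g g' \<cdot> f = Add C (g \<cdot> f) (g' \<cdot> f)"
  using add_comp[of f "Src C f" "Trg C f" g "Trg C g" g'] by (simp add: mem_Mor)

lemma comp_zero [simp]:
  assumes "Src C g = Y"
  shows "g \<cdot> Zro C X Y = Zro C X (Trg C g)"
proof -
  have "Add C (g \<cdot> Zro C X Y) (g \<cdot> Zro C X Y) = g \<cdot> Add C (Zro C X Y) (Zro C X Y)"
    using assms by (subst comp_add') simp_all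
  then show ?thesis using zero_if_double[of "g \<cdot> Zro C X Y"] assms by simp
qed

lemma zero_comp [simp]:
  assumes "Trg C f = Y"
  shows "Zro C Y Z \<cdot> f = Zro C (Src C f) Z"
proof -
  have "Add C (Zro C Y Z \<cdot> f) (Zro C Y Z \<cdot> f) = Add C (Zro C Y Z) (Zro C Y Z) \<cdot> f"
    using assms by (subst add_comp') simp_all
  then show ?thesis using zero_if_double[of "Zro C Y Z \<cdot> f"] assms by simp
qed

lemma neg_unique:
  assumes "Add C f g = Zro C (Src C f) (Trg C f)" "Src C f = Src C g" "Trg C f = Trg C g"
  shows "g = Neg C f"
  by (rule add_left_cancel[of f]) (use assms in simp_all)

lemma neg_neg [simp]: "Neg C (Neg C f) = f"
  by (rule neg_unique[symmetric]) simp_all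

lemma neg_zero [simp]: "Neg C (Zro C X Y) = Zro C X Y"
  by (rule neg_unique[symmetric]) simp_all

lemma neg_eq_zero_iff [simp]:
  "Neg C f = Zro C X Y \<longleftrightarrow> f = Zro C X Y"
  by (metis neg_neg neg_zero)

lemma comp_neg [simp]: "Trg C f = Src C g \<Longrightarrow> g \<cdot> Neg C f = Neg C (g \<cdot> f)"
  by (rule neg_unique) (simp_all flip: comp_add')

lemma neg_comp [simp]: "Trg C f = Src C g \<Longrightarrow> Neg C g \<cdot> f = Neg C (g \<cdot> f)"
  by (rule neg_unique) (simp_all flip: add_comp')

lemma sub_eq_zero:
  assumes "Add C f (Neg C g) = Zro C X Y" "Src C f = X" "Trg C f = Y" "Src C g = X" "Trg C g = Y"
  shows "f = g"
  using neg_unique[of f "Neg C g"] assms by (metis neg_neg src_trg_neg)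

lemma add_sub:
  assumes "Src C f = Src C g" "Trg C f = Trg C g"
  shows "Add C g (Add C f (Neg C g)) = f"
proof -
  have "Add C g (Add C f (Neg C g)) = Add C (Add C f (Neg C g)) g"
    by (rule add_commute) (use assms in simp_all)
  also have "\<dots> = f" using assms by (simp add: add_assoc)
  finally show ?thesis .
qed

text \<open>Subtracting two competing morphisms reduces cancellation to the case where one of them
  is zero.\<close>

lemma monoI:
  assumes "\<And>x. \<lbrakk>Trg C x = Src C m; m \<cdot> x = Zro C (Src C x) (Trg C m)\<rbrakk>
    \<Longrightarrow> x = Zro C (Src C x) (Src C m)"
  shows "is_mono C m"
  unfolding is_mono_def
proof (intro allI ballI impI)
  fix W g h assume *: "g \<in> Mor C W (Src C m)" "h \<in> Mor C W (Src C m)" "m \<cdot> g = m \<cdot> h"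
  then have "Add C g (Neg C h) = Zro C W (Src C m)"
    using assms[of "Add C g (Neg C h)"] by (simp add: mem_Mor)
  then show "g = h" using * by (auto simp: mem_Mor dest: sub_eq_zero)
qed

lemma epiI:
  assumes "\<And>x. \<lbrakk>Src C x = Trg C e; x \<cdot> e = Zro C (Src C e) (Trg C x)\<rbrakk>
    \<Longrightarrow> x = Zro C (Trg C e) (Trg C x)"
  shows "is_epi C e"
  unfolding is_epi_def
proof (intro allI ballI impI)
  fix W g h assume *: "g \<in> Mor C (Trg C e) W" "h \<in> Mor C (Trg C e) W" "g \<cdot> e = h \<cdot> e"
  then have "Add C g (Neg C h) = Zro C (Trg C e) W"
    using assms[of "Add C g (Neg C h)"] by (simp add: mem_Mor)
  then show "g = h" using * by (auto simp: mem_Mor dest: sub_eq_zero)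
qed

lemma mono_zero:
  "\<lbrakk>is_mono C m; m \<cdot> x = Zro C Y Z; Trg C x = Src C m\<rbrakk> \<Longrightarrow> x = Zro C (Src C x) (Src C m)"
  by (rule monoD[of m]) (simp_all, metis src_trg_comp src_trg_zero)

lemma epi_zero:
  "\<lbrakk>is_epi C e; x \<cdot> e = Zro C Y Z; Src C x = Trg C e\<rbrakk> \<Longrightarrow> x = Zro C (Trg C e) (Trg C x)"
  by (rule epiD[of e]) (simp_all, metis src_trg_comp src_trg_zero)

section \<open>Kernels, cokernels and zero objects in preadditive categories\<close>

lemma kernelD:
  assumes "is_kernel C k f"
  shows "Trg C k = Src C f" "f \<cdot> k = Zro C (Src C k) (Trg C f)"
  using assms unfolding is_kernel_def by - (elim conjE, assumption)+

text \<open>The type of the zero morphism is left free, since the other premises force it; callers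
  need not normalise it first.\<close>

lemma kernel_lift:
  assumes "is_kernel C k f" "f \<cdot> h = Zro C Y Z" "Trg C h = Src C f"
  obtains l where "Src C l = Src C h" "Trg C l = Src C k" "k \<cdot> l = h"
proof -
  have "f \<cdot> h = Zro C (Src C h) (Trg C f)"
    using assms(2,3) by (metis src_trg_comp src_trg_zero)
  then show thesis
    using that assms(1,3) unfolding is_kernel_def by (metis mem_Mor)
qed

lemma kernel_mono: "is_kernel C k f \<Longrightarrow> is_mono C k"
  unfolding is_mono_def
proof (intro allI ballI impI)
  fix W g h assume k: "is_kernel C k f"
    and *: "g \<in> Mor C W (Src C k)" "h \<in> Mor C W (Src C k)" "k \<cdot> g = k \<cdot> h"
  have "f \<cdot> (k \<cdot> h) = Zro C W (Trg C f)"
    using kernelD[OF k] * comp_eq_left[of f k _ h] by (simp add: mem_Mor)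
  moreover have "k \<cdot> h \<in> Mor C W (Src C f)" using kernelD[OF k] * by (simp add: mem_Mor)
  ultimately show "g = h" using k * unfolding is_kernel_def by metis
qed

lemma cokernelD:
  assumes "is_cokernel C c f"
  shows "Src C c = Trg C f" "c \<cdot> f = Zro C (Src C f) (Trg C c)"
  using assms unfolding is_cokernel_def by - (elim conjE, assumption)+

lemma cokernel_desc:
  assumes "is_cokernel C c f" "h \<cdot> f = Zro C Y Z" "Src C h = Trg C f"
  obtains l where "Src C l = Trg C c" "Trg C l = Trg C h" "l \<cdot> c = h"
proof -
  have "h \<cdot> f = Zro C (Src C f) (Trg C h)"
    using assms(2,3) by (metis src_trg_comp src_trg_zero)
  then show thesis
    using that assms(1,3) unfolding is_cokernel_def by (metis mem_Mor)
qed

lemma cokernel_epi: "is_cokernel C c f \<Longrightarrow> is_epi C c"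
  unfolding is_epi_def
proof (intro allI ballI impI)
  fix W g h assume c: "is_cokernel C c f"
    and *: "g \<in> Mor C (Trg C c) W" "h \<in> Mor C (Trg C c) W" "g \<cdot> c = h \<cdot> c"
  have "(h \<cdot> c) \<cdot> f = Zro C (Src C f) W"
    using cokernelD[OF c] * by (simp add: mem_Mor)
  moreover have "h \<cdot> c \<in> Mor C (Trg C f) W" using cokernelD[OF c] * by (simp add: mem_Mor)
  ultimately show "g = h" using c * unfolding is_cokernel_def by metis
qed

text \<open>Uniqueness of the factorisation is the mono property, which leaves only existence to be
  shown.\<close>

lemma kernelI:
  assumes "is_mono C k" "Trg C k = Src C f" "f \<cdot> k = Zro C Y Z"
    and "\<And>h. \<lbrakk>Trg C h = Src C f; f \<cdot> h = Zro C (Src C h) (Trg C f)\<rbrakk>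
      \<Longrightarrow> \<exists>l. Src C l = Src C h \<and> Trg C l = Src C k \<and> k \<cdot> l = h"
  shows "is_kernel C k f"
  unfolding is_kernel_def
proof (intro conjI allI ballI impI)
  show "f \<cdot> k = Zro C (Src C k) (Trg C f)"
    using assms(2,3) by (metis src_trg_comp src_trg_zero)
  fix W h assume "h \<in> Mor C W (Src C f)" "f \<cdot> h = Zro C W (Trg C f)"
  then show "\<exists>!l. l \<in> Mor C W (Src C k) \<and> k \<cdot> l = h"
    using assms(4)[of h] monoD[OF assms(1)] by (metis mem_Mor)
qed (use assms in auto)

lemma cokernelI:
  assumes "is_epi C c" "Src C c = Trg C f" "c \<cdot> f = Zro C Y Z"
    and "\<And>h. \<lbrakk>Src C h = Trg C f; h \<cdot> f = Zro C (Src C f) (Trg C h)\<rbrakk>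
      \<Longrightarrow> \<exists>l. Src C l = Trg C c \<and> Trg C l = Trg C h \<and> l \<cdot> c = h"
  shows "is_cokernel C c f"
  unfolding is_cokernel_def
proof (intro conjI allI ballI impI)
  show "c \<cdot> f = Zro C (Src C f) (Trg C c)"
    using assms(2,3) by (metis src_trg_comp src_trg_zero)
  fix W h assume "h \<in> Mor C (Trg C f) W" "h \<cdot> f = Zro C (Src C f) W"
  then show "\<exists>!l. l \<in> Mor C (Trg C c) W \<and> l \<cdot> c = h"
    using assms(4)[of h] epiD[OF assms(1)] assms(2) by (metis mem_Mor)
qed (use assms in auto)

lemma zero_object_if_id_zero:
  assumes "Idm C X = Zro C X X"
  shows "is_zero_object C X"
proof -
  have 1: "f = Zro C X Y" if "f \<in> Mor C X Y" for f Y
    using comp_zero[of f X X] comp_id(1)[of f X] that by (simp add: mem_Mor assms)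
  have 2: "f = Zro C Y X" if "f \<in> Mor C Y X" for f Y
    using zero_comp[of f X X] comp_id(2)[of f X] that by (simp add: mem_Mor assms)
  show ?thesis
    unfolding is_zero_object_def by (metis 1 2 mem_Mor src_trg_zero)
qed

lemma zero_object_mor:
  assumes "is_zero_object C X"
  shows "Src C f = X \<Longrightarrow> f = Zro C X (Trg C f)" "Trg C f = X \<Longrightarrow> f = Zro C (Src C f) X"
  using assms unfolding is_zero_object_def mem_Mor by (metis src_trg_zero)+

end

section \<open>Abelian categories\<close>

context abelian_category
begin

text \<open>The mono \<open>f\<close> is the kernel of some \<open>t\<close>. As \<open>f\<close> is
  also epi, \<open>t\<close> is zero, so the identity of the target factors through
  \<open>f\<close>, which gives a right inverse; mono makes it two-sided.\<close>

lemma mono_epi_iso: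
  assumes "is_mono C f" "is_epi C f"
  obtains g where "Src C g = Trg C f" "Trg C g = Src C f"
    "g \<cdot> f = Idm C (Src C f)" "f \<cdot> g = Idm C (Trg C f)"
proof -
  obtain t where t: "is_kernel C f t" using mono_is_kernel[OF assms(1)] by blast
  note k = kernelD[OF t]
  have "t = Zro C (Src C t) (Trg C t)"
    using epi_zero[OF assms(2) k(2)] k(1) by simp
  then have "t \<cdot> Idm C (Trg C f) = Zro C (Trg C f) (Trg C t)"
    using k(1) by simp
  then obtain g where g: "Src C g = Trg C f" "Trg C g = Src C f" "f \<cdot> g = Idm C (Trg C f)"
    using kernel_lift[OF t, of "Idm C (Trg C f)"] k(1) by auto
  have "g \<cdot> f = Idm C (Src C f)"
    by (rule monoD[OF assms(1)]) (use g(1,2) comp_eq_left[OF g(3), of f] in simp_all)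
  then show thesis using that g by blast
qed

lemma mono_epi_is_isomorphism:
  assumes "is_mono C f" "is_epi C f"
  shows "is_isomorphism C f"
  using mono_epi_iso[OF assms] unfolding is_isomorphism_def by (metis mem_Mor)

text \<open>If \<open>m\<close> is the kernel of \<open>t\<close>, then \<open>t\<close> kills
  \<open>m\<close> and so factors through the cokernel \<open>c\<close>. Whatever \<open>c\<close>
  kills is therefore killed by \<open>t\<close>, hence lifts to \<open>m\<close>.\<close>

lemma mono_kernel_of_cokernel:
  assumes "is_mono C m" "is_cokernel C c m"
  shows "is_kernel C m c"
proof (rule kernelI)
  note c = cokernelD[OF assms(2)]
  show "Trg C m = Src C c" "c \<cdot> m = Zro C (Src C m) (Trg C c)" using c by simp_all
  fix h assume h: "Trg C h = Src C c" "c \<cdot> h = Zro C (Src C h) (Trg C c)"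
  obtain t where t: "is_kernel C m t" using mono_is_kernel[OF assms(1)] by blast
  obtain t' where t': "Src C t' = Trg C c" "Trg C t' = Trg C t" "t' \<cdot> c = t"
    using cokernel_desc[OF assms(2) kernelD(2)[OF t]] kernelD(1)[OF t] by auto
  have "t \<cdot> h = Zro C (Src C h) (Trg C t)"
    using t'(1,2) h by (simp flip: t'(3))
  then show "\<exists>l. Src C l = Src C h \<and> Trg C l = Src C m \<and> m \<cdot> l = h"
    using kernel_lift[OF t, of h] h c kernelD(1)[OF t] by metis
qed (rule assms)

lemma epi_cokernel_of_kernel:
  assumes "is_epi C e" "is_kernel C k e"
  shows "is_cokernel C e k"
proof (rule cokernelI)
  note k = kernelD[OF assms(2)]
  show "Src C e = Trg C k" "e \<cdot> k = Zro C (Src C k) (Trg C e)" using k by simp_all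
  fix h assume h: "Src C h = Trg C k" "h \<cdot> k = Zro C (Src C k) (Trg C h)"
  obtain t where t: "is_cokernel C e t" using epi_is_cokernel[OF assms(1)] by blast
  obtain t' where t': "Src C t' = Src C t" "Trg C t' = Src C k" "k \<cdot> t' = t"
    using kernel_lift[OF assms(2) cokernelD(2)[OF t]] cokernelD(1)[OF t] by auto
  have "h \<cdot> t = (h \<cdot> k) \<cdot> t'"
    using t'(1,2) h(1) by (simp flip: t'(3))
  then have "h \<cdot> t = Zro C (Src C t) (Trg C h)"
    using t' h by (simp del: comp_assoc' add: h(2))
  then show "\<exists>l. Src C l = Trg C e \<and> Trg C l = Trg C h \<and> l \<cdot> e = h"
    using cokernel_desc[OF t, of h] h k cokernelD(1)[OF t] by metis
qed (rule assms)

text \<open>The image is the kernel \<open>m\<close> of the cokernel \<open>c\<close> of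
  \<open>f\<close>. For the remaining factor \<open>e\<close> to be epi, let \<open>g\<close> kill
  it, with kernel \<open>k\<close>. Then \<open>f\<close> factors through the mono
  \<open>m \<cdot> k\<close>, which is a kernel of some \<open>t\<close>. This \<open>t\<close>
  kills \<open>f\<close>, so it factors through \<open>c\<close> and kills \<open>m\<close>; hence
  \<open>m\<close> factors through \<open>m \<cdot> k\<close>, which splits \<open>k\<close> and
  makes \<open>g\<close> zero.\<close>

lemma ex_image:
  obtains m e where "is_mono C m" "is_epi C e" "m \<cdot> e = f" "Src C e = Src C f"
    "Trg C e = Src C m" "Trg C m = Trg C f"
proof -
  obtain c where c: "is_cokernel C c f" using ex_cokernel by blast
  obtain m where m: "is_kernel C m c" using ex_kernel by blast
  note cD = cokernelD[OF c] and mD = kernelD[OF m]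
  obtain e where e: "Src C e = Src C f" "Trg C e = Src C m" "m \<cdot> e = f"
    using kernel_lift[OF m cD(2)] cD(1) by auto
  have "is_epi C e"
  proof (rule epiI)
    fix g assume g: "Src C g = Trg C e" "g \<cdot> e = Zro C (Src C e) (Trg C g)"
    obtain k where k: "is_kernel C k g" using ex_kernel by blast
    note kD = kernelD[OF k]
    obtain e' where e': "Src C e' = Src C e" "Trg C e' = Src C k" "k \<cdot> e' = e"
      using kernel_lift[OF k g(2)] g(1) by auto
    have "is_mono C (m \<cdot> k)"
      using kD g e by (intro mono_comp kernel_mono[OF k] kernel_mono[OF m]) simp
    then obtain t where t: "is_kernel C (m \<cdot> k) t" using mono_is_kernel by blast
    note tD = kernelD[OF t]
    have ty: "Src C t = Trg C m" "Trg C k = Src C m" using tD kD g e by simp_all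
    have "t \<cdot> f = (t \<cdot> (m \<cdot> k)) \<cdot> e'"
      using e e' ty by (metis comp_assoc' src_trg_comp)
    also have "\<dots> = Zro C (Src C f) (Trg C t)"
      using tD(2) e e' ty by (simp del: comp_assoc')
    finally obtain t' where t': "Src C t' = Trg C c" "Trg C t' = Trg C t" "t' \<cdot> c = t"
      using cokernel_desc[OF c, of t] ty cD mD by (metis)
    have "t \<cdot> m = Zro C (Src C m) (Trg C t)"
      using t'(1,2) mD by (simp flip: t'(3))
    then obtain s where s: "Src C s = Src C m" "Trg C s = Src C k" "(m \<cdot> k) \<cdot> s = m"
      using kernel_lift[OF t, of m] ty by (metis src_trg_comp(1))
    have "k \<cdot> s = Idm C (Src C m)"
      by (rule monoD[OF kernel_mono[OF m]]) (use s ty in simp_all)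
    then have "g = g \<cdot> (k \<cdot> s)" using g e by simp
    also have "\<dots> = (g \<cdot> k) \<cdot> s" using s ty g e by simp
    also have "\<dots> = Zro C (Trg C e) (Trg C g)"
      using s ty g e kD by (simp del: comp_assoc')
    finally show "g = Zro C (Trg C e) (Trg C g)" .
  qed
  then show thesis using that[of m e] kernel_mono[OF m] e mD cD by simp
qed

text \<open>
  Diagram chases below use generalised elements: an element of an object is a morphism into it,
  and existence of an element is only asked for after composition with some epimorphism.
\<close>

lemma epi_local_lift:
  assumes "is_epi C e" "Trg C y = Trg C e"
  obtains e' x where "is_epi C e'" "Trg C e' = Src C y" "Src C x = Src C e'" "Trg C x = Src C e"
    "e \<cdot> x = y \<cdot> e'"
proof -
  obtain S where "is_biproduct C (Src C e) (Src C y) S" using ex_biproduct by blast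
  then obtain i j p q where
    ty: "Src C i = Src C e" "Trg C i = S" "Src C j = Src C y" "Trg C j = S"
      "Src C p = S" "Trg C p = Src C e" "Src C q = S" "Trg C q = Src C y"
    and eq: "p \<cdot> i = Idm C (Src C e)" "q \<cdot> j = Idm C (Src C y)"
      "p \<cdot> j = Zro C (Src C y) (Src C e)" "q \<cdot> i = Zro C (Src C e) (Src C y)"
    unfolding is_biproduct_def by (metis mem_Mor)
  \<comment> \<open>The kernel of \<open>(e, -y)\<close> on the biproduct is the pullback of
    \<open>e\<close> and \<open>y\<close>; its second projection \<open>q \<cdot> k\<close> is the
    required epi.\<close>
  define t where "t = Add C (e \<cdot> p) (Neg C (y \<cdot> q))"
  have t: "Src C t = S" "Trg C t = Trg C e" using ty assms by (simp_all add: t_def)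
  have ti: "t \<cdot> i = e" using ty assms eq by (simp add: t_def)
  have "is_epi C t"
    using assms(1) ty t by (intro epi_cancel[of t i]) (simp_all add: ti)
  obtain k where k: "is_kernel C k t" using ex_kernel by blast
  note kD = kernelD[OF k]
  have tc: "is_cokernel C t k" using epi_cokernel_of_kernel[OF \<open>is_epi C t\<close> k] .
  \<comment> \<open>If \<open>g\<close> kills \<open>q \<cdot> k\<close>, then
    \<open>g \<cdot> q\<close> descends along the epi \<open>t\<close> to some \<open>h\<close>.
    Restriction along \<open>i\<close> shows that \<open>h\<close> kills \<open>e\<close>, so
    \<open>h\<close> is zero, and restriction along \<open>j\<close> then gives
    \<open>g\<close>.\<close>
  have "is_epi C (q \<cdot> k)"
  proof (rule epiI)
    fix g assume g: "Src C g = Trg C (q \<cdot> k)" "g \<cdot> (q \<cdot> k) = Zro C (Src C (q \<cdot> k)) (Trg C g)"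
    have "(g \<cdot> q) \<cdot> k = Zro C (Src C k) (Trg C g)" using g ty t kD by simp
    then obtain h where h: "Src C h = Trg C t" "Trg C h = Trg C g" "h \<cdot> t = g \<cdot> q"
      using cokernel_desc[OF tc, of "g \<cdot> q"] g ty t kD by (metis src_trg_comp)
    have "h \<cdot> e = (h \<cdot> t) \<cdot> i" using h(1) t ty ti by simp
    also have "\<dots> = Zro C (Src C e) (Trg C g)" using h g t ty kD by (simp add: eq)
    finally have "h = Zro C (Trg C e) (Trg C g)"
      using epi_zero[OF assms(1), of h] h t by simp
    then have "g \<cdot> q = Zro C S (Trg C g)" using h(3) t by simp
    then have "(g \<cdot> q) \<cdot> j = Zro C (Src C y) (Trg C g)" using ty by simp
    then show "g = Zro C (Trg C (q \<cdot> k)) (Trg C g)" using g ty t kD eq by simp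
  qed
  moreover have "e \<cdot> (p \<cdot> k) = y \<cdot> (q \<cdot> k)"
  proof (rule sub_eq_zero)
    show "Add C (e \<cdot> (p \<cdot> k)) (Neg C (y \<cdot> (q \<cdot> k))) = Zro C (Src C k) (Trg C e)"
      using kD ty t assms by (simp add: t_def)
  qed (use kD ty t assms in simp_all)
  ultimately show thesis using that[of "q \<cdot> k" "p \<cdot> k"] kD ty t by simp
qed

text \<open>Descent along an epi: \<open>m\<close> is the kernel of some \<open>t\<close>, and
  \<open>t \<cdot> f\<close> vanishes because it does so after composition with \<open>e\<close>.
  This turns the local lifts of a diagram chase into actual morphisms.\<close>

lemma mono_lift:
  assumes m: "is_mono C m" and "Trg C f = Trg C m"
    and "is_epi C e" "Trg C e = Src C f" "Src C x = Src C e" "Trg C x = Src C m" "m \<cdot> x = f \<cdot> e"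
  obtains l where "Src C l = Src C f" "Trg C l = Src C m" "m \<cdot> l = f"
proof -
  obtain t where t: "is_kernel C m t" using mono_is_kernel[OF m] by blast
  note tD = kernelD[OF t]
  have "t \<cdot> (f \<cdot> e) = Zro C (Src C e) (Trg C t)"
    using tD assms comp_eq_left[OF tD(2), of x] by (simp flip: assms(7))
  then have "(t \<cdot> f) \<cdot> e = Zro C (Src C e) (Trg C t)"
    using tD assms by simp
  then have "t \<cdot> f = Zro C (Src C f) (Trg C t)"
    using epi_zero[OF assms(3), of "t \<cdot> f"] tD assms by simp
  then show thesis using kernel_lift[OF t, of f] tD assms that by metis
qed

text \<open>An epi is the cokernel of its kernel, so it suffices that \<open>f\<close> kills every
  generalised element killed by \<open>e\<close>.\<close>

lemma epi_desc:
  assumes e: "is_epi C e" and "Src C f = Src C e"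
    and "\<And>x. \<lbrakk>Trg C x = Src C e; e \<cdot> x = Zro C (Src C x) (Trg C e)\<rbrakk>
      \<Longrightarrow> f \<cdot> x = Zro C (Src C x) (Trg C f)"
  obtains g where "Src C g = Trg C e" "Trg C g = Trg C f" "g \<cdot> e = f"
proof -
  obtain k where k: "is_kernel C k e" using ex_kernel by blast
  show thesis
    using cokernel_desc[OF epi_cokernel_of_kernel[OF e k] assms(3)[OF kernelD[OF k]]]
      kernelD[OF k] assms(2) that by metis
qed

section \<open>Exactness and cokernels in terms of generalised elements\<close>

lemma exactD:
  assumes "exact_at C f g"
  shows "Trg C f = Src C g" "g \<cdot> f = Zro C (Src C f) (Trg C g)"
proof -
  obtain m e where m: "is_kernel C m g" "Trg C m = Trg C f" "Src C e = Src C f"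
    "Trg C e = Src C m" "m \<cdot> e = f" and tr: "Trg C f = Src C g"
    using assms unfolding exact_at_def is_image_def by (metis mem_Mor)
  show "Trg C f = Src C g" by fact
  show "g \<cdot> f = Zro C (Src C f) (Trg C g)"
    using m tr kernelD[OF m(1)] comp_eq_left[OF kernelD(2)[OF m(1)], of e] by simp
qed

text \<open>A \<open>y\<close> killed by \<open>g\<close> factors through the image of
  \<open>f\<close>. The source of \<open>f\<close> is only an epimorphic cover of that image, which
  is why the preimage exists after composition with an epi.\<close>

lemma exact_local_lift:
  assumes "exact_at C f g" "g \<cdot> y = Zro C X Z" "Trg C y = Src C g"
  obtains e x where "is_epi C e" "Trg C e = Src C y" "Src C x = Src C e" "Trg C x = Src C f"
    "f \<cdot> x = y \<cdot> e"
proof -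
  obtain m e where m: "is_kernel C m g" "Trg C m = Trg C f" "Src C e = Src C f"
    "Trg C e = Src C m" "m \<cdot> e = f" "is_epi C e"
    using assms(1) unfolding exact_at_def is_image_def by (metis mem_Mor)
  obtain y' where y': "Src C y' = Src C y" "Trg C y' = Src C m" "m \<cdot> y' = y"
    using kernel_lift[OF m(1) assms(2,3)] by blast
  obtain e' x where x: "is_epi C e'" "Trg C e' = Src C y'" "Src C x = Src C e'"
    "Trg C x = Src C e" "e \<cdot> x = y' \<cdot> e'"
    using epi_local_lift[OF m(6), of y'] y' m by metis
  have "f \<cdot> x = y \<cdot> e'"
    using m x y' comp_eq_left[of m e f x] comp_eq_left[of m y' y e'] by simp
  then show thesis using that x y' m by simp
qed

text \<open>With \<open>f\<close> factored through its image \<open>m\<close>, a local preimage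
  under \<open>f\<close> is a local factorisation through \<open>m\<close>, and the latter descends
  to a genuine one.\<close>

lemma exactI:
  assumes ty: "Trg C f = Src C g" and z: "g \<cdot> f = Zro C X Z"
    and lift: "\<And>y. \<lbrakk>Trg C y = Src C g; g \<cdot> y = Zro C (Src C y) (Trg C g)\<rbrakk>
      \<Longrightarrow> \<exists>e x. is_epi C e \<and> Trg C e = Src C y \<and> Src C x = Src C e \<and> Trg C x = Src C f \<and>
            f \<cdot> x = y \<cdot> e"
  shows "exact_at C f g"
proof -
  obtain m e where m: "is_mono C m" "is_epi C e" "m \<cdot> e = f" "Src C e = Src C f"
    "Trg C e = Src C m" "Trg C m = Trg C f" by (rule ex_image)
  have "is_kernel C m g"
  proof (rule kernelI)
    have "(g \<cdot> m) \<cdot> e = Zro C X Z" using m z ty by simp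
    then show "g \<cdot> m = Zro C (Src C m) (Trg C g)"
      using epi_zero[OF m(2), of "g \<cdot> m"] m ty by simp
    fix y assume y: "Trg C y = Src C g" "g \<cdot> y = Zro C (Src C y) (Trg C g)"
    obtain e' x where x: "is_epi C e'" "Trg C e' = Src C y" "Src C x = Src C e'"
      "Trg C x = Src C f" "f \<cdot> x = y \<cdot> e'" using lift[OF y] by blast
    have "m \<cdot> (e \<cdot> x) = y \<cdot> e'" using m x comp_eq_left[of m e f x] by simp
    then show "\<exists>l. Src C l = Src C y \<and> Trg C l = Src C m \<and> m \<cdot> l = y"
      using mono_lift[OF m(1) _ x(1,2), of "e \<cdot> x"] m x y ty by (metis src_trg_comp)
  qed (use m ty in simp_all)
  then show ?thesis
    unfolding exact_at_def is_image_def using m ty by (metis mem_Mor)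
qed

text \<open>A morphism and its image have the same cokernel, and a mono is the kernel of its
  cokernel; so \<open>y\<close> lies in the image of \<open>f\<close>.\<close>

lemma cokernel_local_lift:
  assumes "is_cokernel C c f" "c \<cdot> y = Zro C X Z" "Trg C y = Src C c"
  obtains e x where "is_epi C e" "Trg C e = Src C y" "Src C x = Src C e" "Trg C x = Src C f"
    "f \<cdot> x = y \<cdot> e"
proof -
  obtain m e where m: "is_mono C m" "is_epi C e" "m \<cdot> e = f" "Src C e = Src C f"
    "Trg C e = Src C m" "Trg C m = Trg C f" by (rule ex_image)
  note cD = cokernelD[OF assms(1)]
  have cm: "is_cokernel C c m"
  proof (rule cokernelI)
    have "(c \<cdot> m) \<cdot> e = Zro C (Src C f) (Trg C c)" using m cD by simp
    then show "c \<cdot> m = Zro C (Src C m) (Trg C c)"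
      using epi_zero[OF m(2), of "c \<cdot> m"] m cD by simp
    fix h assume h: "Src C h = Trg C m" "h \<cdot> m = Zro C (Src C m) (Trg C h)"
    have "h \<cdot> f = Zro C (Src C f) (Trg C h)"
      using h(1) m comp_eq_left[OF h(2), of e] by simp
    then show "\<exists>l. Src C l = Trg C c \<and> Trg C l = Trg C h \<and> l \<cdot> c = h"
      using cokernel_desc[OF assms(1), of h] h m by metis
  qed (use m cD cokernel_epi[OF assms(1)] in simp_all)
  obtain y' where y': "Src C y' = Src C y" "Trg C y' = Src C m" "m \<cdot> y' = y"
    using kernel_lift[OF mono_kernel_of_cokernel[OF m(1) cm] assms(2,3)] by blast
  obtain e' x where x: "is_epi C e'" "Trg C e' = Src C y'" "Src C x = Src C e'"
    "Trg C x = Src C e" "e \<cdot> x = y' \<cdot> e'"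
    using epi_local_lift[OF m(2), of y'] y' m by metis
  have "f \<cdot> x = y \<cdot> e'"
    using m x y' comp_eq_left[of m e f x] comp_eq_left[of m y' y e'] by simp
  then show thesis using that x y' m by simp
qed

text \<open>A morphism that kills \<open>f\<close> also kills everything locally in the image of
  \<open>f\<close>, in particular all that \<open>c\<close> kills, so it descends along the epi
  \<open>c\<close>.\<close>

lemma cokernel_if_local_lift:
  assumes c: "is_epi C c" and ty: "Trg C f = Src C c" and z: "c \<cdot> f = Zro C X Z"
    and lift: "\<And>y. \<lbrakk>Trg C y = Src C c; c \<cdot> y = Zro C (Src C y) (Trg C c)\<rbrakk>
      \<Longrightarrow> \<exists>e x. is_epi C e \<and> Trg C e = Src C y \<and> Src C x = Src C e \<and> Trg C x = Src C f \<and>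
            f \<cdot> x = y \<cdot> e"
  shows "is_cokernel C c f"
proof (rule cokernelI)
  show "c \<cdot> f = Zro C X Z" by fact
  fix h assume h: "Src C h = Trg C f" "h \<cdot> f = Zro C (Src C f) (Trg C h)"
  have "h \<cdot> y = Zro C (Src C y) (Trg C h)"
    if y: "Trg C y = Src C c" "c \<cdot> y = Zro C (Src C y) (Trg C c)" for y
  proof -
    obtain e x where x: "is_epi C e" "Trg C e = Src C y" "Src C x = Src C e"
      "Trg C x = Src C f" "f \<cdot> x = y \<cdot> e" using lift[OF y] by blast
    have "(h \<cdot> y) \<cdot> e = h \<cdot> (f \<cdot> x)" using x h y ty by simp
    also have "\<dots> = Zro C (Src C e) (Trg C h)"
      using comp_eq_left[OF h(2), of x] x h by simp
    finally show ?thesis using epi_zero[OF x(1), of "h \<cdot> y"] h y x ty by simp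
  qed
  then show "\<exists>l. Src C l = Trg C c \<and> Trg C l = Trg C h \<and> l \<cdot> c = h"
    using epi_desc[OF c, of h] h ty by metis
qed (use assms in simp_all)

end

section \<open>Derived couples\<close>

context abelian_category
begin

text \<open>On cycles \<open>k\<close> takes values in the kernel of \<open>j\<close>, which is the
  image of \<open>i = \<mu> \<cdot> \<pi>\<close>; this gives \<open>\<kappa>\<close>. Boundaries
  are of the form \<open>j0 \<cdot> k0\<close>, and \<open>k\<close> kills \<open>j0\<close> by
  exactness, so \<open>\<kappa>\<close> passes to classes.\<close>

lemma derived_k_exists:
  assumes \<mu>: "is_mono C \<mu>" and \<pi>: "is_epi C \<pi>" "Trg C \<pi> = Src C \<mu>"
    and ex: "exact_at C (\<mu> \<cdot> \<pi>) j" "exact_at C j0 k"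
    and ty: "Trg C k = Src C j" "Trg C k0 = Src C j0" "Trg C l = Src C z"
    and z: "is_kernel C z (j \<cdot> k)" "z \<cdot> l = j0 \<cdot> k0" and e: "is_cokernel C e l"
  obtains k' where "Src C k' = Trg C e" "Trg C k' = Src C \<mu>" "\<mu> \<cdot> (k' \<cdot> e) = k \<cdot> z"
proof -
  note zD = kernelD[OF z(1)] and eD = cokernelD[OF e] and exD = exactD[OF ex(1)] exactD[OF ex(2)]
  have tz: "Trg C z = Src C k" "Src C j = Trg C \<mu>" using zD exD ty \<pi> by simp_all
  have "j \<cdot> (k \<cdot> z) = Zro C (Src C z) (Trg C j)" using zD(2) ty tz by simp
  then obtain e1 x where x: "is_epi C e1" "Trg C e1 = Src C z" "Src C x = Src C e1"
    "Trg C x = Src C \<pi>" "(\<mu> \<cdot> \<pi>) \<cdot> x = (k \<cdot> z) \<cdot> e1"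
    using exact_local_lift[OF ex(1), of "k \<cdot> z"] tz ty \<pi>(2) by (metis src_trg_comp)
  obtain \<kappa> where \<kappa>: "Src C \<kappa> = Src C z" "Trg C \<kappa> = Src C \<mu>" "\<mu> \<cdot> \<kappa> = k \<cdot> z"
    by (rule mono_lift[OF \<mu> _ x(1), of "k \<cdot> z" "\<pi> \<cdot> x"]) (use x tz ty \<pi>(2) in simp_all)
  have "\<mu> \<cdot> (\<kappa> \<cdot> l) = k \<cdot> (z \<cdot> l)"
    using comp_eq_left[OF \<kappa>(3), of l] \<kappa>(1,2) ty tz by simp
  also have "\<dots> = Zro C (Src C l) (Trg C \<mu>)"
  proof -
    have "Src C k0 = Src C l"
      using arg_cong[OF z(2), of "Src C"] ty tz by simp
    then show ?thesis
      using comp_eq_left[OF exD(4), of k0] ty tz exD by (simp add: z(2))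
  qed
  finally have "\<kappa> \<cdot> l = Zro C (Src C l) (Trg C \<kappa>)"
    using mono_zero[OF \<mu>, of "\<kappa> \<cdot> l"] \<kappa>(1,2) ty by simp
  then obtain k' where "Src C k' = Trg C e" "Trg C k' = Trg C \<kappa>" "k' \<cdot> e = \<kappa>"
    using cokernel_desc[OF e, of \<kappa>] \<kappa>(1) ty by metis
  then show thesis using that \<kappa> by metis
qed

text \<open>Values of \<open>j\<close> are cycles because \<open>k2\<close> kills them. Their class
  depends only on the image under \<open>\<pi>\<close>: an element killed by \<open>\<pi>\<close> is
  killed by \<open>i\<close>, so it comes from \<open>k\<close>, and \<open>j \<cdot> k\<close> is a
  boundary.\<close>

lemma derived_j_exists:
  assumes \<mu>: "is_mono C \<mu>" and \<pi>: "is_epi C \<pi>" "Trg C \<pi> = Src C \<mu>"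
    and ex: "exact_at C k (\<mu> \<cdot> \<pi>)" "exact_at C j k2"
    and ty: "Trg C k = Src C j" "Trg C k2 = Src C j2" "Trg C l = Src C z"
    and z: "is_kernel C z (j2 \<cdot> k2)" "z \<cdot> l = j \<cdot> k" and e: "is_cokernel C e l"
  obtains j' lj where "Src C lj = Src C j" "Trg C lj = Src C z" "z \<cdot> lj = j"
    "Src C j' = Trg C \<pi>" "Trg C j' = Trg C e" "j' \<cdot> \<pi> = e \<cdot> lj"
proof -
  note zD = kernelD[OF z(1)] and eD = cokernelD[OF e] and exD = exactD[OF ex(1)] exactD[OF ex(2)]
  have tz: "Trg C z = Src C k2" "Src C \<pi> = Src C j" "Trg C j = Src C k2"
    using zD exD ty \<pi> by simp_all
  have "(j2 \<cdot> k2) \<cdot> j = Zro C (Src C j) (Trg C j2)" using exD(4) ty tz by simp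
  then obtain lj where lj: "Src C lj = Src C j" "Trg C lj = Src C z" "z \<cdot> lj = j"
    using kernel_lift[OF z(1), of j] tz ty by (metis src_trg_comp(1))
  have "(e \<cdot> lj) \<cdot> x = Zro C (Src C x) (Trg C e)"
    if x: "Trg C x = Src C \<pi>" "\<pi> \<cdot> x = Zro C (Src C x) (Trg C \<pi>)" for x
  proof -
    have "(\<mu> \<cdot> \<pi>) \<cdot> x = Zro C (Src C x) (Trg C \<mu>)" using x \<pi>(2) by simp
    then obtain e1 w where w: "is_epi C e1" "Trg C e1 = Src C x" "Src C w = Src C e1"
      "Trg C w = Src C k" "k \<cdot> w = x \<cdot> e1"
      using exact_local_lift[OF ex(1), of x] x \<pi>(2) by (metis src_trg_comp(1))
    have sl: "Src C l = Src C k"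
      using arg_cong[OF z(2), of "Src C"] ty tz by simp
    have "z \<cdot> (lj \<cdot> (x \<cdot> e1)) = j \<cdot> (k \<cdot> w)"
      using comp_eq_left[OF lj(3), of "x \<cdot> e1"] lj(1,2) w x tz ty by simp
    also have "\<dots> = z \<cdot> (l \<cdot> w)"
      using comp_eq_left[OF z(2), of w] ty tz w(3,4) sl by simp
    finally have "lj \<cdot> (x \<cdot> e1) = l \<cdot> w"
      by (rule monoD[OF kernel_mono[OF z(1)]]) (use lj(1,2) w(2-4) x(1) tz ty sl in simp_all)
    then have "((e \<cdot> lj) \<cdot> x) \<cdot> e1 = e \<cdot> (l \<cdot> w)"
      using lj(1,2) w(2-4) x(1) tz ty sl eD(1) by simp
    also have "\<dots> = Zro C (Src C e1) (Trg C e)"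
      using comp_eq_left[OF eD(2), of w] w(2-4) sl ty eD(1) by simp
    finally show ?thesis
      using epi_zero[OF w(1), of "(e \<cdot> lj) \<cdot> x"] lj(1,2) w(2) x(1) tz eD ty by simp
  qed
  then obtain j' where "Src C j' = Trg C \<pi>" "Trg C j' = Trg C e" "j' \<cdot> \<pi> = e \<cdot> lj"
    using epi_desc[OF \<pi>(1), of "e \<cdot> lj"] lj(1,2) tz eD ty by (metis src_trg_comp)
  then show thesis using that lj by metis
qed

text \<open>If the class of \<open>j(x)\<close> is zero, then \<open>j(x) = j(k(w))\<close> for some
  \<open>w\<close>, so \<open>x - k(w)\<close> lies in the kernel of \<open>j\<close>, that is, in
  the image of \<open>i\<close>.\<close>

lemma derived_exact_D:
  assumes \<mu>0: "is_mono C \<mu>0" and \<pi>0: "is_epi C \<pi>0" "Trg C \<pi>0 = Src C \<mu>0"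
    and \<mu>: "is_mono C \<mu>" and \<pi>: "is_epi C \<pi>" "Trg C \<pi> = Src C \<mu>"
    and ex: "exact_at C (\<mu>0 \<cdot> \<pi>0) j" "exact_at C k (\<mu> \<cdot> \<pi>)"
    and ty: "Trg C k = Src C j" "Trg C l = Src C z"
    and z: "is_mono C z" "z \<cdot> l = j \<cdot> k" "Trg C z = Trg C j" and e: "is_cokernel C e l"
    and lj: "Src C lj = Src C j" "Trg C lj = Src C z" "z \<cdot> lj = j"
    and j': "Src C j' = Trg C \<pi>" "j' \<cdot> \<pi> = e \<cdot> lj"
  shows "exact_at C (\<pi> \<cdot> \<mu>0) j'"
proof (rule exactI)
  note eD = cokernelD[OF e] and exD = exactD[OF ex(1)] exactD[OF ex(2)]
  have tz: "Src C \<pi> = Src C j" "Trg C \<mu>0 = Src C j"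
    using exD ty \<pi> \<pi>0 by simp_all
  have sl: "Src C l = Src C k"
    using arg_cong[OF z(2), of "Src C"] ty z(3) by simp
  show "Trg C (\<pi> \<cdot> \<mu>0) = Src C j'" using tz j' by simp
  have "z \<cdot> (lj \<cdot> (\<mu>0 \<cdot> \<pi>0)) = Zro C (Src C \<pi>0) (Trg C j)"
    using exD(2) comp_eq_left[OF lj(3), of "\<mu>0 \<cdot> \<pi>0"] lj(1,2) tz \<pi>0(2) by simp
  then have "lj \<cdot> (\<mu>0 \<cdot> \<pi>0) = Zro C (Src C \<pi>0) (Src C z)"
    using mono_zero[OF z(1), of "lj \<cdot> (\<mu>0 \<cdot> \<pi>0)"] lj(1,2) tz \<pi>0(2) by simp
  then have "(lj \<cdot> \<mu>0) \<cdot> \<pi>0 = Zro C (Src C \<pi>0) (Src C z)" using lj(1,2) tz \<pi>0(2) by simp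
  then have "lj \<cdot> \<mu>0 = Zro C (Src C \<mu>0) (Src C z)"
    using epi_zero[OF \<pi>0(1), of "lj \<cdot> \<mu>0"] lj(1,2) tz \<pi>0(2) by simp
  then have "(e \<cdot> lj) \<cdot> \<mu>0 = Zro C (Src C \<mu>0) (Trg C e)" using lj(1,2) tz eD ty by simp
  then show "j' \<cdot> (\<pi> \<cdot> \<mu>0) = Zro C (Src C \<mu>0) (Trg C e)"
    using comp_eq_left[OF j'(2), of \<mu>0] j'(1) tz by simp
  fix y assume y: "Trg C y = Src C j'" "j' \<cdot> y = Zro C (Src C y) (Trg C j')"
  obtain e1 x where x: "is_epi C e1" "Trg C e1 = Src C y" "Src C x = Src C e1"
    "Trg C x = Src C \<pi>" "\<pi> \<cdot> x = y \<cdot> e1"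
    using epi_local_lift[OF \<pi>(1), of y] y j' by metis
  have "e \<cdot> (lj \<cdot> x) = j' \<cdot> (y \<cdot> e1)"
    using comp_eq_left[OF j'(2), of x] j'(1) lj(1,2) x tz eD ty by simp
  also have "\<dots> = Zro C (Src C x) (Trg C j')"
    using comp_eq_left[OF y(2), of e1] y(1) x by simp
  finally obtain e2 w where w: "is_epi C e2" "Trg C e2 = Src C x" "Src C w = Src C e2"
    "Trg C w = Src C l" "l \<cdot> w = (lj \<cdot> x) \<cdot> e2"
    using cokernel_local_lift[OF e, of "lj \<cdot> x"] lj(1,2) x(3,4) tz eD ty by (metis src_trg_comp)
  have "j \<cdot> (k \<cdot> w) = z \<cdot> (l \<cdot> w)"
    using comp_eq_left[OF z(2), of w] ty z(3) w(3,4) sl by simp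
  also have "\<dots> = j \<cdot> (x \<cdot> e2)"
    using comp_eq_left[OF lj(3), of "x \<cdot> e2"] lj(1,2) w(2,5) x(4) tz by simp
  finally have jj: "j \<cdot> (k \<cdot> w) = j \<cdot> (x \<cdot> e2)" .
  \<comment> \<open>The correction by \<open>k \<cdot> w\<close> moves \<open>x\<close> into the
    kernel of \<open>j\<close> without changing its image under \<open>\<pi>\<close>, since
    \<open>i \<cdot> k = 0\<close> and \<open>\<mu>\<close> is mono.\<close>
  define u where "u = Add C (x \<cdot> e2) (Neg C (k \<cdot> w))"
  have u: "Src C u = Src C e2" "Trg C u = Src C j"
    using w(2-4) x(3,4) tz ty sl by (simp_all add: u_def)
  have "j \<cdot> u = Zro C (Src C e2) (Trg C j)"
    using w(2-4) x(3,4) tz ty sl by (simp add: u_def jj)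
  then obtain e3 v where v: "is_epi C e3" "Trg C e3 = Src C u" "Src C v = Src C e3"
    "Trg C v = Src C \<pi>0" "(\<mu>0 \<cdot> \<pi>0) \<cdot> v = u \<cdot> e3"
    using exact_local_lift[OF ex(1), of u] u \<pi>0(2) by (metis src_trg_comp(1))
  have "\<mu> \<cdot> (\<pi> \<cdot> k) = Zro C (Src C k) (Trg C \<mu>)"
    using exD(4) \<pi>(2) ty tz by simp
  then have pk: "\<pi> \<cdot> k = Zro C (Src C k) (Trg C \<pi>)"
    using mono_zero[OF \<mu>, of "\<pi> \<cdot> k"] \<pi>(2) ty tz by simp
  have "\<pi> \<cdot> u = \<pi> \<cdot> (x \<cdot> e2)"
    using comp_eq_left[OF pk, of w] w(2-4) x(3,4) tz ty sl by (simp add: u_def)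
  then have "(\<pi> \<cdot> \<mu>0) \<cdot> (\<pi>0 \<cdot> v) = \<pi> \<cdot> (x \<cdot> (e2 \<cdot> e3))"
    using v u w(2-4) x(3,4) tz \<pi>0(2) comp_eq_left[of \<pi> u "\<pi> \<cdot> (x \<cdot> e2)" e3] by simp
  also have "\<dots> = y \<cdot> (e1 \<cdot> (e2 \<cdot> e3))"
    using comp_eq_left[OF x(5), of "e2 \<cdot> e3"] x(2-4) w(2) v(2) u y(1) j'(1) by simp
  finally show "\<exists>e x. is_epi C e \<and> Trg C e = Src C y \<and> Src C x = Src C e \<and>
      Trg C x = Src C (\<pi> \<cdot> \<mu>0) \<and> (\<pi> \<cdot> \<mu>0) \<cdot> x = y \<cdot> e"
    using x(1-3) w(1,2) v(1-4) u \<pi>0(2) tz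
    by (intro exI[of _ "e1 \<cdot> (e2 \<cdot> e3)"] exI[of _ "\<pi>0 \<cdot> v"]) (simp add: epi_comp)
qed

text \<open>\<open>k'\<close> of the class of a cycle \<open>x\<close> vanishes only if
  \<open>k(x) = 0\<close>, because \<open>\<mu>\<close> is mono. Then \<open>x = j(v)\<close>, and
  its class is \<open>j'\<close> of \<open>\<pi>(v)\<close>.\<close>

lemma derived_exact_E:
  assumes ex: "exact_at C j k" and \<mu>: "is_mono C \<mu>" "Trg C \<mu> = Trg C k"
    and z: "is_mono C z" "Trg C z = Src C k" and e: "is_epi C e" "Src C e = Src C z"
    and lj: "Src C lj = Src C j" "Trg C lj = Src C z" "z \<cdot> lj = j"
    and \<pi>: "is_epi C \<pi>" "Src C \<pi> = Src C j"
    and j': "Src C j' = Trg C \<pi>" "Trg C j' = Trg C e" "j' \<cdot> \<pi> = e \<cdot> lj"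
    and k': "Src C k' = Trg C e" "Trg C k' = Src C \<mu>" "\<mu> \<cdot> (k' \<cdot> e) = k \<cdot> z"
  shows "exact_at C j' k'"
proof (rule exactI)
  note exD = exactD[OF ex]
  show "Trg C j' = Src C k'" using j' k' by simp
  have "\<mu> \<cdot> (k' \<cdot> (e \<cdot> lj)) = (\<mu> \<cdot> (k' \<cdot> e)) \<cdot> lj"
    using k'(1,2) lj(1,2) e by simp
  also have "\<dots> = Zro C (Src C lj) (Trg C k)"
    unfolding k'(3) using lj z exD by simp
  finally have "k' \<cdot> (e \<cdot> lj) = Zro C (Src C lj) (Src C \<mu>)"
    using mono_zero[OF \<mu>(1), of "k' \<cdot> (e \<cdot> lj)"] k'(1,2) lj(1,2) e by simp
  then have "(k' \<cdot> j') \<cdot> \<pi> = Zro C (Src C lj) (Src C \<mu>)"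
    using k'(1,2) j' by simp
  then show "k' \<cdot> j' = Zro C (Src C j') (Trg C k')"
    using epi_zero[OF \<pi>(1), of "k' \<cdot> j'"] k'(1,2) j'(1,2) by simp
  fix y assume y: "Trg C y = Src C k'" "k' \<cdot> y = Zro C (Src C y) (Trg C k')"
  obtain e1 x where x: "is_epi C e1" "Trg C e1 = Src C y" "Src C x = Src C e1"
    "Trg C x = Src C e" "e \<cdot> x = y \<cdot> e1"
    using epi_local_lift[OF e(1), of y] y k' by metis
  have "k \<cdot> (z \<cdot> x) = (\<mu> \<cdot> (k' \<cdot> e)) \<cdot> x"
    unfolding k'(3) using x(4) z e by simp
  also have "\<dots> = \<mu> \<cdot> (k' \<cdot> (y \<cdot> e1))"
    using k'(1,2) x e by simp
  also have "\<dots> = Zro C (Src C x) (Trg C k)"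
    using comp_eq_left[OF y(2), of e1] y(1) x(2,3) k'(2) \<mu> by simp
  finally obtain e2 v where v: "is_epi C e2" "Trg C e2 = Src C x" "Src C v = Src C e2"
    "Trg C v = Src C j" "j \<cdot> v = (z \<cdot> x) \<cdot> e2"
    using exact_local_lift[OF ex, of "z \<cdot> x"] z e x(3,4) by (metis src_trg_comp)
  have "z \<cdot> (x \<cdot> e2) = z \<cdot> (lj \<cdot> v)"
    using v comp_eq_left[OF lj(3), of v] lj(1,2) z x(4) e by simp
  then have xe: "x \<cdot> e2 = lj \<cdot> v"
    by (rule monoD[OF z(1)]) (use v(2-4) lj(1,2) x(4) e in simp_all)
  have "j' \<cdot> (\<pi> \<cdot> v) = y \<cdot> (e1 \<cdot> e2)"
    using comp_eq_left[OF j'(3), of v] comp_eq_left[OF x(5), of e2] j'(1) v(2-4) lj(1,2) e x(2-4) \<pi>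
      xe y(1) k'(1) by simp
  then show "\<exists>e x. is_epi C e \<and> Trg C e = Src C y \<and> Src C x = Src C e \<and>
      Trg C x = Src C j' \<and> j' \<cdot> x = y \<cdot> e"
    using x(1-3) v(1-4) j'(1) \<pi>
    by (intro exI[of _ "e1 \<cdot> e2"] exI[of _ "\<pi> \<cdot> v"]) (simp add: epi_comp)
qed

text \<open>An element \<open>y\<close> of the derived \<open>D\<close>-term killed by
  \<open>i\<close> is \<open>k(w)\<close> in the original one. Since \<open>y\<close> lies in the
  image of the preceding \<open>i\<close>, it is killed by \<open>j\<close>, so \<open>w\<close> is
  a cycle and \<open>y\<close> is \<open>k'\<close> of its class.\<close>

lemma derived_exact_D':
  assumes \<mu>: "is_mono C \<mu>" and \<pi>0: "is_epi C \<pi>0" "Trg C \<pi>0 = Src C \<mu>"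
    and \<mu>1: "is_mono C \<mu>1" and \<pi>: "Trg C \<pi> = Src C \<mu>1"
    and ex: "exact_at C k (\<mu>1 \<cdot> \<pi>)" "exact_at C (\<mu> \<cdot> \<pi>0) j"
    and z: "is_kernel C z (j \<cdot> k)" "Trg C k = Src C j" and e: "is_epi C e" "Src C e = Src C z"
    and k': "Src C k' = Trg C e" "Trg C k' = Src C \<mu>" "\<mu> \<cdot> (k' \<cdot> e) = k \<cdot> z"
  shows "exact_at C k' (\<pi> \<cdot> \<mu>)"
proof (rule exactI)
  note exD = exactD[OF ex(1)] exactD[OF ex(2)] and zD = kernelD[OF z(1)]
  have tz: "Src C \<pi> = Trg C k" "Trg C \<mu> = Trg C k" "Src C j = Trg C k"
    using exD(1,3) \<pi> \<pi>0(2) z(2) by simp_all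
  have tz': "Trg C z = Src C k" using zD(1) tz by simp
  have "\<mu>1 \<cdot> (\<pi> \<cdot> k) = Zro C (Src C k) (Trg C \<mu>1)"
    using exD(2) \<pi> tz by simp
  then have pk: "\<pi> \<cdot> k = Zro C (Src C k) (Trg C \<pi>)"
    using mono_zero[OF \<mu>1, of "\<pi> \<cdot> k"] \<pi> tz by simp
  show "Trg C k' = Src C (\<pi> \<cdot> \<mu>)" using k' tz by simp
  have "((\<pi> \<cdot> \<mu>) \<cdot> k') \<cdot> e = \<pi> \<cdot> (k \<cdot> z)"
    using k' tz by simp
  also have "\<dots> = Zro C (Src C e) (Trg C \<pi>)"
    using comp_eq_left[OF pk, of z] tz tz' e by simp
  finally show "(\<pi> \<cdot> \<mu>) \<cdot> k' = Zro C (Src C k') (Trg C \<pi>)"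
    using epi_zero[OF e(1), of "(\<pi> \<cdot> \<mu>) \<cdot> k'"] k'(1,2) tz by simp
  fix y assume y: "Trg C y = Src C (\<pi> \<cdot> \<mu>)"
    "(\<pi> \<cdot> \<mu>) \<cdot> y = Zro C (Src C y) (Trg C (\<pi> \<cdot> \<mu>))"
  have ty: "Trg C y = Src C \<mu>" using y(1) tz by simp
  have "(\<mu>1 \<cdot> \<pi>) \<cdot> (\<mu> \<cdot> y) = Zro C (Src C y) (Trg C \<mu>1)"
    using y(2) ty tz \<pi> by simp
  then obtain e1 w where w: "is_epi C e1" "Trg C e1 = Src C y" "Src C w = Src C e1"
    "Trg C w = Src C k" "k \<cdot> w = (\<mu> \<cdot> y) \<cdot> e1"
    using exact_local_lift[OF ex(1), of "\<mu> \<cdot> y"] ty tz \<pi> by (metis src_trg_comp)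
  have "(j \<cdot> \<mu>) \<cdot> \<pi>0 = Zro C (Src C \<pi>0) (Trg C j)"
    using exD(4) tz \<pi>0(2) by simp
  then have jm: "j \<cdot> \<mu> = Zro C (Src C \<mu>) (Trg C j)"
    using epi_zero[OF \<pi>0(1), of "j \<cdot> \<mu>"] \<pi>0(2) tz by simp
  have "(j \<cdot> k) \<cdot> w = Zro C (Src C w) (Trg C j)"
    using w comp_eq_left[OF jm, of "y \<cdot> e1"] ty tz by simp
  then obtain w' where w': "Src C w' = Src C w" "Trg C w' = Src C z" "z \<cdot> w' = w"
    using kernel_lift[OF z(1), of w] w tz by (metis src_trg_comp(1))
  have "\<mu> \<cdot> (k' \<cdot> (e \<cdot> w')) = (\<mu> \<cdot> (k' \<cdot> e)) \<cdot> w'"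
    using k'(1,2) w'(1,2) e by simp
  also have "\<dots> = \<mu> \<cdot> (y \<cdot> e1)"
    unfolding k'(3) using w' w tz' ty by simp
  finally have "k' \<cdot> (e \<cdot> w') = y \<cdot> e1"
    by (rule monoD[OF \<mu>]) (use k'(1,2) w'(1,2) w(2,3) e ty in simp_all)
  then show "\<exists>e x. is_epi C e \<and> Trg C e = Src C y \<and> Src C x = Src C e \<and>
      Trg C x = Src C k' \<and> k' \<cdot> x = y \<cdot> e"
    using w(1-3) w'(1,2) k'(1) e
    by (intro exI[of _ "e1"] exI[of _ "e \<cdot> w'"]) simp
qed

end

section \<open>Derivation of bigraded exact couples\<close>

lemma exact_coupleD:
  assumes "exact_couple A n K"
  shows "Src A (ic K p q) = Dc K p q" "Trg A (ic K p q) = Dc K (p - 1) (q + 1)"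
    "Src A (jc K p q) = Dc K p q" "Trg A (jc K p q) = Ec K (p + n - 1) (q - n + 1)"
    "Src A (kc K p q) = Ec K p q" "Trg A (kc K p q) = Dc K (p + 1) q"
    "exact_at A (ic K (p + 1) (q - 1)) (jc K p q)"
    "exact_at A (jc K (p - n + 1) (q + n - 1)) (kc K p q)"
    "exact_at A (kc K (p - 1) q) (ic K p q)"
  using assms unfolding exact_couple_def mem_Mor by blast+

text \<open>This repeats the kernel and cokernel clauses of \<open>spectral_sequence\<close> for the
  differential \<open>j \<cdot> k\<close>, so that cycles and quotients of a page can be chosen
  before the next couple exists.\<close>

definition couple_cohomology ::
  "('a, 'b, 'y) preadd_struct_scheme \<Rightarrow> int \<Rightarrow> ('a, 'b) couple
    \<Rightarrow> (int \<Rightarrow> int \<Rightarrow> 'b) \<Rightarrow> (int \<Rightarrow> int \<Rightarrow> 'b) \<Rightarrow> bool" where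
  "couple_cohomology A n K z e \<longleftrightarrow> (\<forall>p q.
     is_kernel A (z p q) (jc K (p + 1) q \<cdot>\<^bsub>A\<^esub> kc K p q) \<and>
     (\<exists>l \<in> Mor A (Ec K (p - n) (q + n - 1)) (Src A (z p q)).
        z p q \<cdot>\<^bsub>A\<^esub> l = jc K (p - n + 1) (q + n - 1) \<cdot>\<^bsub>A\<^esub> kc K (p - n) (q + n - 1) \<and>
        is_cokernel A (e p q) l))"

context abelian_category
begin

lemma ex_couple_cohomology:
  assumes "exact_couple C n K"
  obtains z e where "couple_cohomology C n K z e"
proof -
  note KD = exact_coupleD[OF assms]
  have "\<exists>z e. is_kernel C z (jc K (p + 1) q \<cdot> kc K p q) \<and>
     (\<exists>l \<in> Mor C (Ec K (p - n) (q + n - 1)) (Src C z).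
        z \<cdot> l = jc K (p - n + 1) (q + n - 1) \<cdot> kc K (p - n) (q + n - 1) \<and>
        is_cokernel C e l)" for p q
  proof -
    obtain z where z: "is_kernel C z (jc K (p + 1) q \<cdot> kc K p q)" using ex_kernel by blast
    define d where "d = jc K (p - n + 1) (q + n - 1) \<cdot> kc K (p - n) (q + n - 1)"
    have d: "Src C d = Ec K (p - n) (q + n - 1)" "Trg C d = Ec K p q"
      unfolding d_def by (simp_all add: KD)
    have "kc K p q \<cdot> d = Zro C (Src C d) (Dc K (p + 1) q)"
      using exactD[OF KD(8), of p q] comp_eq_left[OF exactD(2)[OF KD(8), of p q]]
      unfolding d_def by (simp add: KD)
    then have "(jc K (p + 1) q \<cdot> kc K p q) \<cdot> d = Zro C (Src C d) (Ec K (p + n) (q - n + 1))"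
      using d by (simp add: KD)
    then obtain l where "Src C l = Src C d" "Trg C l = Src C z" "z \<cdot> l = d"
      using kernel_lift[OF z, of d] d KD by (metis src_trg_comp(1))
    moreover obtain e where "is_cokernel C e l" using ex_cokernel by blast
    ultimately show ?thesis using z d unfolding d_def by (metis mem_Mor)
  qed
  then show thesis using that unfolding couple_cohomology_def by metis
qed

text \<open>The image factorisations of \<open>ic K\<close> and the given cohomology data are fixed;
  the preceding chases, applied in each bidegree, supply the derived maps and their
  exactness.\<close>

lemma ex_derived_couple:
  assumes K: "exact_couple C n K" and ze: "couple_cohomology C n K z e"
  obtains K' where "derived_couple C n K z e K'" "exact_couple C (n + 1) K'"
    "Ec K' = (\<lambda>p q. Trg C (e p q))"
proof -
  note KD = exact_coupleD[OF K]
  have zk: "is_kernel C (z p q) (jc K (p + 1) q \<cdot> kc K p q)" for p q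
    using ze unfolding couple_cohomology_def by blast
  have "\<forall>p q. \<exists>l. Src C l = Ec K (p - n) (q + n - 1) \<and> Trg C l = Src C (z p q) \<and>
      z p q \<cdot> l = jc K (p - n + 1) (q + n - 1) \<cdot> kc K (p - n) (q + n - 1) \<and>
      is_cokernel C (e p q) l"
    using ze unfolding couple_cohomology_def Bex_def mem_Mor by meson
  then obtain l where l: "\<And>p q. Src C (l p q) = Ec K (p - n) (q + n - 1)"
    "\<And>p q. Trg C (l p q) = Src C (z p q)"
    "\<And>p q. z p q \<cdot> l p q = jc K (p - n + 1) (q + n - 1) \<cdot> kc K (p - n) (q + n - 1)"
    "\<And>p q. is_cokernel C (e p q) (l p q)"
    by metis
  have zt: "Trg C (z p q) = Ec K p q" for p q
    using kernelD(1)[OF zk, of p q] by (simp add: KD)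
  have es: "Src C (e p q) = Src C (z p q)" for p q
    using cokernelD(1)[OF l(4), of p q] l(2) by simp
  have "\<exists>m e. is_mono C m \<and> is_epi C e \<and> m \<cdot> e = ic K p q \<and> Src C e = Src C (ic K p q) \<and>
    Trg C e = Src C m \<and> Trg C m = Trg C (ic K p q)" for p q
    using ex_image by metis
  then obtain m \<pi> where "\<forall>p q. is_mono C (m p q) \<and> is_epi C (\<pi> p q) \<and> m p q \<cdot> \<pi> p q = ic K p q \<and>
    Src C (\<pi> p q) = Src C (ic K p q) \<and>
    Trg C (\<pi> p q) = Src C (m p q) \<and> Trg C (m p q) = Trg C (ic K p q)"
    by metis
  then have m: "\<And>p q. is_mono C (m p q)" "\<And>p q. is_epi C (\<pi> p q)"
    "\<And>p q. m p q \<cdot> \<pi> p q = ic K p q" "\<And>p q. Src C (\<pi> p q) = Dc K p q"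
    "\<And>p q. Trg C (\<pi> p q) = Src C (m p q)" "\<And>p q. Trg C (m p q) = Dc K (p - 1) (q + 1)"
    by (simp_all add: KD)
  \<comment> \<open>The map \<open>ic K (p + 2) (q - 1)\<close> is the one that ends in bidegree
    \<open>(p + 1, q)\<close>, where \<open>kc K p q\<close> takes its values.\<close>
  have "\<exists>k'. Src C k' = Trg C (e p q) \<and> Trg C k' = Src C (m (p + 2) (q - 1)) \<and>
    m (p + 2) (q - 1) \<cdot> (k' \<cdot> e p q) = kc K p q \<cdot> z p q" for p q
    by (rule derived_k_exists[of "m (p + 2) (q - 1)" "\<pi> (p + 2) (q - 1)" "jc K (p + 1) q"
          "jc K (p - n + 1) (q + n - 1)" "kc K p q" "kc K (p - n) (q + n - 1)" "l p q" "z p q" "e p q"])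
      (use KD(7)[of "p + 1" q] KD(8)[of p q] zk[of p q] in
        \<open>auto simp: m KD l algebra_simps\<close>)
  then obtain k' where k': "\<And>p q. Src C (k' p q) = Trg C (e p q)"
    "\<And>p q. Trg C (k' p q) = Src C (m (p + 2) (q - 1))"
    "\<And>p q. m (p + 2) (q - 1) \<cdot> (k' p q \<cdot> e p q) = kc K p q \<cdot> z p q"
    by metis
  have "\<exists>j' lj. Src C lj = Dc K p q \<and> Trg C lj = Src C (z (p + n - 1) (q - n + 1)) \<and>
    z (p + n - 1) (q - n + 1) \<cdot> lj = jc K p q \<and>
    Src C j' = Src C (m p q) \<and> Trg C j' = Trg C (e (p + n - 1) (q - n + 1)) \<and>
    j' \<cdot> \<pi> p q = e (p + n - 1) (q - n + 1) \<cdot> lj" for p q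
    by (rule derived_j_exists[of "m p q" "\<pi> p q" "kc K (p - 1) q" "jc K p q"
          "kc K (p + n - 1) (q - n + 1)" "jc K (p + n) (q - n + 1)" "l (p + n - 1) (q - n + 1)"
          "z (p + n - 1) (q - n + 1)" "e (p + n - 1) (q - n + 1)"])
      (use KD(9)[of p q] KD(8)[of "p + n - 1" "q - n + 1"] zk[of "p + n - 1" "q - n + 1"]
          l(3)[of "p + n - 1" "q - n + 1"] in
        \<open>auto simp: m KD l(1,2,4) algebra_simps\<close>)
  then obtain j' lj where lj: "\<And>p q. Src C (lj p q) = Dc K p q"
    "\<And>p q. Trg C (lj p q) = Src C (z (p + n - 1) (q - n + 1))"
    "\<And>p q. z (p + n - 1) (q - n + 1) \<cdot> lj p q = jc K p q"
    and j': "\<And>p q. Src C (j' p q) = Src C (m p q)"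
    "\<And>p q. Trg C (j' p q) = Trg C (e (p + n - 1) (q - n + 1))"
    "\<And>p q. j' p q \<cdot> \<pi> p q = e (p + n - 1) (q - n + 1) \<cdot> lj p q"
    by metis
  \<comment> \<open>The image of \<open>ic K p q\<close> sits inside bidegree
    \<open>(p - 1, q + 1)\<close>. Indexing the derived \<open>D\<close>-terms by the place they are
    contained in accounts for the shift by \<open>(1, -1)\<close>.\<close>
  define K' where "K' = \<lparr>Dc = (\<lambda>p q. Src C (m (p + 1) (q - 1))), Ec = (\<lambda>p q. Trg C (e p q)),
    ic = (\<lambda>p q. \<pi> p q \<cdot> m (p + 1) (q - 1)), jc = (\<lambda>p q. j' (p + 1) (q - 1)), kc = k'\<rparr>"
  have K'_simps: "Dc K' = (\<lambda>p q. Src C (m (p + 1) (q - 1)))" "Ec K' = (\<lambda>p q. Trg C (e p q))"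
    "ic K' = (\<lambda>p q. \<pi> p q \<cdot> m (p + 1) (q - 1))" "jc K' = (\<lambda>p q. j' (p + 1) (q - 1))" "kc K' = k'"
    by (simp_all add: K'_def)
  have "derived_couple C n K z e K'"
    unfolding derived_couple_def mem_Mor
  proof (rule exI[of _ \<pi>], rule exI[of _ "\<lambda>p q. m (p + 1) (q - 1)"], intro allI conjI)
    fix p q
    show "\<exists>l\<in>Mor C (Dc K p q) (Src C (z (p + n - 1) (q - n + 1))).
      z (p + n - 1) (q - n + 1) \<cdot> l = jc K p q \<and>
      jc K' (p - 1) (q + 1) \<cdot> \<pi> p q = e (p + n - 1) (q - n + 1) \<cdot> l"
      using lj[of p q] j'(3)[of p q] by (intro bexI[of _ "lj p q"]) (auto simp: K'_simps mem_Mor)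
    show "m (p + 1 + 1) (q - 1) \<cdot> (kc K' p q \<cdot> e p q) = kc K p q \<cdot> z p q"
      using k'(3)[of p q] by (simp add: K'_simps add.assoc)
  qed (simp_all add: K'_simps m KD k' j'(1,2) algebra_simps)
  moreover have "exact_couple C (n + 1) K'"
    unfolding exact_couple_def mem_Mor
  proof (intro allI conjI)
    fix p q
    have "exact_at C (\<pi> (p + 1) (q - 1) \<cdot> m (p + 2) (q - 2)) (j' (p + 1) (q - 1))"
      by (rule derived_exact_D[of "m (p + 2) (q - 2)" "\<pi> (p + 2) (q - 2)" "m (p + 1) (q - 1)"
            "\<pi> (p + 1) (q - 1)" "jc K (p + 1) (q - 1)" "kc K p (q - 1)" "l (p + n) (q - n)"
            "z (p + n) (q - n)" "e (p + n) (q - n)" "lj (p + 1) (q - 1)"])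
        (use KD(7)[of "p + 1" "q - 1"] KD(9)[of "p + 1" "q - 1"] kernel_mono[OF zk[of "p + n" "q - n"]]
          j'[of "p + 1" "q - 1"] lj[of "p + 1" "q - 1"] l(3)[of "p + n" "q - n"] in
          \<open>auto simp: m KD l(1,2,4) zt algebra_simps\<close>)
    then show "exact_at C (ic K' (p + 1) (q - 1)) (jc K' p q)"
      by (simp add: K'_simps algebra_simps)
    have "exact_at C (j' (p - n + 1) (q + n - 1)) (k' p q)"
      by (rule derived_exact_E[of "jc K (p - n + 1) (q + n - 1)" "kc K p q" "m (p + 2) (q - 1)"
            "z p q" "e p q" "lj (p - n + 1) (q + n - 1)" "\<pi> (p - n + 1) (q + n - 1)"])
        (use KD(8)[of p q] kernel_mono[OF zk[of p q]] cokernel_epi[OF l(4)[of p q]] k'(3)[of p q]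
          j'[of "p - n + 1" "q + n - 1"] lj[of "p - n + 1" "q + n - 1"] in
          \<open>auto simp: m KD zt es k'(1,2) algebra_simps\<close>)
    then show "exact_at C (jc K' (p - (n + 1) + 1) (q + (n + 1) - 1)) (kc K' p q)"
      by (simp add: K'_simps algebra_simps)
    have "exact_at C (k' (p - 1) q) (\<pi> p q \<cdot> m (p + 1) (q - 1))"
      by (rule derived_exact_D'[of "m (p + 1) (q - 1)" "\<pi> (p + 1) (q - 1)" "m p q" "\<pi> p q"
            "kc K (p - 1) q" "jc K p q" "z (p - 1) q" "e (p - 1) q"])
        (use KD(7,9)[of p q] zk[of "p - 1" q] cokernel_epi[OF l(4)[of "p - 1" q]]
          k'[of "p - 1" q] in
          \<open>auto simp: m KD es algebra_simps\<close>)
    then show "exact_at C (kc K' (p - 1) q) (ic K' p q)"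
      by (simp add: K'_simps)
  qed (simp_all add: K'_simps m KD k' j'(1,2) algebra_simps)
  ultimately show thesis using that by (simp add: K'_simps)
qed


text \<open>A derived couple depends on the cycles and quotients chosen for its predecessor, so the
  recursion is by dependent choice on triples of a couple and these two choices. Stage
  \<open>r\<close> of the choice is page \<open>r + 1\<close>.\<close>

lemma ex_spec_seq_of_couple:
  assumes "exact_couple C 1 K"
  obtains T where "spec_seq_of_couple C K T"
proof -
  let ?P = "\<lambda>r x. exact_couple C (int r + 1) (fst x) \<and>
    couple_cohomology C (int r + 1) (fst x) (fst (snd x)) (snd (snd x)) \<and> (r = 0 \<longrightarrow> fst x = K)"
  let ?Q = "\<lambda>r x y. derived_couple C (int r + 1) (fst x) (fst (snd x)) (snd (snd x)) (fst y) \<and>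
    Ec (fst y) = (\<lambda>p q. Trg C (snd (snd x) p q))"
  obtain z0 e0 where ze0: "couple_cohomology C 1 K z0 e0"
    by (rule ex_couple_cohomology[OF assms])
  have "\<exists>f. \<forall>r. ?P r (f r) \<and> ?Q r (f r) (f (Suc r))"
  proof (rule dependent_nat_choice[where Q = ?Q and P = ?P], goal_cases)
    case 1
    show ?case using assms ze0 by (intro exI[of _ "(K, z0, e0)"]) simp
  next
    case (2 x r)
    obtain K1 z e where x: "x = (K1, z, e)" by (cases x)
    obtain K' where K': "derived_couple C (int r + 1) K1 z e K'"
      "exact_couple C (int r + 1 + 1) K'" "Ec K' = (\<lambda>p q. Trg C (e p q))"
      using ex_derived_couple[of "int r + 1" K1 z e] 2 x by auto
    obtain z' e' where "couple_cohomology C (int r + 1 + 1) K' z' e'"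
      by (rule ex_couple_cohomology[OF K'(2)])
    then show ?case
      using K' x by (intro exI[of _ "(K', z', e')"]) (simp add: ac_simps)
  qed
  then obtain f where f: "\<And>r. ?P r (f r)" "\<And>r. ?Q r (f r) (f (Suc r))" by blast
  \<comment> \<open>Stages are numbered from 0 and pages from 1. Truncated subtraction makes the
    value at 0 a copy of the value at 1.\<close>
  define Ks where "Ks = (\<lambda>r. fst (f (r - 1)))"
  define T where "T = \<lparr>Eo = (\<lambda>r. Ec (Ks r)),
    dm = (\<lambda>r p q. jc (Ks r) (p + 1) q \<cdot> kc (Ks r) p q),
    zm = (\<lambda>r. fst (snd (f (r - 1)))), em = (\<lambda>r. snd (snd (f (r - 1))))\<rparr>"
  have Ks: "exact_couple C (int r) (Ks r)" "couple_cohomology C (int r) (Ks r) (zm T r) (em T r)"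
    "derived_couple C (int r) (Ks r) (zm T r) (em T r) (Ks (r + 1))"
    "Ec (Ks (r + 1)) = (\<lambda>p q. Trg C (em T r p q))" if "r \<ge> 1" for r
    using f(1)[of "r - 1"] f(2)[of "r - 1"] that
    by (auto simp: Ks_def T_def case_prod_beta of_nat_diff)
  have "spectral_sequence C T"
    unfolding spectral_sequence_def
  proof (intro allI impI conjI)
    fix r :: nat and p q assume r: "r \<ge> 1"
    note KD = exact_coupleD[OF Ks(1)[OF r]]
    show "dm T r p q \<in> Mor C (Eo T r p q) (Eo T r (p + int r) (q - int r + 1))"
      by (simp add: mem_Mor T_def KD)
    show "dm T r (p + int r) (q - int r + 1) \<cdot> dm T r p q =
      Zro C (Eo T r p q) (Eo T r (p + 2 * int r) (q - 2 * int r + 2))"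
    proof -
      have "kc (Ks r) (p + int r) (q - int r + 1) \<cdot> jc (Ks r) (p + 1) q =
        Zro C (Dc (Ks r) (p + 1) q) (Dc (Ks r) (p + int r + 1) (q - int r + 1))"
        using exactD[OF KD(8), of "p + int r" "q - int r + 1"] by (simp add: KD)
      from comp_eq_left[OF this, of "kc (Ks r) p q"] show ?thesis
        by (simp add: T_def KD algebra_simps)
    qed
    show "is_kernel C (zm T r p q) (dm T r p q)"
      using Ks(2)[OF r] by (simp add: couple_cohomology_def T_def)
    show "Trg C (em T r p q) = Eo T (r + 1) p q"
      using Ks(4)[OF r] by (simp add: T_def)
    show "\<exists>l\<in>Mor C (Eo T r (p - int r) (q + int r - 1)) (Src C (zm T r p q)).
        zm T r p q \<cdot> l = dm T r (p - int r) (q + int r - 1) \<and> is_cokernel C (em T r p q) l"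
      using Ks(2)[OF r] by (simp add: couple_cohomology_def T_def)
  qed
  then have "spec_seq_of_couple C K T"
    unfolding spec_seq_of_couple_def
    using Ks f(1)[of 0] by (intro conjI exI[of _ Ks]) (auto simp: T_def Ks_def)
  then show thesis using that by blast
qed

end

section \<open>Morphisms of couples and of spectral sequences\<close>

definition couple_morphism ::
  "('a, 'b, 'y) preadd_struct_scheme \<Rightarrow> int \<Rightarrow> ('a, 'b) couple \<Rightarrow> ('a, 'b) couple
    \<Rightarrow> (int \<Rightarrow> int \<Rightarrow> 'b) \<Rightarrow> (int \<Rightarrow> int \<Rightarrow> 'b) \<Rightarrow> bool" where
  "couple_morphism A n K L g f \<longleftrightarrow> (\<forall>p q.
     g p q \<in> Mor A (Dc K p q) (Dc L p q) \<and>
     f p q \<in> Mor A (Ec K p q) (Ec L p q) \<and>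
     g (p - 1) (q + 1) \<cdot>\<^bsub>A\<^esub> ic K p q = ic L p q \<cdot>\<^bsub>A\<^esub> g p q \<and>
     f (p + n - 1) (q - n + 1) \<cdot>\<^bsub>A\<^esub> jc K p q = jc L p q \<cdot>\<^bsub>A\<^esub> g p q \<and>
     g (p + 1) q \<cdot>\<^bsub>A\<^esub> kc K p q = kc L p q \<cdot>\<^bsub>A\<^esub> f p q)"

lemma couple_morphismD:
  assumes "couple_morphism A n K L g f"
  shows "Src A (g p q) = Dc K p q" "Trg A (g p q) = Dc L p q"
    "Src A (f p q) = Ec K p q" "Trg A (f p q) = Ec L p q"
    "g (p - 1) (q + 1) \<cdot>\<^bsub>A\<^esub> ic K p q = ic L p q \<cdot>\<^bsub>A\<^esub> g p q"
    "f (p + n - 1) (q - n + 1) \<cdot>\<^bsub>A\<^esub> jc K p q = jc L p q \<cdot>\<^bsub>A\<^esub> g p q"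
    "g (p + 1) q \<cdot>\<^bsub>A\<^esub> kc K p q = kc L p q \<cdot>\<^bsub>A\<^esub> f p q"
  using assms unfolding couple_morphism_def mem_Mor by blast+

text \<open>A description rather than a choice: the induced map is unique between spectral
  sequences, so it is a function of the pages alone, whatever derived couples lie behind
  them.\<close>

definition next_page_map ::
  "('a, 'b, 'y) cat_struct_scheme \<Rightarrow> ('a, 'b) spec_seq \<Rightarrow> ('a, 'b) spec_seq
    \<Rightarrow> nat \<Rightarrow> (int \<Rightarrow> int \<Rightarrow> 'b) \<Rightarrow> int \<Rightarrow> int \<Rightarrow> 'b" where
  "next_page_map A T T' r f p q = (THE f'. induces_on_next_page A T T' r p q (f p q) f')"

text \<open>\<open>page_map A T T' f r\<close> is the map of the pages \<open>E\<^sub>r\<close> induced by a map \<open>f\<close> of the pages \<open>E\<^sub>1\<close>;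
  its value at \<open>r = 0\<close> is junk.\<close>

primrec page_map ::
  "('a, 'b, 'y) cat_struct_scheme \<Rightarrow> ('a, 'b) spec_seq \<Rightarrow> ('a, 'b) spec_seq
    \<Rightarrow> (int \<Rightarrow> int \<Rightarrow> 'b) \<Rightarrow> nat \<Rightarrow> int \<Rightarrow> int \<Rightarrow> 'b" where
  "page_map A T T' f 0 = f"
| "page_map A T T' f (Suc r) = (if r = 0 then f else next_page_map A T T' r (page_map A T T' f r))"

lemma page_map_1 [simp]: "page_map A T T' f 1 = f" "page_map A T T' f (Suc 0) = f"
  by simp_all

context abelian_category
begin

text \<open>That \<open>g1\<close> carries one image into the other can be tested after the epi
  \<open>\<pi>\<close>, where it is the given square.\<close>

lemma image_map:
  assumes \<mu>: "is_mono C \<mu>2" "Trg C \<pi>2 = Src C \<mu>2" and \<pi>: "is_epi C \<pi>" "Trg C \<pi> = Src C \<mu>"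
    and ty: "Src C g1 = Trg C \<mu>" "Trg C g1 = Trg C \<mu>2" "Src C g = Src C \<pi>" "Trg C g = Src C \<pi>2"
    and eq: "g1 \<cdot> (\<mu> \<cdot> \<pi>) = (\<mu>2 \<cdot> \<pi>2) \<cdot> g"
  obtains g' where "Src C g' = Src C \<mu>" "Trg C g' = Src C \<mu>2" "\<mu>2 \<cdot> g' = g1 \<cdot> \<mu>" "g' \<cdot> \<pi> = \<pi>2 \<cdot> g"
proof -
  have eq': "\<mu>2 \<cdot> (\<pi>2 \<cdot> g) = (g1 \<cdot> \<mu>) \<cdot> \<pi>" using eq \<mu> \<pi> ty by simp
  obtain g' where g': "Src C g' = Src C \<mu>" "Trg C g' = Src C \<mu>2" "\<mu>2 \<cdot> g' = g1 \<cdot> \<mu>"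
    by (rule mono_lift[OF \<mu>(1) _ \<pi>(1) _ _ _ eq']) (use \<mu>(2) \<pi>(2) ty in simp_all)
  have "g' \<cdot> \<pi> = \<pi>2 \<cdot> g"
    by (rule monoD[OF \<mu>(1)])
      (use comp_eq_left[OF g'(3), of \<pi>] g'(1,2) \<mu>(2) \<pi>(2) ty eq' in simp_all)
  then show thesis using that g' by blast
qed

text \<open>Compatibility with the outgoing differential preserves cycles, compatibility with the
  incoming one preserves boundaries.\<close>

lemma cohomology_map:
  assumes z: "is_kernel C z d" "is_kernel C z2 d2" and e: "is_cokernel C e l" "is_cokernel C e2 l2"
    and zl: "z \<cdot> l = d0" "z2 \<cdot> l2 = d02" "Trg C l = Src C z" "Trg C l2 = Src C z2"
    and ty: "Src C f = Src C d" "Trg C f = Src C d2" "Src C f1 = Trg C d"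
      "Src C f0 = Src C l" "Trg C f0 = Src C l2"
    and eq: "f1 \<cdot> d = d2 \<cdot> f" "f \<cdot> d0 = d02 \<cdot> f0"
  obtains l' f' where "Src C l' = Src C z" "Trg C l' = Src C z2" "z2 \<cdot> l' = f \<cdot> z"
    "Src C f' = Trg C e" "Trg C f' = Trg C e2" "f' \<cdot> e = e2 \<cdot> l'"
proof -
  note zD = kernelD[OF z(1)] kernelD[OF z(2)] and eD = cokernelD[OF e(1)] cokernelD[OF e(2)]
  have "d2 \<cdot> (f \<cdot> z) = (f1 \<cdot> d) \<cdot> z" unfolding eq(1) using zD ty by simp
  also have "\<dots> = Zro C (Src C z) (Trg C f1)" using zD ty by simp
  finally obtain l' where l': "Src C l' = Src C z" "Trg C l' = Src C z2" "z2 \<cdot> l' = f \<cdot> z"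
    using kernel_lift[OF z(2), of "f \<cdot> z"] zD ty by (metis src_trg_comp)
  have "z2 \<cdot> (l' \<cdot> l) = f \<cdot> d0"
    using comp_eq_left[OF l'(3), of l] l'(1,2) zl(3) zD(1) ty by (simp add: zl(1))
  also have "\<dots> = z2 \<cdot> (l2 \<cdot> f0)"
    using comp_eq_left[OF zl(2), of f0] eq(2) zl(4) ty by simp
  finally have "l' \<cdot> l = l2 \<cdot> f0"
    by (rule monoD[OF kernel_mono[OF z(2)]]) (use l'(1,2) zl(3,4) ty in simp_all)
  then have "(e2 \<cdot> l') \<cdot> l = Zro C (Src C l) (Trg C e2)"
    using comp_eq_left[OF eD(4), of f0] eD l'(1,2) zl(3,4) ty by simp
  then obtain f' where "Src C f' = Trg C e" "Trg C f' = Trg C e2" "f' \<cdot> e = e2 \<cdot> l'"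
    using cokernel_desc[OF e(1), of "e2 \<cdot> l'"] eD l'(1,2) zl(3,4) by (metis src_trg_comp)
  then show thesis using that l' by blast
qed

text \<open>Each square of the derived couples becomes a square of the original ones after
  composition with the epis \<open>\<pi>\<close>, \<open>e\<close> and the monos
  \<open>\<mu>\<close>, \<open>z\<close>, all of which cancel. The last conclusion ties
  \<open>f'\<close> to \<open>f\<close> alone, in the form in which page maps are compared.\<close>

lemma derived_couple_morphism:
  assumes K: "exact_couple C n K" "couple_cohomology C n K z e" "derived_couple C n K z e K'"
      "\<And>p q. Trg C (e p q) = Ec K' p q"
    and L: "exact_couple C n L" "couple_cohomology C n L z2 e2" "derived_couple C n L z2 e2 L'"
      "\<And>p q. Trg C (e2 p q) = Ec L' p q"
    and gf: "couple_morphism C n K L g f"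
  obtains g' f' where "couple_morphism C (n + 1) K' L' g' f'"
    "\<And>p q. \<exists>l \<in> Mor C (Src C (z p q)) (Src C (z2 p q)).
      z2 p q \<cdot> l = f p q \<cdot> z p q \<and> f' p q \<cdot> e p q = e2 p q \<cdot> l"
proof -
  note KD = exact_coupleD[OF K(1)] and LD = exact_coupleD[OF L(1)] and M = couple_morphismD[OF gf]
  obtain \<pi> \<mu> where K': "\<And>p q.
     \<pi> p q \<in> Mor C (Dc K p q) (Dc K' (p - 1) (q + 1)) \<and> is_epi C (\<pi> p q) \<and>
     \<mu> p q \<in> Mor C (Dc K' p q) (Dc K p q) \<and> is_mono C (\<mu> p q) \<and>
     ic K p q = \<mu> (p - 1) (q + 1) \<cdot> \<pi> p q \<and>
     ic K' p q = \<pi> p q \<cdot> \<mu> p q \<and>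
     kc K' p q \<in> Mor C (Ec K' p q) (Dc K' (p + 1) q) \<and>
     \<mu> (p + 1) q \<cdot> (kc K' p q \<cdot> e p q) = kc K p q \<cdot> z p q \<and>
     jc K' p q \<in> Mor C (Dc K' p q) (Ec K' (p + n) (q - n)) \<and>
     (\<exists>l \<in> Mor C (Dc K p q) (Src C (z (p + n - 1) (q - n + 1))).
        z (p + n - 1) (q - n + 1) \<cdot> l = jc K p q \<and>
        jc K' (p - 1) (q + 1) \<cdot> \<pi> p q = e (p + n - 1) (q - n + 1) \<cdot> l)"
    using K(3) unfolding derived_couple_def by blast
  obtain \<pi>2 \<mu>2 where L': "\<And>p q.
     \<pi>2 p q \<in> Mor C (Dc L p q) (Dc L' (p - 1) (q + 1)) \<and> is_epi C (\<pi>2 p q) \<and>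
     \<mu>2 p q \<in> Mor C (Dc L' p q) (Dc L p q) \<and> is_mono C (\<mu>2 p q) \<and>
     ic L p q = \<mu>2 (p - 1) (q + 1) \<cdot> \<pi>2 p q \<and>
     ic L' p q = \<pi>2 p q \<cdot> \<mu>2 p q \<and>
     kc L' p q \<in> Mor C (Ec L' p q) (Dc L' (p + 1) q) \<and>
     \<mu>2 (p + 1) q \<cdot> (kc L' p q \<cdot> e2 p q) = kc L p q \<cdot> z2 p q \<and>
     jc L' p q \<in> Mor C (Dc L' p q) (Ec L' (p + n) (q - n)) \<and>
     (\<exists>l \<in> Mor C (Dc L p q) (Src C (z2 (p + n - 1) (q - n + 1))).
        z2 (p + n - 1) (q - n + 1) \<cdot> l = jc L p q \<and>
        jc L' (p - 1) (q + 1) \<cdot> \<pi>2 p q = e2 (p + n - 1) (q - n + 1) \<cdot> l)"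
    using L(3) unfolding derived_couple_def by blast
  have ty: "Src C (\<pi> p q) = Dc K p q" "Trg C (\<pi> p q) = Dc K' (p - 1) (q + 1)"
    "Src C (\<pi>2 p q) = Dc L p q" "Trg C (\<pi>2 p q) = Dc L' (p - 1) (q + 1)"
    "Src C (\<mu> p q) = Dc K' p q" "Trg C (\<mu> p q) = Dc K p q"
    "Src C (\<mu>2 p q) = Dc L' p q" "Trg C (\<mu>2 p q) = Dc L p q"
    "Src C (kc K' p q) = Ec K' p q" "Trg C (kc K' p q) = Dc K' (p + 1) q"
    "Src C (kc L' p q) = Ec L' p q" "Trg C (kc L' p q) = Dc L' (p + 1) q"
    "Src C (jc K' p q) = Dc K' p q" "Trg C (jc K' p q) = Ec K' (p + n) (q - n)"
    "Src C (jc L' p q) = Dc L' p q" "Trg C (jc L' p q) = Ec L' (p + n) (q - n)" for p q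
    using K'[of p q] L'[of p q] by (simp_all add: mem_Mor)
  have ep: "is_epi C (\<pi> p q)" "is_epi C (\<pi>2 p q)" "is_mono C (\<mu> p q)" "is_mono C (\<mu>2 p q)" for p q
    using K'[of p q] L'[of p q] by blast+
  have ii: "\<mu> (p - 1) (q + 1) \<cdot> \<pi> p q = ic K p q" "\<mu>2 (p - 1) (q + 1) \<cdot> \<pi>2 p q = ic L p q"
    "ic K' p q = \<pi> p q \<cdot> \<mu> p q" "ic L' p q = \<pi>2 p q \<cdot> \<mu>2 p q" for p q
    using K'[of p q] L'[of p q] by simp_all
  have kk: "\<mu> (p + 1) q \<cdot> (kc K' p q \<cdot> e p q) = kc K p q \<cdot> z p q"
    "\<mu>2 (p + 1) q \<cdot> (kc L' p q \<cdot> e2 p q) = kc L p q \<cdot> z2 p q" for p q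
    using K'[of p q] L'[of p q] by blast+
  have "\<exists>g'. Src C g' = Dc K' (p - 1) (q + 1) \<and> Trg C g' = Dc L' (p - 1) (q + 1) \<and>
    \<mu>2 (p - 1) (q + 1) \<cdot> g' = g (p - 1) (q + 1) \<cdot> \<mu> (p - 1) (q + 1) \<and> g' \<cdot> \<pi> p q = \<pi>2 p q \<cdot> g p q"
    for p q
    by (rule image_map[of "\<mu>2 (p - 1) (q + 1)" "\<pi>2 p q" "\<pi> p q" "\<mu> (p - 1) (q + 1)"
          "g (p - 1) (q + 1)" "g p q"]) (use M(5)[of p q] in \<open>auto simp: ep ty M(1,2) ii\<close>)
  then obtain \<gamma> where \<gamma>: "\<And>p q. Src C (\<gamma> p q) = Dc K' (p - 1) (q + 1)"
    "\<And>p q. Trg C (\<gamma> p q) = Dc L' (p - 1) (q + 1)"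
    "\<And>p q. \<mu>2 (p - 1) (q + 1) \<cdot> \<gamma> p q = g (p - 1) (q + 1) \<cdot> \<mu> (p - 1) (q + 1)"
    "\<And>p q. \<gamma> p q \<cdot> \<pi> p q = \<pi>2 p q \<cdot> g p q"
    by metis
  define g' where "g' = (\<lambda>p q. \<gamma> (p + 1) (q - 1))"
  have g': "Src C (g' p q) = Dc K' p q" "Trg C (g' p q) = Dc L' p q"
    "\<mu>2 p q \<cdot> g' p q = g p q \<cdot> \<mu> p q" "g' (p - 1) (q + 1) \<cdot> \<pi> p q = \<pi>2 p q \<cdot> g p q" for p q
    using \<gamma>[of "p + 1" "q - 1"] \<gamma>(4)[of p q] by (simp_all add: g'_def)
  have zk: "is_kernel C (z p q) (jc K (p + 1) q \<cdot> kc K p q)"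
    "is_kernel C (z2 p q) (jc L (p + 1) q \<cdot> kc L p q)" for p q
    using K(2) L(2) unfolding couple_cohomology_def by blast+
  have zt: "Trg C (z p q) = Ec K p q" "Trg C (z2 p q) = Ec L p q" for p q
    using kernelD(1)[OF zk(1), of p q] kernelD(1)[OF zk(2), of p q] by (simp_all add: KD LD)
  have fe: "\<exists>l f'. Src C l = Src C (z p q) \<and> Trg C l = Src C (z2 p q) \<and>
    z2 p q \<cdot> l = f p q \<cdot> z p q \<and> Src C f' = Ec K' p q \<and> Trg C f' = Ec L' p q \<and>
    f' \<cdot> e p q = e2 p q \<cdot> l \<and> is_epi C (e p q) \<and> Src C (e p q) = Src C (z p q) \<and>
    Src C (e2 p q) = Src C (z2 p q)" for p q
  proof -
    obtain l0 where l0: "Src C l0 = Ec K (p - n) (q + n - 1)" "Trg C l0 = Src C (z p q)"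
        "z p q \<cdot> l0 = jc K (p - n + 1) (q + n - 1) \<cdot> kc K (p - n) (q + n - 1)"
        "is_cokernel C (e p q) l0"
      using K(2) unfolding couple_cohomology_def Bex_def mem_Mor by meson
    obtain l2 where l2: "Src C l2 = Ec L (p - n) (q + n - 1)" "Trg C l2 = Src C (z2 p q)"
        "z2 p q \<cdot> l2 = jc L (p - n + 1) (q + n - 1) \<cdot> kc L (p - n) (q + n - 1)"
        "is_cokernel C (e2 p q) l2"
      using L(2) unfolding couple_cohomology_def Bex_def mem_Mor by meson
    have d: "f (p + n) (q - n + 1) \<cdot> (jc K (p + 1) q \<cdot> kc K p q) =
      (jc L (p + 1) q \<cdot> kc L p q) \<cdot> f p q" for p q
      using M(6)[of "p + 1" q] M(7)[of p q] comp_eq_left[OF M(6)[of "p + 1" q], of "kc K p q"]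
      by (simp add: KD LD M(1-4) algebra_simps)
    obtain l f' where "Src C l = Src C (z p q)" "Trg C l = Src C (z2 p q)"
        "z2 p q \<cdot> l = f p q \<cdot> z p q" "Src C f' = Trg C (e p q)" "Trg C f' = Trg C (e2 p q)"
        "f' \<cdot> e p q = e2 p q \<cdot> l"
      by (rule cohomology_map[OF zk[of p q] l0(4) l2(4) l0(3) l2(3) l0(2) l2(2) _ _ _ _ _ d[of p q],
            of "f (p - n) (q + n - 1)"])
        (use d[of "p - n" "q + n - 1"] in \<open>auto simp: KD LD M(1-4) l0(1) l2(1) algebra_simps\<close>)
    then show ?thesis
      using K(4) L(4) cokernel_epi[OF l0(4)] cokernelD(1)[OF l0(4)] cokernelD(1)[OF l2(4)] l0(2) l2(2)
      by metis
  qed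
  then obtain l f' where l: "\<And>p q. Src C (l p q) = Src C (z p q)"
    "\<And>p q. Trg C (l p q) = Src C (z2 p q)" "\<And>p q. z2 p q \<cdot> l p q = f p q \<cdot> z p q"
    and f': "\<And>p q. Src C (f' p q) = Ec K' p q" "\<And>p q. Trg C (f' p q) = Ec L' p q"
    "\<And>p q. f' p q \<cdot> e p q = e2 p q \<cdot> l p q"
    by metis
  have e: "is_epi C (e p q)" "Src C (e p q) = Src C (z p q)" "Src C (e2 p q) = Src C (z2 p q)" for p q
    using fe[of p q] by blast+
  have "couple_morphism C (n + 1) K' L' g' f'"
    unfolding couple_morphism_def
  proof (intro allI conjI)
    fix p q
    show "g' p q \<in> Mor C (Dc K' p q) (Dc L' p q)" "f' p q \<in> Mor C (Ec K' p q) (Ec L' p q)"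
      by (simp_all add: mem_Mor g' f')
    show "g' (p - 1) (q + 1) \<cdot> ic K' p q = ic L' p q \<cdot> g' p q"
      using comp_eq_left[OF g'(4)[of p q], of "\<mu> p q"]
      by (simp add: ii ty M(1,2) g')
    have "\<mu>2 (p + 1) q \<cdot> ((g' (p + 1) q \<cdot> kc K' p q) \<cdot> e p q) = g (p + 1) q \<cdot> (kc K p q \<cdot> z p q)"
      using comp_eq_left[OF g'(3)[of "p + 1" q], of "kc K' p q \<cdot> e p q"]
      by (simp add: ty M(1,2) g'(1,2) K(4) kk)
    also have "\<dots> = kc L p q \<cdot> (z2 p q \<cdot> l p q)"
      using comp_eq_left[OF M(7)[of p q], of "z p q"] by (simp add: KD LD zt M(1-4) l(3))
    also have "\<dots> = \<mu>2 (p + 1) q \<cdot> ((kc L' p q \<cdot> f' p q) \<cdot> e p q)"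
      using comp_eq_left[OF kk(2)[of p q], of "l p q"]
      by (simp add: ty f' K(4) L(4) e l(1,2) LD zt)
    finally have "(g' (p + 1) q \<cdot> kc K' p q) \<cdot> e p q = (kc L' p q \<cdot> f' p q) \<cdot> e p q"
      by (rule monoD[OF ep(4)]) (simp_all add: ty g'(1,2) f'(1,2) K(4))
    then show "g' (p + 1) q \<cdot> kc K' p q = kc L' p q \<cdot> f' p q"
      by (rule epiD[OF e(1)]) (simp_all add: ty g' f' K(4))
  next
    \<comment> \<open>Stated at \<open>(p - 1, q + 1)\<close> because \<open>\<pi> p q\<close> is
      cancelled, and that is where it ends; the required indices follow by translation.\<close>
    have main: "f' (p + n - 1) (q - n + 1) \<cdot> jc K' (p - 1) (q + 1) =
      jc L' (p - 1) (q + 1) \<cdot> g' (p - 1) (q + 1)" for p q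
    proof -
      let ?z = "z (p + n - 1) (q - n + 1)" and ?z2 = "z2 (p + n - 1) (q - n + 1)"
        and ?e = "e (p + n - 1) (q - n + 1)" and ?e2 = "e2 (p + n - 1) (q - n + 1)"
        and ?l = "l (p + n - 1) (q - n + 1)" and ?f' = "f' (p + n - 1) (q - n + 1)"
        and ?f = "f (p + n - 1) (q - n + 1)"
      obtain lK where lK: "Src C lK = Dc K p q" "Trg C lK = Src C ?z" "?z \<cdot> lK = jc K p q"
        "jc K' (p - 1) (q + 1) \<cdot> \<pi> p q = ?e \<cdot> lK"
        using K'[of p q] unfolding mem_Mor Bex_def by metis
      obtain lL where lL: "Src C lL = Dc L p q" "Trg C lL = Src C ?z2" "?z2 \<cdot> lL = jc L p q"
        "jc L' (p - 1) (q + 1) \<cdot> \<pi>2 p q = ?e2 \<cdot> lL"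
        using L'[of p q] unfolding mem_Mor Bex_def by metis
      have "?z2 \<cdot> (?l \<cdot> lK) = ?f \<cdot> (?z \<cdot> lK)"
        using comp_eq_left[OF l(3)[of "p + n - 1" "q - n + 1"], of lK]
        by (simp add: l(1,2) lK(1,2) zt M(1-4))
      also have "\<dots> = ?z2 \<cdot> (lL \<cdot> g p q)"
        using comp_eq_left[OF lL(3), of "g p q"] M(6)[of p q]
        by (simp add: lK lL(1,2) zt M(1-4))
      finally have "?l \<cdot> lK = lL \<cdot> g p q"
        by (rule monoD[OF kernel_mono[OF zk(2)]]) (simp_all add: l(1,2) lK(1,2) lL(1,2) M(1-4))
      then have "?f' \<cdot> (?e \<cdot> lK) = ?e2 \<cdot> (lL \<cdot> g p q)"
        using comp_eq_left[OF f'(3)[of "p + n - 1" "q - n + 1"], of lK]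
        by (simp add: l(1,2) lK(1,2) e f' L(4) K(4))
      also have "\<dots> = jc L' (p - 1) (q + 1) \<cdot> (\<pi>2 p q \<cdot> g p q)"
        using comp_eq_left[OF lL(4), of "g p q"] by (simp add: lL(1,2) e ty M(1-4))
      finally have "(?f' \<cdot> jc K' (p - 1) (q + 1)) \<cdot> \<pi> p q =
        (jc L' (p - 1) (q + 1) \<cdot> g' (p - 1) (q + 1)) \<cdot> \<pi> p q"
        using lK(4) g'(4)[of p q] by (simp add: ty f'(1,2) g'(1,2) algebra_simps)
      then show ?thesis
        by (rule epiD[OF ep(1)]) (simp_all add: ty f' g' algebra_simps)
    qed
    fix p q
    show "f' (p + (n + 1) - 1) (q - (n + 1) + 1) \<cdot> jc K' p q = jc L' p q \<cdot> g' p q"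
      using main[of "p + 1" "q - 1"] by (simp add: algebra_simps)
  qed
  then show thesis
    using that[of g' f'] l f' by (metis mem_Mor)
qed

section \<open>Induced page maps, their uniqueness and composition\<close>

lemma spec_seq_of_coupleE:
  assumes "spec_seq_of_couple C K T"
  obtains Ks where "Ks 1 = K" "\<And>r. r \<ge> 1 \<Longrightarrow> exact_couple C (int r) (Ks r)"
    "\<And>r. r \<ge> 1 \<Longrightarrow> Eo T r = Ec (Ks r)"
    "\<And>r p q. r \<ge> 1 \<Longrightarrow> dm T r p q = jc (Ks r) (p + 1) q \<cdot> kc (Ks r) p q"
    "\<And>r. r \<ge> 1 \<Longrightarrow> derived_couple C (int r) (Ks r) (zm T r) (em T r) (Ks (Suc r))"
    "\<And>r. r \<ge> 1 \<Longrightarrow> couple_cohomology C (int r) (Ks r) (zm T r) (em T r)"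
    "\<And>r p q. r \<ge> 1 \<Longrightarrow> Trg C (em T r p q) = Ec (Ks (Suc r)) p q"
proof -
  obtain Ks where Ks: "Ks 1 = K" "\<And>r. r \<ge> 1 \<Longrightarrow> exact_couple C (int r) (Ks r)"
    "\<And>r. r \<ge> 1 \<Longrightarrow> Eo T r = Ec (Ks r)"
    "\<And>r p q. r \<ge> 1 \<Longrightarrow> dm T r p q = jc (Ks r) (p + 1) q \<cdot> kc (Ks r) p q"
    "\<And>r. r \<ge> 1 \<Longrightarrow> derived_couple C (int r) (Ks r) (zm T r) (em T r) (Ks (Suc r))"
    using assms unfolding spec_seq_of_couple_def Suc_eq_plus1 by blast
  have T: "spectral_sequence C T" using assms unfolding spec_seq_of_couple_def by blast
  have "couple_cohomology C (int r) (Ks r) (zm T r) (em T r)" if "r \<ge> 1" for r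
    unfolding couple_cohomology_def using T that
    by (simp add: spectral_sequence_def Ks(3) flip: Ks(4))
  moreover have "Trg C (em T r p q) = Ec (Ks (Suc r)) p q" if "r \<ge> 1" for r p q
    using T that unfolding spectral_sequence_def by (simp add: Ks(3) flip: Suc_eq_plus1)
  ultimately show thesis using that Ks by blast
qed

text \<open>The mono \<open>zm T' r p q\<close> determines the restriction to cycles, and the epi
  \<open>em T r p q\<close> then determines the map of classes.\<close>

lemma induces_unique:
  assumes T: "spectral_sequence C T" "spectral_sequence C T'" and "r \<ge> 1"
    and f: "induces_on_next_page C T T' r p q f f1" "induces_on_next_page C T T' r p q f f2"
  shows "f1 = f2"
proof -
  obtain l1 where l1: "Src C l1 = Src C (zm T r p q)" "Trg C l1 = Src C (zm T' r p q)"
    "zm T' r p q \<cdot> l1 = f \<cdot> zm T r p q" "f1 \<cdot> em T r p q = em T' r p q \<cdot> l1"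
    using f(1) unfolding induces_on_next_page_def mem_Mor Bex_def by blast
  obtain l2 where l2: "Src C l2 = Src C (zm T r p q)" "Trg C l2 = Src C (zm T' r p q)"
    "zm T' r p q \<cdot> l2 = f \<cdot> zm T r p q" "f2 \<cdot> em T r p q = em T' r p q \<cdot> l2"
    using f(2) unfolding induces_on_next_page_def mem_Mor Bex_def by blast
  have "is_kernel C (zm T' r p q) (dm T' r p q)"
    using T(2) \<open>r \<ge> 1\<close> unfolding spectral_sequence_def by blast
  then have "l1 = l2"
    using l1 l2 kernel_mono monoD by metis
  moreover have "is_epi C (em T r p q)" "Trg C (em T r p q) = Eo T (r + 1) p q"
    using T(1) \<open>r \<ge> 1\<close> cokernel_epi unfolding spectral_sequence_def by blast+
  moreover have "Src C f1 = Eo T (r + 1) p q" "Src C f2 = Eo T (r + 1) p q" "Trg C f1 = Trg C f2"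
    using f unfolding induces_on_next_page_def mem_Mor by simp_all
  ultimately show ?thesis using l1(4) l2(4) epiD[of "em T r p q" f1 f2] by simp
qed

lemma induces_id:
  assumes T: "spectral_sequence C T" and "r \<ge> 1"
  shows "induces_on_next_page C T T r p q (Idm C (Eo T r p q)) (Idm C (Eo T (r + 1) p q))"
proof -
  have "is_kernel C (zm T r p q) (dm T r p q)" "dm T r p q \<in> Mor C (Eo T r p q) (Eo T r (p + int r) (q - int r + 1))"
    and e: "Trg C (em T r p q) = Eo T (r + 1) p q"
    and "\<exists>l. Trg C l = Src C (zm T r p q) \<and> is_cokernel C (em T r p q) l"
    using T \<open>r \<ge> 1\<close> unfolding spectral_sequence_def Bex_def mem_Mor by blast+
  then have "Trg C (zm T r p q) = Eo T r p q" "Src C (em T r p q) = Src C (zm T r p q)"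
    using kernelD(1) cokernelD(1) by (metis mem_Mor)+
  then show ?thesis
    unfolding induces_on_next_page_def using e
    by (auto simp: mem_Mor intro!: bexI[of _ "Idm C (Src C (zm T r p q))"])
qed

lemma induces_comp:
  assumes T: "spectral_sequence C T" "spectral_sequence C T'" "spectral_sequence C T''" and "r \<ge> 1"
    and f: "induces_on_next_page C T T' r p q f f'" and g: "induces_on_next_page C T' T'' r p q g g'"
  shows "induces_on_next_page C T T'' r p q (g \<cdot> f) (g' \<cdot> f')"
proof -
  have S: "Trg C (zm T r p q) = Eo T r p q \<and> Src C (em T r p q) = Src C (zm T r p q) \<and>
    Trg C (em T r p q) = Eo T (r + 1) p q" if T: "spectral_sequence C T" for T
  proof -
    have "is_kernel C (zm T r p q) (dm T r p q)" "dm T r p q \<in> Mor C (Eo T r p q) (Eo T r (p + int r) (q - int r + 1))"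
      and "Trg C (em T r p q) = Eo T (r + 1) p q"
      and "\<exists>l. Trg C l = Src C (zm T r p q) \<and> is_cokernel C (em T r p q) l"
      using T \<open>r \<ge> 1\<close> unfolding spectral_sequence_def Bex_def mem_Mor by blast+
    then show ?thesis
      using kernelD(1) cokernelD(1) by (metis mem_Mor)
  qed
  obtain l where l: "Src C l = Src C (zm T r p q)" "Trg C l = Src C (zm T' r p q)"
    "zm T' r p q \<cdot> l = f \<cdot> zm T r p q" "f' \<cdot> em T r p q = em T' r p q \<cdot> l"
    using f unfolding induces_on_next_page_def mem_Mor Bex_def by blast
  obtain k where k: "Src C k = Src C (zm T' r p q)" "Trg C k = Src C (zm T'' r p q)"
    "zm T'' r p q \<cdot> k = g \<cdot> zm T' r p q" "g' \<cdot> em T' r p q = em T'' r p q \<cdot> k"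
    using g unfolding induces_on_next_page_def mem_Mor Bex_def by blast
  have ty: "Src C f = Eo T r p q" "Trg C f = Eo T' r p q" "Src C g = Eo T' r p q" "Trg C g = Eo T'' r p q"
    "Src C f' = Eo T (r + 1) p q" "Trg C f' = Eo T' (r + 1) p q"
    "Src C g' = Eo T' (r + 1) p q" "Trg C g' = Eo T'' (r + 1) p q"
    using f g unfolding induces_on_next_page_def mem_Mor by blast+
  have "zm T'' r p q \<cdot> (k \<cdot> l) = (g \<cdot> f) \<cdot> zm T r p q"
    using comp_eq_left[OF k(3), of l] l(1-3) k(1,2) S[OF T(1)] S[OF T(2)] ty by simp
  moreover have "(g' \<cdot> f') \<cdot> em T r p q = em T'' r p q \<cdot> (k \<cdot> l)"
    using comp_eq_left[OF k(4), of l] l k(1,2) S[OF T(1)] S[OF T(2)] S[OF T(3)] ty by simp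
  ultimately show ?thesis
    unfolding induces_on_next_page_def mem_Mor Bex_def using ty l(1,2) k(1,2)
    by (intro conjI exI[of _ "k \<cdot> l"]) simp_all
qed

lemma next_page_map_eq:
  assumes "spectral_sequence C T" "spectral_sequence C T'" "r \<ge> 1"
    and "induces_on_next_page C T T' r p q (f p q) f'"
  shows "next_page_map C T T' r f p q = f'"
  unfolding next_page_map_def
  using induces_unique[OF assms(1-3)] assms(4) by (intro the_equality) blast+

text \<open>The induction keeps only the existence of a map of \<open>D\<close>-terms that completes
  the page map to a morphism of couples. The \<open>D\<close>-part is taken anew on each page, while
  the \<open>E\<close>-part is forced.\<close>

lemma spec_seq_morphism_page_map:
  assumes K: "spec_seq_of_couple C K T" and L: "spec_seq_of_couple C L T'"
    and gf: "couple_morphism C 1 K L g f"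
  shows "spec_seq_morphism C 1 T T' (page_map C T T' f)"
proof -
  have T: "spectral_sequence C T" "spectral_sequence C T'"
    using K L unfolding spec_seq_of_couple_def by blast+
  obtain Ks where Ks: "Ks 1 = K" "\<And>r. r \<ge> 1 \<Longrightarrow> exact_couple C (int r) (Ks r)"
    "\<And>r. r \<ge> 1 \<Longrightarrow> Eo T r = Ec (Ks r)"
    "\<And>r p q. r \<ge> 1 \<Longrightarrow> dm T r p q = jc (Ks r) (p + 1) q \<cdot> kc (Ks r) p q"
    "\<And>r. r \<ge> 1 \<Longrightarrow> derived_couple C (int r) (Ks r) (zm T r) (em T r) (Ks (Suc r))"
    "\<And>r. r \<ge> 1 \<Longrightarrow> couple_cohomology C (int r) (Ks r) (zm T r) (em T r)"
    "\<And>r p q. r \<ge> 1 \<Longrightarrow> Trg C (em T r p q) = Ec (Ks (Suc r)) p q"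
    using spec_seq_of_coupleE[OF K] by blast
  obtain Ls where Ls: "Ls 1 = L" "\<And>r. r \<ge> 1 \<Longrightarrow> exact_couple C (int r) (Ls r)"
    "\<And>r. r \<ge> 1 \<Longrightarrow> Eo T' r = Ec (Ls r)"
    "\<And>r p q. r \<ge> 1 \<Longrightarrow> dm T' r p q = jc (Ls r) (p + 1) q \<cdot> kc (Ls r) p q"
    "\<And>r. r \<ge> 1 \<Longrightarrow> derived_couple C (int r) (Ls r) (zm T' r) (em T' r) (Ls (Suc r))"
    "\<And>r. r \<ge> 1 \<Longrightarrow> couple_cohomology C (int r) (Ls r) (zm T' r) (em T' r)"
    "\<And>r p q. r \<ge> 1 \<Longrightarrow> Trg C (em T' r p q) = Ec (Ls (Suc r)) p q"
    using spec_seq_of_coupleE[OF L] by blast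
  let ?F = "page_map C T T' f"
  have next_step: "(\<exists>g'. couple_morphism C (int (Suc r)) (Ks (Suc r)) (Ls (Suc r)) g' (?F (Suc r))) \<and>
    (\<forall>p q. induces_on_next_page C T T' r p q (?F r p q) (?F (Suc r) p q))"
    if r: "r \<ge> 1" and ex: "\<exists>g. couple_morphism C (int r) (Ks r) (Ls r) g (?F r)" for r
  proof -
    obtain g where g: "couple_morphism C (int r) (Ks r) (Ls r) g (?F r)" using ex by blast
    obtain g' f' where f': "couple_morphism C (int r + 1) (Ks (Suc r)) (Ls (Suc r)) g' f'"
      "\<And>p q. \<exists>l \<in> Mor C (Src C (zm T r p q)) (Src C (zm T' r p q)).
        zm T' r p q \<cdot> l = ?F r p q \<cdot> zm T r p q \<and> f' p q \<cdot> em T r p q = em T' r p q \<cdot> l"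
      using derived_couple_morphism[OF Ks(2,6,5,7)[OF r] Ls(2,6,5,7)[OF r] g] by blast
    have ind: "induces_on_next_page C T T' r p q (?F r p q) (f' p q)" for p q
      unfolding induces_on_next_page_def
      using f'(2)[of p q] couple_morphismD(3,4)[OF g, of p q] couple_morphismD(3,4)[OF f'(1), of p q] r
      by (simp add: mem_Mor Ks(3) Ls(3))
    have "next_page_map C T T' r (?F r) p q = f' p q" for p q
      by (rule next_page_map_eq[OF T r]) (rule ind)
    then have "?F (Suc r) = f'"
      using r by (simp add: fun_eq_iff)
    then show ?thesis using f'(1) ind by (metis of_nat_Suc add.commute)
  qed
  have cm: "\<exists>g. couple_morphism C (int r) (Ks r) (Ls r) g (?F r)" if "r \<ge> 1" for r
    using that
  proof (induction r rule: nat_induct_at_least)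
    case base
    then show ?case using gf Ks(1) Ls(1) by auto
  next
    case (Suc r)
    then show ?case using next_step by simp
  qed
  show ?thesis
    unfolding spec_seq_morphism_def
  proof (intro allI impI conjI)
    fix r :: nat and p q assume r: "r \<ge> 1"
    obtain g where g: "couple_morphism C (int r) (Ks r) (Ls r) g (?F r)" using cm[OF r] by blast
    note M = couple_morphismD[OF g] and KD = exact_coupleD[OF Ks(2)[OF r]]
      and LD = exact_coupleD[OF Ls(2)[OF r]]
    show "?F r p q \<in> Mor C (Eo T r p q) (Eo T' r p q)"
      using M r by (simp add: mem_Mor Ks(3) Ls(3))
    show "?F r (p + int r) (q - int r + 1) \<cdot> dm T r p q = dm T' r p q \<cdot> ?F r p q"
      using comp_eq_left[OF M(6)[of "p + 1" q], of "kc (Ks r) p q"] M(7)[of p q] r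
      by (simp add: Ks(4) Ls(4) KD LD M(1-4) algebra_simps)
    show "induces_on_next_page C T T' r p q (?F r p q) (?F (r + 1) p q)"
      using next_step[OF r cm[OF r]] by simp
  qed
qed

text \<open>Each page determines the next one. All functor laws are reduced by this to an equation
  on one page.\<close>

lemma spec_seq_morphism_unique:
  assumes "spectral_sequence C T" "spectral_sequence C T'" "s \<ge> 1"
    and "spec_seq_morphism C s T T' F" "spec_seq_morphism C s T T' G"
    and "\<And>p q. F s p q = G s p q" and "r \<ge> s"
  shows "F r p q = G r p q"
  using \<open>r \<ge> s\<close>
proof (induction r arbitrary: p q rule: nat_induct_at_least)
  case base
  show ?case by (rule assms)
next
  case (Suc r)
  have "induces_on_next_page C T T' r p q (F r p q) (F (Suc r) p q)"
    "induces_on_next_page C T T' r p q (G r p q) (G (Suc r) p q)"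
    using assms(4,5) Suc.hyps unfolding spec_seq_morphism_def by simp_all
  then show ?case
    using induces_unique[OF assms(1,2)] Suc assms(3) by (metis le_trans)
qed

lemma spec_seq_morphism_id:
  assumes "spectral_sequence C T" "s \<ge> 1"
  shows "spec_seq_morphism C s T T (\<lambda>r p q. Idm C (Eo T r p q))"
  unfolding spec_seq_morphism_def
proof (intro allI impI conjI)
  fix r p q assume r: "s \<le> r"
  then have "dm T r p q \<in> Mor C (Eo T r p q) (Eo T r (p + int r) (q - int r + 1))"
    using assms unfolding spectral_sequence_def by simp
  then show "Idm C (Eo T r (p + int r) (q - int r + 1)) \<cdot> dm T r p q = dm T r p q \<cdot> Idm C (Eo T r p q)"
    by (simp add: mem_Mor)
  show "induces_on_next_page C T T r p q (Idm C (Eo T r p q)) (Idm C (Eo T (r + 1) p q))"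
    using induces_id[OF assms(1)] assms(2) r by simp
qed (simp add: mem_Mor)

lemma spec_seq_morphism_comp:
  assumes T: "spectral_sequence C T" "spectral_sequence C T'" "spectral_sequence C T''" "s \<ge> 1"
    and F: "spec_seq_morphism C s T T' F" and G: "spec_seq_morphism C s T' T'' G"
  shows "spec_seq_morphism C s T T'' (\<lambda>r p q. G r p q \<cdot> F r p q)"
  unfolding spec_seq_morphism_def
proof (intro allI impI conjI)
  fix r p q assume r: "s \<le> r"
  have F': "Src C (F r p q) = Eo T r p q" "Trg C (F r p q) = Eo T' r p q"
    "F r (p + int r) (q - int r + 1) \<cdot> dm T r p q = dm T' r p q \<cdot> F r p q"
    "induces_on_next_page C T T' r p q (F r p q) (F (r + 1) p q)" for p q
    using F r unfolding spec_seq_morphism_def mem_Mor by blast+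
  have G': "Src C (G r p q) = Eo T' r p q" "Trg C (G r p q) = Eo T'' r p q"
    "G r (p + int r) (q - int r + 1) \<cdot> dm T' r p q = dm T'' r p q \<cdot> G r p q"
    "induces_on_next_page C T' T'' r p q (G r p q) (G (r + 1) p q)" for p q
    using G r unfolding spec_seq_morphism_def mem_Mor by blast+
  have d: "Src C (dm T r p q) = Eo T r p q \<and> Trg C (dm T r p q) = Eo T r (p + int r) (q - int r + 1)"
    if "spectral_sequence C T" for T
    using that r T(4) unfolding spectral_sequence_def mem_Mor by simp
  show "G r p q \<cdot> F r p q \<in> Mor C (Eo T r p q) (Eo T'' r p q)"
    by (simp add: mem_Mor F' G')
  show "(G r (p + int r) (q - int r + 1) \<cdot> F r (p + int r) (q - int r + 1)) \<cdot> dm T r p q =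
    dm T'' r p q \<cdot> (G r p q \<cdot> F r p q)"
    using comp_eq_left[OF G'(3)[of p q], of "F r p q"] d[OF T(1)] d[OF T(2)] d[OF T(3)]
    by (simp add: F'(1-3) G'(1,2))
  show "induces_on_next_page C T T'' r p q (G r p q \<cdot> F r p q) (G (r + 1) p q \<cdot> F (r + 1) p q)"
    using induces_comp[OF T(1-3) _ F'(4) G'(4)] r T(4) by simp
qed

end

section \<open>Convergence of the spectral sequence of a couple\<close>

primrec couple_power ::
  "('a, 'b, 'y) cat_struct_scheme \<Rightarrow> ('a, 'b) couple \<Rightarrow> nat \<Rightarrow> int \<Rightarrow> int \<Rightarrow> 'b" where
  "couple_power A K 0 p q = Idm A (Dc K p q)"
| "couple_power A K (Suc N) p q = couple_power A K N (p - 1) (q + 1) \<cdot>\<^bsub>A\<^esub> ic K p q"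

context abelian_category
begin

lemma couple_power_src_trg:
  assumes "exact_couple C n K"
  shows "Src C (couple_power C K N p q) = Dc K p q"
    "Trg C (couple_power C K N p q) = Dc K (p - int N) (q + int N)"
proof -
  note KD = exact_coupleD[OF assms]
  have "Src C (couple_power C K N p q) = Dc K p q \<and>
    Trg C (couple_power C K N p q) = Dc K (p - int N) (q + int N)" for p q
    by (induction N arbitrary: p q) (auto simp: KD algebra_simps)
  then show "Src C (couple_power C K N p q) = Dc K p q"
    "Trg C (couple_power C K N p q) = Dc K (p - int N) (q + int N)" by blast+
qed

text \<open>The recursion splits off the factor nearest to the source; here the one nearest to the
  target is split off, since that end of the diagonal is where a convergence hypothesis
  acts.\<close>

lemma couple_power_Suc:
  assumes "exact_couple C n K"
  shows "couple_power C K (Suc N) p q = ic K (p - int N) (q + int N) \<cdot> couple_power C K N p q"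
proof (induction N arbitrary: p q)
  case 0
  then show ?case by (simp add: exact_coupleD[OF assms])
next
  case (Suc N)
  have "couple_power C K (Suc (Suc N)) p q = couple_power C K (Suc N) (p - 1) (q + 1) \<cdot> ic K p q"
    by simp
  also have "\<dots> = (ic K (p - int (Suc N)) (q + int (Suc N)) \<cdot> couple_power C K N (p - 1) (q + 1)) \<cdot> ic K p q"
    unfolding Suc.IH by (simp add: algebra_simps)
  also have "\<dots> = ic K (p - int (Suc N)) (q + int (Suc N)) \<cdot> couple_power C K (Suc N) p q"
    by (simp add: couple_power_src_trg[OF assms] exact_coupleD[OF assms] algebra_simps)
  finally show ?case .
qed

text \<open>Iterating image factorisations: the \<open>D\<close>-terms after \<open>N\<close>
  derivations are the images of the \<open>N\<close>-fold composites of \<open>i\<close>, and the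
  projections \<open>\<pi>\<close> intertwine the maps \<open>i\<close>. Questions about late pages
  thus become questions about powers of \<open>i\<close> in the original couple.\<close>

lemma derived_couple_D:
  assumes Ks: "Ks 1 = K" "\<And>r. r \<ge> 1 \<Longrightarrow> exact_couple C (int r) (Ks r)"
    "\<And>r. r \<ge> 1 \<Longrightarrow> derived_couple C (int r) (Ks r) (z r) (e r) (Ks (Suc r))"
  shows "\<exists>\<pi> \<mu>. \<forall>p q.
    Src C (\<pi> p q) = Dc K p q \<and> Trg C (\<pi> p q) = Dc (Ks (Suc N)) (p - int N) (q + int N) \<and>
    is_epi C (\<pi> p q) \<and>
    Src C (\<mu> p q) = Dc (Ks (Suc N)) p q \<and> Trg C (\<mu> p q) = Dc K p q \<and> is_mono C (\<mu> p q) \<and>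
    \<mu> (p - int N) (q + int N) \<cdot> \<pi> p q = couple_power C K N p q \<and>
    ic (Ks (Suc N)) (p - int N) (q + int N) \<cdot> \<pi> p q = \<pi> (p - 1) (q + 1) \<cdot> ic K p q"
proof (induction N)
  case 0
  have "exact_couple C 1 K" using Ks(2)[of 1] unfolding Ks(1) by simp
  note KD = exact_coupleD[OF this]
  show ?case
    by (rule exI[of _ "\<lambda>p q. Idm C (Dc K p q)"], rule exI[of _ "\<lambda>p q. Idm C (Dc K p q)"])
      (use Ks(1) in \<open>simp add: KD\<close>)
next
  case (Suc N)
  let ?K = "Ks (Suc N)" and ?K' = "Ks (Suc (Suc N))"
  have "exact_couple C 1 K" using Ks(2)[of 1] unfolding Ks(1) by simp
  note KD = exact_coupleD[OF this]
  obtain \<pi> \<mu> where "\<forall>p q.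
    Src C (\<pi> p q) = Dc K p q \<and> Trg C (\<pi> p q) = Dc ?K (p - int N) (q + int N) \<and>
    is_epi C (\<pi> p q) \<and>
    Src C (\<mu> p q) = Dc ?K p q \<and> Trg C (\<mu> p q) = Dc K p q \<and> is_mono C (\<mu> p q) \<and>
    \<mu> (p - int N) (q + int N) \<cdot> \<pi> p q = couple_power C K N p q \<and>
    ic ?K (p - int N) (q + int N) \<cdot> \<pi> p q = \<pi> (p - 1) (q + 1) \<cdot> ic K p q"
    using Suc.IH by blast
  then have A: "Src C (\<pi> p q) = Dc K p q" "Trg C (\<pi> p q) = Dc ?K (p - int N) (q + int N)"
    "is_epi C (\<pi> p q)" "Src C (\<mu> p q) = Dc ?K p q" "Trg C (\<mu> p q) = Dc K p q" "is_mono C (\<mu> p q)"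
    "\<mu> (p - int N) (q + int N) \<cdot> \<pi> p q = couple_power C K N p q"
    "ic ?K (p - int N) (q + int N) \<cdot> \<pi> p q = \<pi> (p - 1) (q + 1) \<cdot> ic K p q" for p q
    by blast+
  obtain \<pi>' \<mu>' where "\<forall>p q. \<pi>' p q \<in> Mor C (Dc ?K p q) (Dc ?K' (p - 1) (q + 1)) \<and> is_epi C (\<pi>' p q) \<and>
     \<mu>' p q \<in> Mor C (Dc ?K' p q) (Dc ?K p q) \<and> is_mono C (\<mu>' p q) \<and>
     ic ?K p q = \<mu>' (p - 1) (q + 1) \<cdot> \<pi>' p q \<and> ic ?K' p q = \<pi>' p q \<cdot> \<mu>' p q"
    using Ks(3)[of "Suc N"] unfolding derived_couple_def by fastforce
  then have B: "Src C (\<pi>' p q) = Dc ?K p q" "Trg C (\<pi>' p q) = Dc ?K' (p - 1) (q + 1)"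
    "is_epi C (\<pi>' p q)" "Src C (\<mu>' p q) = Dc ?K' p q" "Trg C (\<mu>' p q) = Dc ?K p q" "is_mono C (\<mu>' p q)"
    "\<mu>' (p - 1) (q + 1) \<cdot> \<pi>' p q = ic ?K p q" "ic ?K' p q = \<pi>' p q \<cdot> \<mu>' p q" for p q
    by (simp_all add: mem_Mor)
  let ?\<pi> = "\<lambda>p q. \<pi>' (p - int N) (q + int N) \<cdot> \<pi> p q" and ?\<mu> = "\<lambda>p q. \<mu> p q \<cdot> \<mu>' p q"
  have "?\<mu> (p - int (Suc N)) (q + int (Suc N)) \<cdot> ?\<pi> p q = couple_power C K (Suc N) p q" for p q
  proof -
    let ?p = "p - int N" and ?q = "q + int N"
    have 1: "ic ?K ?p ?q \<cdot> \<pi> p q = \<mu>' (?p - 1) (?q + 1) \<cdot> (\<pi>' ?p ?q \<cdot> \<pi> p q)"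
      using comp_eq_left[OF B(7)[of ?p ?q], of "\<pi> p q"] by (simp add: A(1,2) B(1,2,4))
    have "(\<mu> (?p - 1) (?q + 1) \<cdot> \<mu>' (?p - 1) (?q + 1)) \<cdot> ?\<pi> p q = \<mu> (?p - 1) (?q + 1) \<cdot> (\<pi> (p - 1) (q + 1) \<cdot> ic K p q)"
      using A(8)[of p q] by (simp add: A(1,2,4,5) B(1,2,4,5) 1 KD)
    also have "\<dots> = couple_power C K N (p - 1) (q + 1) \<cdot> ic K p q"
      using comp_eq_left[OF A(7)[of "p - 1" "q + 1"], of "ic K p q"]
      by (simp add: A(1,2,4,5) KD algebra_simps)
    finally show ?thesis by (simp add: algebra_simps)
  qed
  moreover have "ic ?K' (p - int (Suc N)) (q + int (Suc N)) \<cdot> ?\<pi> p q = ?\<pi> (p - 1) (q + 1) \<cdot> ic K p q" for p q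
  proof -
    let ?p = "p - int N" and ?q = "q + int N"
    have 1: "ic ?K ?p ?q \<cdot> \<pi> p q = \<mu>' (?p - 1) (?q + 1) \<cdot> (\<pi>' ?p ?q \<cdot> \<pi> p q)"
      using comp_eq_left[OF B(7)[of ?p ?q], of "\<pi> p q"] by (simp add: A(1,2) B(1,2,4))
    have "ic ?K' (?p - 1) (?q + 1) \<cdot> ?\<pi> p q = \<pi>' (?p - 1) (?q + 1) \<cdot> (\<pi> (p - 1) (q + 1) \<cdot> ic K p q)"
      using A(8)[of p q] by (simp add: A(1,2,4,5) B(1,2,4,5,8) 1 KD)
    then show ?thesis by (simp add: A(1,2,4,5) B(1,2,4,5) KD algebra_simps)
  qed
  ultimately show ?case
    by - (rule exI[of _ ?\<pi>], rule exI[of _ ?\<mu>], simp add: A(1-6) B(1-6) epi_comp mono_comp algebra_simps)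
qed

text \<open>As \<open>\<alpha> \<cdot> i = \<alpha>\<close>, every power of \<open>i\<close> has its
  kernel inside that of \<open>\<alpha>\<close>; \<open>pos\<close> gives the reverse inclusion once
  the power reaches far enough. A late derived \<open>D\<close>-term and the filtration step are
  then both the quotient of \<open>Dc K p q\<close> by the kernel of
  \<open>\<alpha>\<close>.\<close>

theorem couple_converges:
  assumes K: "spec_seq_of_couple C K T"
    and \<alpha>: "\<And>p q. Src C (\<alpha> p q) = Dc K p q" "\<And>p q. Trg C (\<alpha> p q) = L (p + q)"
      "\<And>p q. \<alpha> (p - 1) (q + 1) \<cdot> ic K p q = \<alpha> p q"
    and neg: "\<And>n. \<exists>p1. \<forall>p \<ge> p1. \<forall>q. p + q = n \<longrightarrow>
      ic K p q = Zro C (Dc K p q) (Dc K (p - 1) (q + 1)) \<and> \<alpha> p q = Zro C (Dc K p q) (L n)"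
    and pos: "\<And>n. \<exists>p0. \<forall>p \<le> p0. \<forall>q. p + q = n \<longrightarrow> is_epi C (\<alpha> p q) \<and>
      (\<forall>x. Trg C x = Dc K p q \<longrightarrow> \<alpha> p q \<cdot> x = Zro C (Src C x) (L n) \<longrightarrow>
        ic K p q \<cdot> x = Zro C (Src C x) (Dc K (p - 1) (q + 1)))"
    and F: "\<And>p q. is_image C (F (p + q) p) (\<alpha> p q)"
  shows "converges_to C T L F"
proof -
  obtain Ks where Ks: "Ks 1 = K" "\<And>r. r \<ge> 1 \<Longrightarrow> exact_couple C (int r) (Ks r)"
    "\<And>r. r \<ge> 1 \<Longrightarrow> Eo T r = Ec (Ks r)"
    "\<And>r p q. r \<ge> 1 \<Longrightarrow> dm T r p q = jc (Ks r) (p + 1) q \<cdot> kc (Ks r) p q"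
    "\<And>r. r \<ge> 1 \<Longrightarrow> derived_couple C (int r) (Ks r) (zm T r) (em T r) (Ks (Suc r))"
    using spec_seq_of_coupleE[OF K] by blast
  have K1: "exact_couple C 1 K" using Ks(2)[of 1] unfolding Ks(1) by simp
  note KD = exact_coupleD[OF K1] and pw = couple_power_src_trg[OF K1]
  have "\<exists>\<epsilon>. Src C \<epsilon> = Dc K p q \<and> Trg C \<epsilon> = Src C (F (p + q) p) \<and> is_epi C \<epsilon> \<and>
      F (p + q) p \<cdot> \<epsilon> = \<alpha> p q" for p q
    using F[of p q] \<alpha>(1)[of p q] unfolding is_image_def by (metis mem_Mor)
  then obtain \<epsilon> where \<epsilon>: "\<And>p q. Src C (\<epsilon> p q) = Dc K p q"
    "\<And>p q. Trg C (\<epsilon> p q) = Src C (F (p + q) p)" "\<And>p q. is_epi C (\<epsilon> p q)"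
    "\<And>p q. F (p + q) p \<cdot> \<epsilon> p q = \<alpha> p q"
    by metis
  have Fm: "is_mono C (F n p)" "Trg C (F n p) = L n" for n p
    using F[of p "n - p"] \<alpha>(2)[of p "n - p"] unfolding is_image_def by simp_all
  have \<alpha>pw: "\<alpha> (p - int N) (q + int N) \<cdot> couple_power C K N p q = \<alpha> p q" for N p q
  proof (induction N arbitrary: p q)
    case 0
    then show ?case by (simp add: \<alpha>)
  next
    case (Suc N)
    then show ?case
      using comp_eq_left[OF Suc[of "p - 1" "q + 1"], of "ic K p q"]
      using \<alpha>(3)[of p q] by (simp add: \<alpha>(1,2) KD pw algebra_simps)
  qed
  have "\<exists>p0 p1. (\<forall>p \<le> p0. is_isomorphism C (F n p)) \<and> (\<forall>p \<ge> p1. is_zero_object C (Src C (F n p)))"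
    for n
  proof -
    obtain p0 where p0: "\<And>p q. p \<le> p0 \<Longrightarrow> p + q = n \<Longrightarrow> is_epi C (\<alpha> p q)" using pos by blast
    obtain p1 where p1: "\<And>p q. p1 \<le> p \<Longrightarrow> p + q = n \<Longrightarrow> \<alpha> p q = Zro C (Dc K p q) (L n)"
      using neg by blast
    have "is_isomorphism C (F n p)" if "p \<le> p0" for p
      using p0[OF that, of "n - p"] \<epsilon>(2,4)[of p "n - p"] epi_cancel[of "F n p" "\<epsilon> p (n - p)"]
      by (intro mono_epi_is_isomorphism Fm) simp
    \<comment> \<open>The epi onto the image is zero because \<open>\<alpha>\<close> is, and an
      object with a zero epi onto it has zero identity.\<close>
    moreover have "is_zero_object C (Src C (F n p))" if "p \<ge> p1" for p
    proof (rule zero_object_if_id_zero)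
      have "F n p \<cdot> \<epsilon> p (n - p) = Zro C (Dc K p (n - p)) (L n)"
        using p1[OF that, of "n - p"] \<epsilon>(4)[of p "n - p"] by simp
      then have "\<epsilon> p (n - p) = Zro C (Dc K p (n - p)) (Src C (F n p))"
        using mono_zero[OF Fm(1)] \<epsilon>(1,2)[of p "n - p"] by fastforce
      then have "Idm C (Src C (F n p)) \<cdot> \<epsilon> p (n - p) = Zro C (Dc K p (n - p)) (Src C (F n p))"
        using \<epsilon>(1,2)[of p "n - p"] by simp
      then show "Idm C (Src C (F n p)) = Zro C (Src C (F n p)) (Src C (F n p))"
        using epi_zero[OF \<epsilon>(3)[of p "n - p"], of "Idm C (Src C (F n p))"] \<epsilon>(2)[of p "n - p"]
        by simp
    qed
    ultimately show ?thesis by blast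
  qed
  moreover have "\<exists>R \<ge> 1.
        (\<forall>r \<ge> R.
           dm T r p q = Zro C (Eo T r p q) (Eo T r (p + int r) (q - int r + 1)) \<and>
           dm T r (p - int r) (q + int r - 1) =
             Zro C (Eo T r (p - int r) (q + int r - 1)) (Eo T r p q)) \<and>
        (\<exists>l \<in> Mor C (Src C (F (p + q) (p + 1))) (Src C (F (p + q) p)).
           F (p + q) p \<cdot> l = F (p + q) (p + 1) \<and>
           (\<exists>c \<in> Mor C (Src C (F (p + q) p)) (Eo T R p q). is_cokernel C c l))" for p q
  proof -
    \<comment> \<open>The outgoing \<open>k\<close> ends in bidegree \<open>(p + 1, q)\<close>, so
      the vanishing of \<open>i\<close> is needed in total degree \<open>p + q + 1\<close>, while
      \<open>p0\<close> below belongs to total degree \<open>p + q\<close>.\<close>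
    obtain p1 where p1: "\<And>p' q'. p1 \<le> p' \<Longrightarrow> p' + q' = p + q + 1 \<Longrightarrow>
        ic K p' q' = Zro C (Dc K p' q') (Dc K (p' - 1) (q' + 1))" using neg by blast
    obtain p0 where p0: "\<And>p' q' x. p' \<le> p0 \<Longrightarrow> p' + q' = p + q \<Longrightarrow> Trg C x = Dc K p' q' \<Longrightarrow>
        \<alpha> p' q' \<cdot> x = Zro C (Src C x) (L (p + q)) \<Longrightarrow>
        ic K p' q' \<cdot> x = Zro C (Src C x) (Dc K (p' - 1) (q' + 1))" using pos by blast
    \<comment> \<open>Chosen so that \<open>N \<ge> N0\<close> gives both
      \<open>p + N + 1 \<ge> p1\<close> and \<open>p - (N - 1) \<le> p0\<close>; the summand 1 pays
      for the last factor \<open>i\<close>, which is applied at \<open>p - (N - 1)\<close>.\<close>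
    define N0 where "N0 = 1 + nat \<bar>p1 - p\<bar> + nat \<bar>p - p0\<bar>"
    have stable: "couple_power C K N (p + int N + 1) (q - int N) =
        Zro C (Dc K (p + int N + 1) (q - int N)) (Dc K (p + 1) q)"
      "\<And>x. Trg C x = Dc K p q \<Longrightarrow> couple_power C K N p q \<cdot> x = Zro C (Src C x) (Dc K (p - int N) (q + int N))
        \<longleftrightarrow> \<alpha> p q \<cdot> x = Zro C (Src C x) (L (p + q))" if N: "N \<ge> N0" for N
    proof -
      obtain M where M: "N = Suc M" using N unfolding N0_def by (cases N) auto
      have "ic K (p + int N + 1) (q - int N) =
        Zro C (Dc K (p + int N + 1) (q - int N)) (Dc K (p + int N) (q - int N + 1))"
        using p1[of "p + int N + 1" "q - int N"] N unfolding N0_def by simp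
      then show "couple_power C K N (p + int N + 1) (q - int N) =
        Zro C (Dc K (p + int N + 1) (q - int N)) (Dc K (p + 1) q)"
        by (simp add: M pw algebra_simps)
      fix x assume x: "Trg C x = Dc K p q"
      show "couple_power C K N p q \<cdot> x = Zro C (Src C x) (Dc K (p - int N) (q + int N))
        \<longleftrightarrow> \<alpha> p q \<cdot> x = Zro C (Src C x) (L (p + q))"
      proof
        assume "couple_power C K N p q \<cdot> x = Zro C (Src C x) (Dc K (p - int N) (q + int N))"
        then show "\<alpha> p q \<cdot> x = Zro C (Src C x) (L (p + q))"
          using comp_eq_left[OF \<alpha>pw[of p N q], of x] x by (simp add: pw \<alpha>)
      next
        assume "\<alpha> p q \<cdot> x = Zro C (Src C x) (L (p + q))"
        then have "\<alpha> (p - int M) (q + int M) \<cdot> (couple_power C K M p q \<cdot> x) = Zro C (Src C x) (L (p + q))"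
          using comp_eq_left[OF \<alpha>pw[of p M q], of x] x by (simp add: pw \<alpha>)
        then have "ic K (p - int M) (q + int M) \<cdot> (couple_power C K M p q \<cdot> x) =
          Zro C (Src C x) (Dc K (p - int M - 1) (q + int M + 1))"
          using p0[of "p - int M" "q + int M" "couple_power C K M p q \<cdot> x"] x N M
          unfolding N0_def by (simp add: pw)
        then show "couple_power C K N p q \<cdot> x = Zro C (Src C x) (Dc K (p - int N) (q + int N))"
          using x unfolding M couple_power_Suc[OF K1] by (simp add: pw KD algebra_simps)
      qed
    qed
    \<comment> \<open>On page \<open>r = N + 1\<close> the differential into \<open>(p, q)\<close>
      starts at \<open>(p - N - 1, q + N)\<close>. Both differentials vanish because the
      \<open>k\<close> they begin with does.\<close>
    have page: "kc (Ks (Suc N)) p q = Zro C (Ec (Ks (Suc N)) p q) (Dc (Ks (Suc N)) (p + 1) q) \<and>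
      kc (Ks (Suc N)) (p - int N - 1) (q + int N) = Zro C (Ec (Ks (Suc N)) (p - int N - 1) (q + int N))
         (Dc (Ks (Suc N)) (p - int N) (q + int N)) \<and>
      (\<exists>\<pi> \<pi>'. Src C \<pi> = Dc K p q \<and> Trg C \<pi> = Dc (Ks (Suc N)) (p - int N) (q + int N) \<and> is_epi C \<pi> \<and>
         (\<forall>x. Trg C x = Dc K p q \<longrightarrow> (\<pi> \<cdot> x = Zro C (Src C x) (Trg C \<pi>)
            \<longleftrightarrow> \<alpha> p q \<cdot> x = Zro C (Src C x) (L (p + q)))) \<and>
         Src C \<pi>' = Dc K (p + 1) (q - 1) \<and> Trg C \<pi>' = Dc (Ks (Suc N)) (p - int N + 1) (q + int N - 1) \<and>
         is_epi C \<pi>' \<and>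
         ic (Ks (Suc N)) (p - int N + 1) (q + int N - 1) \<cdot> \<pi>' = \<pi> \<cdot> ic K (p + 1) (q - 1))"
      if N: "N \<ge> N0" for N
    proof -
      let ?K = "Ks (Suc N)" and ?p = "p - int N" and ?q = "q + int N"
      have Kr: "exact_couple C (int (Suc N)) ?K" by (rule Ks(2)) simp
      note D = exact_coupleD[OF Kr]
      obtain \<pi> \<mu> where "\<forall>p q.
        Src C (\<pi> p q) = Dc K p q \<and> Trg C (\<pi> p q) = Dc ?K (p - int N) (q + int N) \<and>
        is_epi C (\<pi> p q) \<and>
        Src C (\<mu> p q) = Dc ?K p q \<and> Trg C (\<mu> p q) = Dc K p q \<and> is_mono C (\<mu> p q) \<and>
        \<mu> (p - int N) (q + int N) \<cdot> \<pi> p q = couple_power C K N p q \<and>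
        ic ?K (p - int N) (q + int N) \<cdot> \<pi> p q = \<pi> (p - 1) (q + 1) \<cdot> ic K p q"
        using derived_couple_D[OF Ks(1,2,5), of N] by blast
      then have A: "Src C (\<pi> p q) = Dc K p q" "Trg C (\<pi> p q) = Dc ?K (p - int N) (q + int N)"
        "is_epi C (\<pi> p q)" "Src C (\<mu> p q) = Dc ?K p q" "Trg C (\<mu> p q) = Dc K p q" "is_mono C (\<mu> p q)"
        "\<mu> (p - int N) (q + int N) \<cdot> \<pi> p q = couple_power C K N p q"
        "ic ?K (p - int N) (q + int N) \<cdot> \<pi> p q = \<pi> (p - 1) (q + 1) \<cdot> ic K p q" for p q
        by blast+
      have "\<mu> (p + 1) q \<cdot> \<pi> (p + int N + 1) (q - int N) =
          Zro C (Dc K (p + int N + 1) (q - int N)) (Dc K (p + 1) q)"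
        using A(7)[of "p + int N + 1" "q - int N"] stable(1)[OF N] by simp
      then have "\<pi> (p + int N + 1) (q - int N) = Zro C (Dc K (p + int N + 1) (q - int N)) (Dc ?K (p + 1) q)"
        using mono_zero[OF A(6)[of "p + 1" q], of "\<pi> (p + int N + 1) (q - int N)"] A(1,2,4) by simp
      \<comment> \<open>This derived \<open>D\<close>-term is the image of a zero power of
        \<open>i\<close>, so it is a zero object, and \<open>k\<close> has nowhere to go.\<close>
      then have "Idm C (Dc ?K (p + 1) q) = Zro C (Dc ?K (p + 1) q) (Dc ?K (p + 1) q)"
        using epi_zero[OF A(3)[of "p + int N + 1" "q - int N"], of "Idm C (Dc ?K (p + 1) q)"
            "Dc K (p + int N + 1) (q - int N)" "Dc ?K (p + 1) q"] A(2)[of "p + int N + 1" "q - int N"]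
        by simp
      then have k1: "kc ?K p q = Zro C (Ec ?K p q) (Dc ?K (p + 1) q)"
        using zero_object_mor(2)[OF zero_object_if_id_zero, of "Dc ?K (p + 1) q" "kc ?K p q"] D by simp
      have \<pi>: "\<pi> p q \<cdot> x = Zro C (Src C x) (Trg C (\<pi> p q)) \<longleftrightarrow> \<alpha> p q \<cdot> x = Zro C (Src C x) (L (p + q))"
        if x: "Trg C x = Dc K p q" for x
      proof -
        have "\<pi> p q \<cdot> x = Zro C (Src C x) (Trg C (\<pi> p q)) \<longleftrightarrow>
          \<mu> ?p ?q \<cdot> (\<pi> p q \<cdot> x) = Zro C (Src C x) (Dc K ?p ?q)"
          using mono_zero[OF A(6)[of ?p ?q], of "\<pi> p q \<cdot> x"] x A(1,2,4,5) by auto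
        also have "\<dots> \<longleftrightarrow> couple_power C K N p q \<cdot> x = Zro C (Src C x) (Dc K ?p ?q)"
          using comp_eq_left[OF A(7)[of p q], of x] x A(1,2,4) by simp
        finally show ?thesis using stable(2)[OF N x] by simp
      qed
      \<comment> \<open>The powers \<open>N\<close> and \<open>N + 1\<close> of \<open>i\<close>
        have the same kernel, that of \<open>\<alpha>\<close>, so \<open>i\<close> is injective on
        the image of the first. Exactness then kills the incoming \<open>k\<close>.\<close>
      have "is_mono C (ic ?K ?p ?q)"
      proof (rule monoI)
        fix y assume y: "Trg C y = Src C (ic ?K ?p ?q)"
          "ic ?K ?p ?q \<cdot> y = Zro C (Src C y) (Trg C (ic ?K ?p ?q))"
        obtain e x where x: "is_epi C e" "Trg C e = Src C y" "Src C x = Src C e"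
          "Trg C x = Dc K p q" "\<pi> p q \<cdot> x = y \<cdot> e"
          using epi_local_lift[OF A(3)[of p q], of y] y(1) A(1,2) D(1) by metis
        have "\<pi> (p - 1) (q + 1) \<cdot> (ic K p q \<cdot> x) = ic ?K ?p ?q \<cdot> (y \<cdot> e)"
          using comp_eq_left[OF A(8)[of p q], of x] x A(1,2) by (simp add: D KD)
        also have "\<dots> = Zro C (Src C x) (Dc ?K (?p - 1) (?q + 1))"
          using comp_eq_left[OF y(2), of e] y(1) x by (simp add: D)
        finally have "\<mu> (?p - 1) (?q + 1) \<cdot> (\<pi> (p - 1) (q + 1) \<cdot> (ic K p q \<cdot> x)) =
          Zro C (Src C x) (Dc K (?p - 1) (?q + 1))"
          using A(4,5) by simp
        moreover have "\<mu> (?p - 1) (?q + 1) \<cdot> (\<pi> (p - 1) (q + 1) \<cdot> (ic K p q \<cdot> x)) =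
          couple_power C K (Suc N) p q \<cdot> x"
          using comp_eq_left[OF A(7)[of "p - 1" "q + 1"], of "ic K p q \<cdot> x"] x(4) A(1,2,4)
          by (simp add: KD pw algebra_simps)
        ultimately have "\<alpha> p q \<cdot> x = Zro C (Src C x) (L (p + q))"
          using stable(2)[of "Suc N" x] N x(4) by (simp add: algebra_simps)
        then have "y \<cdot> e = Zro C (Src C x) (Dc ?K ?p ?q)"
          using \<pi>[OF x(4)] x(5) A(2) by simp
        then show "y = Zro C (Src C y) (Src C (ic ?K ?p ?q))"
          using epi_zero[OF x(1), of y] x(2) y(1) by simp
      qed
      moreover have "ic ?K ?p ?q \<cdot> kc ?K (?p - 1) ?q = Zro C (Ec ?K (?p - 1) ?q) (Dc ?K (?p - 1) (?q + 1))"
        using exactD(2)[OF D(9)[of ?p ?q]] by (simp add: D)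
      ultimately have k2: "kc ?K (?p - 1) ?q = Zro C (Ec ?K (?p - 1) ?q) (Dc ?K ?p ?q)"
        using mono_zero[of "ic ?K ?p ?q" "kc ?K (?p - 1) ?q"] D by simp
      show ?thesis
        using k1 k2 A[of p q] A[of "p + 1" "q - 1"] \<pi>
        by (intro conjI exI[of _ "\<pi> p q"] exI[of _ "\<pi> (p + 1) (q - 1)"]) (auto simp: algebra_simps)
    qed
    let ?R = "Suc N0" and ?p = "p - int N0" and ?q = "q + int N0"
    have "dm T r p q = Zro C (Eo T r p q) (Eo T r (p + int r) (q - int r + 1)) \<and>
      dm T r (p - int r) (q + int r - 1) = Zro C (Eo T r (p - int r) (q + int r - 1)) (Eo T r p q)"
      if r: "r \<ge> ?R" for r
    proof -
      obtain N where N: "r = Suc N" "N \<ge> N0" using r by (cases r) auto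
      have Kr: "exact_couple C (int r) (Ks r)" using r by (intro Ks(2)) simp
      show ?thesis
        using page[OF N(2)] exact_coupleD[OF Kr] by (simp add: N(1) Ks(3,4) algebra_simps)
    qed
    moreover have "\<exists>l \<in> Mor C (Src C (F (p + q) (p + 1))) (Src C (F (p + q) p)).
           F (p + q) p \<cdot> l = F (p + q) (p + 1) \<and>
           (\<exists>c \<in> Mor C (Src C (F (p + q) p)) (Eo T ?R p q). is_cokernel C c l)"
    proof -
      let ?K = "Ks ?R" and ?F = "F (p + q) p" and ?F' = "F (p + q) (p + 1)"
        and ?\<epsilon> = "\<epsilon> p q" and ?\<epsilon>' = "\<epsilon> (p + 1) (q - 1)" and ?i = "ic K (p + 1) (q - 1)"
      have Kr: "exact_couple C (int ?R) ?K" by (rule Ks(2)) simp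
      note D = exact_coupleD[OF Kr]
      obtain \<pi> \<pi>' where \<pi>: "Src C \<pi> = Dc K p q" "Trg C \<pi> = Dc ?K ?p ?q" "is_epi C \<pi>"
        "\<And>x. Trg C x = Dc K p q \<Longrightarrow> \<pi> \<cdot> x = Zro C (Src C x) (Trg C \<pi>)
            \<longleftrightarrow> \<alpha> p q \<cdot> x = Zro C (Src C x) (L (p + q))"
        and \<pi>': "Src C \<pi>' = Dc K (p + 1) (q - 1)" "Trg C \<pi>' = Dc ?K (?p + 1) (?q - 1)"
        "is_epi C \<pi>'" "ic ?K (?p + 1) (?q - 1) \<cdot> \<pi>' = \<pi> \<cdot> ?i"
        and k0: "kc ?K p q = Zro C (Ec ?K p q) (Dc ?K (p + 1) q)"
        using page[OF order_refl] by blast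
      have \<epsilon>': "Src C ?\<epsilon>' = Dc K (p + 1) (q - 1)" "Trg C ?\<epsilon>' = Src C ?F'" "is_epi C ?\<epsilon>'"
        "?F' \<cdot> ?\<epsilon>' = \<alpha> (p + 1) (q - 1)"
        using \<epsilon>[of "p + 1" "q - 1"] by simp_all
      have \<epsilon>0: "?\<epsilon> \<cdot> x = Zro C (Src C x) (Src C ?F) \<longleftrightarrow> \<alpha> p q \<cdot> x = Zro C (Src C x) (L (p + q))"
        if "Trg C x = Dc K p q" for x
        using mono_zero[OF Fm(1)[of "p + q" p], of "?\<epsilon> \<cdot> x"] that \<epsilon>(1,2)[of p q] Fm(2)[of "p + q" p]
          comp_eq_left[OF \<epsilon>(4)[of p q], of x] by auto
      \<comment> \<open>Both \<open>\<epsilon>\<close> and \<open>\<pi>\<close> are epis out of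
        \<open>Dc K p q\<close> with the kernel of \<open>\<alpha>\<close>; \<open>\<phi>\<close> is
        the resulting identification of the filtration step with the derived
        \<open>D\<close>-term.\<close>
      obtain \<phi> where \<phi>: "Src C \<phi> = Src C ?F" "Trg C \<phi> = Dc ?K ?p ?q" "\<phi> \<cdot> ?\<epsilon> = \<pi>"
        by (rule epi_desc[OF \<epsilon>(3)[of p q], of \<pi>]) (use \<pi> \<epsilon>0 \<epsilon>(1,2)[of p q] in auto)
      have "is_mono C \<phi>"
      proof (rule monoI)
        fix y assume y: "Trg C y = Src C \<phi>" "\<phi> \<cdot> y = Zro C (Src C y) (Trg C \<phi>)"
        obtain e x where x: "is_epi C e" "Trg C e = Src C y" "Src C x = Src C e"
          "Trg C x = Dc K p q" "?\<epsilon> \<cdot> x = y \<cdot> e"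
          using epi_local_lift[OF \<epsilon>(3)[of p q], of y] y(1) \<epsilon>(1,2)[of p q] \<phi>(1) by metis
        have "\<pi> \<cdot> x = \<phi> \<cdot> (y \<cdot> e)"
          using comp_eq_left[OF \<phi>(3), of x] x \<epsilon>(1,2)[of p q] \<phi>(1) by simp
        also have "\<dots> = Zro C (Src C x) (Trg C \<pi>)"
          using comp_eq_left[OF y(2), of e] y(1) x(2,3) \<phi>(2) \<pi>(2) by simp
        finally have "y \<cdot> e = Zro C (Src C x) (Src C ?F)"
          using \<pi>(4)[OF x(4)] \<epsilon>0[OF x(4)] x(5) by simp
        then show "y = Zro C (Src C y) (Src C \<phi>)"
          using epi_zero[OF x(1), of y] x(2) y(1) \<phi>(1) by simp
      qed
      have Fl: "?F \<cdot> (?\<epsilon> \<cdot> ?i) = ?F' \<cdot> ?\<epsilon>'"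
        using comp_eq_left[OF \<epsilon>(4)[of p q], of ?i] \<epsilon>(1,2)[of p q] \<epsilon>'(4) \<alpha>(3)[of "p + 1" "q - 1"]
        by (simp add: KD)
      obtain l where l: "Src C l = Src C ?F'" "Trg C l = Src C ?F" "?F \<cdot> l = ?F'"
        by (rule mono_lift[OF Fm(1) _ \<epsilon>'(3) _ _ _ Fl]) (use \<epsilon>' \<epsilon>(1,2)[of p q] in \<open>simp_all add: KD Fm\<close>)
      have l\<epsilon>: "l \<cdot> ?\<epsilon>' = ?\<epsilon> \<cdot> ?i"
        by (rule monoD[OF Fm(1)[of "p + q" p]])
          (use comp_eq_left[OF l(3), of ?\<epsilon>'] l(1,2) \<epsilon>'(1,2) \<epsilon>(1,2)[of p q] Fl in \<open>simp_all add: KD\<close>)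
      let ?j = "jc ?K ?p ?q"
      have j: "Src C ?j = Dc ?K ?p ?q" "Trg C ?j = Ec ?K p q" by (simp_all add: D)
      have ex: "exact_at C (ic ?K (?p + 1) (?q - 1)) ?j" "exact_at C ?j (kc ?K p q)"
        using D(7)[of ?p ?q] D(8)[of p q] by (simp_all add: algebra_simps)
      have "is_epi C ?j"
      proof -
        have "kc ?K p q \<cdot> Idm C (Ec ?K p q) = Zro C (Ec ?K p q) (Dc ?K (p + 1) q)"
          using k0 by simp
        then obtain e x where "is_epi C e" "Trg C e = Ec ?K p q" "Src C x = Src C e"
          "Trg C x = Src C ?j" "?j \<cdot> x = Idm C (Ec ?K p q) \<cdot> e"
          using exact_local_lift[OF ex(2)] by (metis D(5) src_trg_id)
        then show ?thesis using epi_cancel[of ?j x] by simp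
      qed
      have jic: "?j \<cdot> ic ?K (?p + 1) (?q - 1) = Zro C (Dc ?K (?p + 1) (?q - 1)) (Ec ?K p q)"
        using exactD(2)[OF ex(1)] j by (simp add: D)
      \<comment> \<open>As \<open>k\<close> vanishes, the epi \<open>?j\<close> is the cokernel of
        the derived \<open>i\<close>; the identification \<open>\<phi>\<close> transports this to
        the inclusion \<open>l\<close> of filtration steps.\<close>
      have "is_cokernel C (?j \<cdot> \<phi>) l"
      proof (rule cokernel_if_local_lift)
        have "is_epi C \<phi>"
          using epi_cancel[of \<phi> ?\<epsilon>] \<phi> \<pi>(3) \<epsilon>(2)[of p q] by simp
        then show "is_epi C (?j \<cdot> \<phi>)"
          using \<open>is_epi C ?j\<close> \<phi>(2) j by (intro epi_comp) simp_all
        show "Trg C l = Src C (?j \<cdot> \<phi>)" using \<phi> l j by simp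
        have "((?j \<cdot> \<phi>) \<cdot> l) \<cdot> ?\<epsilon>' = ?j \<cdot> (\<pi> \<cdot> ?i)"
          using \<phi>(1,2) l(1,2) l\<epsilon> j \<epsilon>'(1,2) \<epsilon>(1,2)[of p q] comp_eq_left[OF \<phi>(3), of ?i] by (simp add: KD)
        also have "\<dots> = Zro C (Dc K (p + 1) (q - 1)) (Ec ?K p q)"
          using comp_eq_left[OF jic, of \<pi>'] \<pi>' j by (simp add: D)
        finally show "(?j \<cdot> \<phi>) \<cdot> l = Zro C (Src C ?F') (Ec ?K p q)"
          using epi_zero[OF \<epsilon>'(3), of "(?j \<cdot> \<phi>) \<cdot> l"] \<epsilon>'(2) \<phi>(1,2) l(1,2) j by simp
        fix y assume y: "Trg C y = Src C (?j \<cdot> \<phi>)" "(?j \<cdot> \<phi>) \<cdot> y = Zro C (Src C y) (Trg C (?j \<cdot> \<phi>))"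
        have ty: "Trg C y = Src C ?F" using y(1) \<phi> j by simp
        have "?j \<cdot> (\<phi> \<cdot> y) = Zro C (Src C y) (Ec ?K p q)" using y(2) ty \<phi>(1,2) j by simp
        then obtain e1 w where w: "is_epi C e1" "Trg C e1 = Src C y" "Src C w = Src C e1"
          "Trg C w = Dc ?K (?p + 1) (?q - 1)" "ic ?K (?p + 1) (?q - 1) \<cdot> w = (\<phi> \<cdot> y) \<cdot> e1"
          using exact_local_lift[OF ex(1), of "\<phi> \<cdot> y"] ty \<phi>(1,2) j D(1) by (metis src_trg_comp)
        obtain e2 x where x: "is_epi C e2" "Trg C e2 = Src C w" "Src C x = Src C e2"
          "Trg C x = Dc K (p + 1) (q - 1)" "\<pi>' \<cdot> x = w \<cdot> e2"
          using epi_local_lift[OF \<pi>'(3), of w] w(4) \<pi>'(1,2) by metis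
        have "\<phi> \<cdot> (l \<cdot> (?\<epsilon>' \<cdot> x)) = \<phi> \<cdot> (?\<epsilon> \<cdot> (?i \<cdot> x))"
          using comp_eq_left[OF l\<epsilon>, of x] l(1,2) \<epsilon>'(1,2) \<epsilon>(1,2)[of p q] x(4) by (simp add: KD)
        also have "\<dots> = \<pi> \<cdot> (?i \<cdot> x)"
          using comp_eq_left[OF \<phi>(3), of "?i \<cdot> x"] \<epsilon>(1,2)[of p q] x(4) \<phi>(1) by (simp add: KD)
        also have "\<dots> = ic ?K (?p + 1) (?q - 1) \<cdot> (w \<cdot> e2)"
          using comp_eq_left[OF \<pi>'(4), of x] \<pi>'(1,2) \<pi>(1) x(4,5) by (simp add: D KD)
        also have "\<dots> = \<phi> \<cdot> (y \<cdot> (e1 \<cdot> e2))"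
          using comp_eq_left[OF w(5), of e2] w(2-4) x(2) ty \<phi>(1) by (simp add: D)
        finally have "l \<cdot> (?\<epsilon>' \<cdot> x) = y \<cdot> (e1 \<cdot> e2)"
          by (rule monoD[OF \<open>is_mono C \<phi>\<close>]) (use l(1,2) \<epsilon>'(1,2) x(2-4) w(2,3) ty \<phi>(1) in simp_all)
        then show "\<exists>e x. is_epi C e \<and> Trg C e = Src C y \<and> Src C x = Src C e \<and> Trg C x = Src C l \<and>
            l \<cdot> x = y \<cdot> e"
          using epi_comp[OF w(1) x(1)] w(2,3) x(2-4) l(1) \<epsilon>'(1,2)
          by (intro exI[of _ "e1 \<cdot> e2"] exI[of _ "?\<epsilon>' \<cdot> x"]) simp
      qed
      then show ?thesis
        using l \<phi> j by (intro bexI[of _ l] conjI bexI[of _ "?j \<cdot> \<phi>"]) (simp_all add: mem_Mor Ks(3))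
    qed
    ultimately show ?thesis by (intro exI[of _ ?R]) auto
  qed
  ultimately show ?thesis
    unfolding converges_to_def using Fm by blast
qed

end

section \<open>Weak kernels and lifts to Postnikov towers\<close>

context triangulated_category
begin

lemma src_trg_shift [simp]:
  "Src C (ShM C n f) = ShO C n (Src C f)" "Trg C (ShM C n f) = ShO C n (Trg C f)"
  using shift_mor[of f "Src C f" "Trg C f" n] by (simp_all add: mem_Mor)

lemma shift_comp' [simp]:
  "Trg C f = Src C g \<Longrightarrow> ShM C n (g \<cdot> f) = ShM C n g \<cdot> ShM C n f"
  using shift_comp[of f "Src C f" "Trg C f" g "Trg C g" n] by (simp add: mem_Mor)

lemma shift_add' [simp]:
  "\<lbrakk>Src C f = Src C g; Trg C f = Trg C g\<rbrakk> \<Longrightarrow> ShM C n (Add C f g) = Add C (ShM C n f) (ShM C n g)"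
  using shift_add[of f "Src C f" "Trg C f" g n] by (simp add: mem_Mor)

declare shift_id [simp] shift_obj_0 [simp] shift_obj_plus [simp] shift_mor_0 [simp] shift_mor_plus [simp]

lemma shift_zero [simp]: "ShM C n (Zro C X Y) = Zro C (ShO C n X) (ShO C n Y)"
proof -
  have "Add C (ShM C n (Zro C X Y)) (ShM C n (Zro C X Y)) = ShM C n (Zro C X Y)"
    by (simp flip: shift_add')
  then show ?thesis using zero_if_double[of "ShM C n (Zro C X Y)"] by simp
qed

lemma shift_neg [simp]: "ShM C n (Neg C f) = Neg C (ShM C n f)"
  by (rule neg_unique) (simp_all flip: shift_add')

lemma shift_eq_iff: "ShM C n f = ShM C n g \<longleftrightarrow> f = g"
  by (metis add.left_inverse shift_mor_0 shift_mor_plus)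

lemma shift_eq_zero: "ShM C n f = Zro C X Y \<Longrightarrow> f = Zro C (Src C f) (Trg C f)"
  using shift_eq_iff[of n f "Zro C (Src C f) (Trg C f)"]
  by (metis shift_zero src_trg_shift src_trg_zero)

lemma zero_object_id: "is_zero_object C Z \<Longrightarrow> Idm C Z = Zro C Z Z"
  using zero_object_mor(1)[of Z "Idm C Z"] by simp

lemma shift_zero_object:
  assumes "is_zero_object C Z"
  shows "is_zero_object C (ShO C n Z)"
proof (rule zero_object_if_id_zero)
  show "Idm C (ShO C n Z) = Zro C (ShO C n Z) (ShO C n Z)"
    using arg_cong[OF zero_object_id[OF assms], of "ShM C n"] by simp
qed

lemma distD:
  assumes "(u, v, w) \<in> Dist C"
  shows "Trg C u = Src C v" "Trg C v = Src C w" "Trg C w = ShO C 1 (Src C u)"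
  using dist_triangle[OF assms] by (simp_all add: is_triangle_def)

lemma dist_rotate:
  assumes "(u, v, w) \<in> Dist C"
  shows "(v, w, Neg C (ShM C 1 u)) \<in> Dist C"
  using TR2[OF dist_triangle[OF assms]] assms by simp

lemma dist_zero_id:
  assumes Z: "is_zero_object C Z"
  shows "(Zro C Z X, Idm C X, Zro C X (ShO C 1 Z)) \<in> Dist C"
proof -
  have "(Idm C X, Zro C X (ShO C 1 Z), Neg C (ShM C 1 (Zro C Z X))) \<in> Dist C"
    using TR1_id[OF shift_zero_object[OF Z, of 1], of X] by simp
  then show ?thesis
    using TR2[of "Zro C Z X" "Idm C X" "Zro C X (ShO C 1 Z)"] by (simp add: is_triangle_def)
qed

text \<open>TR3 for the map \<open>h\<close> into the triangle with terms zero, the target of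
  \<open>h\<close>, and the target of \<open>h\<close> again. The vanishing of
  \<open>h \<cdot> u\<close> is the required commuting square.\<close>

lemma weak_cokernel:
  assumes t: "(u, v, w) \<in> Dist C" and h: "Src C h = Trg C u" "h \<cdot> u = Zro C X Y"
  obtains h' where "Src C h' = Trg C v" "Trg C h' = Trg C h" "h' \<cdot> v = h"
proof -
  obtain Z where Z: "is_zero_object C Z" using ex_zero_object by blast
  note d = distD[OF t]
  have hu: "h \<cdot> u = Zro C (Src C u) (Trg C h)"
    using h by (metis src_trg_comp src_trg_zero)
  have "\<exists>\<gamma> \<in> Mor C (Src C w) (Src C (Zro C (Trg C h) (ShO C 1 Z))).
      \<gamma> \<cdot> v = Idm C (Trg C h) \<cdot> h \<and>
      ShM C 1 (Zro C (Src C u) Z) \<cdot> w = Zro C (Trg C h) (ShO C 1 Z) \<cdot> \<gamma>"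
    by (rule TR3[OF t dist_zero_id[OF Z, of "Trg C h"]]) (use h(1) hu d in \<open>simp_all add: mem_Mor\<close>)
  then obtain \<gamma> where "\<gamma> \<in> Mor C (Src C w) (Trg C h)" "\<gamma> \<cdot> v = Idm C (Trg C h) \<cdot> h"
    by auto
  then show thesis using that[of \<gamma>] d by (simp add: mem_Mor)
qed

text \<open>TR3 from a rotated identity triangle on the source of \<open>h\<close> produces the lift
  shifted by 1. The signs from rotating both triangles cancel.\<close>

lemma weak_kernel:
  assumes t: "(u, v, w) \<in> Dist C" and h: "Trg C h = Src C v" "v \<cdot> h = Zro C X Y"
  obtains h' where "Src C h' = Src C h" "Trg C h' = Src C u" "u \<cdot> h' = h"
proof -
  obtain Z where Z: "is_zero_object C Z" using ex_zero_object by blast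
  note d = distD[OF t]
  let ?W = "Src C h"
  have vh: "v \<cdot> h = Zro C ?W (Trg C v)"
    using h by (metis src_trg_comp src_trg_zero)
  have "\<exists>\<gamma> \<in> Mor C (Src C (Neg C (ShM C 1 (Idm C ?W)))) (Src C (Neg C (ShM C 1 u))).
      \<gamma> \<cdot> Zro C Z (ShO C 1 ?W) = w \<cdot> Zro C Z (Trg C v) \<and>
      ShM C 1 h \<cdot> Neg C (ShM C 1 (Idm C ?W)) = Neg C (ShM C 1 u) \<cdot> \<gamma>"
    by (rule TR3[OF dist_rotate[OF TR1_id[OF Z, of ?W]] dist_rotate[OF t]])
      (use h(1) d vh in \<open>simp_all add: mem_Mor\<close>)
  then obtain \<gamma> where \<gamma>: "Src C \<gamma> = ShO C 1 ?W" "Trg C \<gamma> = ShO C 1 (Src C u)"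
    "Neg C (ShM C 1 h) = Neg C (ShM C 1 u \<cdot> \<gamma>)"
    by (auto simp: mem_Mor)
  have eq: "ShM C 1 h = ShM C 1 u \<cdot> \<gamma>"
    using \<gamma>(3) by (metis neg_neg)
  have "h = ShM C (- 1) (ShM C 1 h)" by simp
  also have "\<dots> = u \<cdot> ShM C (- 1) \<gamma>"
    unfolding eq using \<gamma>(1,2) d by simp
  finally have "u \<cdot> ShM C (- 1) \<gamma> = h" by (rule sym)
  from that[OF _ _ this] show thesis using \<gamma>(1,2) by simp
qed

text \<open>Extension along the first map of a triangle. Two rotations put \<open>w\<close> before
  \<open>-u[1]\<close>, so the obstruction is the composite of \<open>h[1]\<close> with
  \<open>w\<close>.\<close>

lemma weak_cokernel_left:
  assumes t: "(u, v, w) \<in> Dist C" and h: "Src C h = Src C u" "ShM C 1 h \<cdot> w = Zro C X Y"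
  obtains h' where "Src C h' = Trg C u" "Trg C h' = Trg C h" "h' \<cdot> u = h"
proof -
  note d = distD[OF t]
  obtain k where k: "Src C k = ShO C 1 (Trg C u)" "Trg C k = ShO C 1 (Trg C h)"
    "k \<cdot> Neg C (ShM C 1 u) = ShM C 1 h"
    by (rule weak_cokernel[OF dist_rotate[OF dist_rotate[OF t]] _ h(2)]) (use h(1) d in auto)
  have "h = ShM C (- 1) (ShM C 1 h)" by simp
  also have "\<dots> = Neg C (ShM C (- 1) k) \<cdot> u"
    unfolding k(3)[symmetric] using k(1,2) by simp
  finally have "Neg C (ShM C (- 1) k) \<cdot> u = h" by (rule sym)
  from that[OF _ _ this] show thesis using k(1,2) by simp
qed

end

section \<open>Weight Postnikov towers: boundedness and lifts of morphisms\<close>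

lemma tower_simps:
  assumes "weight_postnikov_tower C Wle Wge X P"
  shows "Src C (aT P k) = ShO C k X" "Trg C (aT P k) = LE P k"
    "Src C (fT P k) = LE P k" "Trg C (fT P k) = GE P (k + 1)"
    "Src C (bT P k) = GE P k" "Trg C (bT P k) = ShO C k X"
    "Src C (sT P k) = ShO C (- 1) (LE P k)" "Trg C (sT P k) = LE P (k - 1)"
    "Src C (tT P k) = ShO C (- 1) (GE P (k + 1))" "Trg C (tT P k) = GE P k"
    "Src C (cT P k) = LE P (k - 1)" "Trg C (cT P k) = GR P k"
    "Src C (dT P k) = GR P k" "Trg C (dT P k) = LE P k"
    "Src C (yT P k) = GE P k" "Trg C (yT P k) = GR P k"
  using assms unfolding weight_postnikov_tower_def mem_Mor by blast+

lemma towerD: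
  assumes "weight_postnikov_tower C Wle Wge X P"
  shows "LE P k \<in> Wle" "GE P k \<in> Wge" "GR P k \<in> Wle" "GR P k \<in> Wge"
    "(aT P k, fT P k, bT P (k + 1)) \<in> Dist C"
    "(sT P k, cT P k, dT P k) \<in> Dist C" "(xT P k, tT P k, yT P k) \<in> Dist C"
    "sT P k \<cdot>\<^bsub>C\<^esub> ShM C (- 1) (aT P k) = aT P (k - 1)"
    "tT P k \<cdot>\<^bsub>C\<^esub> Neg C (ShM C (- 1) (fT P k)) = fT P (k - 1) \<cdot>\<^bsub>C\<^esub> sT P k"
    "cT P k = yT P k \<cdot>\<^bsub>C\<^esub> fT P (k - 1)"
  using assms unfolding weight_postnikov_tower_def by blast+

context weight_structure
begin

lemma orth: "\<lbrakk>Src C f \<in> Wge; Trg C f = ShO C 1 Y; Y \<in> Wle\<rbrakk> \<Longrightarrow> f = Zro C (Src C f) (Trg C f)"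
  using orthogonality unfolding perp_def
  by (metis image_eqI mem_Mor singletonD)

lemma orth_shift:
  assumes "Src C f = ShO C (- 1) Z" "Z \<in> Wge" "Trg C f \<in> Wle"
  shows "f = Zro C (Src C f) (Trg C f)"
  using orth[of "ShM C 1 f" "Trg C f"] assms by (intro shift_eq_zero[of 1]) simp

lemma Wle_shift: "Y \<in> Wle \<Longrightarrow> ShO C (int n) Y \<in> Wle"
proof (induction n)
  case (Suc n)
  then have "ShO C 1 (ShO C (int n) Y) \<in> Wle" using semi_invariance_le by blast
  then show ?case by simp
qed simp

lemma Wge_shift: "Y \<in> Wge \<Longrightarrow> ShO C (- int n) Y \<in> Wge"
proof (induction n)
  case (Suc n)
  then obtain Z where Z: "ShO C (- int n) Y = ShO C 1 Z" "Z \<in> Wge" using semi_invariance_ge by blast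
  have "ShO C (- int (Suc n)) Y = ShO C (- 1) (ShO C (- int n) Y)" by simp
  also have "\<dots> = Z" unfolding Z(1) by simp
  finally show ?case using Z by simp
qed simp

lemma Wle_weight_class: "\<lbrakk>X \<in> weight_class C Wle m; m \<le> k\<rbrakk> \<Longrightarrow> ShO C k X \<in> Wle"
  using Wle_shift[of _ "nat (k - m)"] by (auto simp: weight_class_def)

lemma Wge_weight_class: "\<lbrakk>X \<in> weight_class C Wge m; k \<le> m\<rbrakk> \<Longrightarrow> ShO C k X \<in> Wge"
  using Wge_shift[of _ "nat (m - k)"] by (auto simp: weight_class_def)

text \<open>\<open>bT P (k + 1)\<close> runs from weight \<open>\<ge> 0\<close> to
  \<open>X[k + 1]\<close>, which lies in \<open>Wle[1]\<close>, so it is zero. The identity of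
  \<open>GE P (k + 1)\<close> then lifts along \<open>fT P k\<close>, and this is the
  retraction.\<close>

lemma tower_bounded_above:
  assumes P: "weight_postnikov_tower C Wle Wge X P" and X: "X \<in> weight_class C Wle m" "m \<le> k"
  shows "bT P (k + 1) = Zro C (GE P (k + 1)) (ShO C (k + 1) X)"
    "GE P (k + 1) \<in> Wle" "tT P (k + 1) = Zro C (ShO C (- 1) (GE P (k + 2))) (GE P (k + 1))"
proof -
  note S = tower_simps[OF P] and D = towerD[OF P]
  show b: "bT P (k + 1) = Zro C (GE P (k + 1)) (ShO C (k + 1) X)"
    using orth[of "bT P (k + 1)" "ShO C k X"] Wle_weight_class[OF X] S D by (simp add: add.commute)
  have "bT P (k + 1) \<cdot> Idm C (GE P (k + 1)) = Zro C (GE P (k + 1)) (ShO C (k + 1) X)"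
    using b by simp
  then obtain h where "Src C h = GE P (k + 1)" "Trg C h = LE P k" "fT P k \<cdot> h = Idm C (GE P (k + 1))"
    by (rule weak_kernel[OF dist_rotate[OF D(5)[of k]], rotated]) (auto simp: S)
  then have "is_retract_of C (GE P (k + 1)) (LE P k)"
    unfolding is_retract_of_def using S by (metis mem_Mor)
  then show GE: "GE P (k + 1) \<in> Wle"
    using Karoubi_le D(1) unfolding Karoubi_closed_def by blast
  show "tT P (k + 1) = Zro C (ShO C (- 1) (GE P (k + 2))) (GE P (k + 1))"
    using orth_shift[of "tT P (k + 1)" "GE P (k + 2)"] S D GE by (simp add: add.assoc)
qed

lemma tower_bounded_below:
  assumes P: "weight_postnikov_tower C Wle Wge X P" and X: "X \<in> weight_class C Wge m" "k < m"
  shows "aT P k = Zro C (ShO C k X) (LE P k)" "sT P k = Zro C (ShO C (- 1) (LE P k)) (LE P (k - 1))"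
proof -
  note S = tower_simps[OF P] and D = towerD[OF P]
  \<comment> \<open>The strict bound matters: orthogonality needs \<open>X[k]\<close> to be a shift
    by -1 of the object \<open>X[k + 1]\<close> of weight \<open>\<ge> 0\<close>, so
    \<open>k + 1 \<le> m\<close>.\<close>
  show a: "aT P k = Zro C (ShO C k X) (LE P k)"
    using orth_shift[of "aT P k" "ShO C (k + 1) X"] Wge_weight_class[OF X(1), of "k + 1"] X S D
    by simp
  have "Idm C (LE P k) \<cdot> aT P k = Zro C (ShO C k X) (LE P k)"
    using a by simp
  then obtain h where "Src C h = GE P (k + 1)" "Trg C h = LE P k" "h \<cdot> fT P k = Idm C (LE P k)"
    by (rule weak_cokernel[OF D(5)[of k], rotated]) (auto simp: S)
  then have "is_retract_of C (LE P k) (GE P (k + 1))"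
    unfolding is_retract_of_def using S by (metis mem_Mor)
  then have "LE P k \<in> Wge"
    using Karoubi_ge D(2) unfolding Karoubi_closed_def by blast
  then show "sT P k = Zro C (ShO C (- 1) (LE P k)) (LE P (k - 1))"
    using orth_shift[of "sT P k" "LE P k"] S D by simp
qed

text \<open>The difference of two such morphisms factors through \<open>GE P (k + 1)[-1]\<close>.\<close>

lemma tower_mor_ext:
  assumes P: "weight_postnikov_tower C Wle Wge X P"
    and ty: "Src C g = ShO C (- 1) (LE P k)" "Src C h = ShO C (- 1) (LE P k)" "Trg C g = Trg C h"
      "Trg C h \<in> Wle"
    and eq: "g \<cdot> ShM C (- 1) (aT P k) = h \<cdot> ShM C (- 1) (aT P k)"
  shows "g = h"
proof -
  note S = tower_simps[OF P] and D = towerD[OF P]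
  define \<delta> where "\<delta> = Add C g (Neg C h)"
  have \<delta>: "Src C \<delta> = ShO C (- 1) (LE P k)" "Trg C \<delta> = Trg C h"
    using ty by (simp_all add: \<delta>_def)
  have "\<delta> \<cdot> ShM C (- 1) (aT P k) = Zro C (ShO C (k - 1) X) (Trg C h)"
    using ty S eq by (simp add: \<delta>_def)
  then have "ShM C 1 (\<delta> \<cdot> ShM C (- 1) (aT P k)) = Zro C (ShO C k X) (ShO C 1 (Trg C h))"
    by simp
  then have "ShM C 1 \<delta> \<cdot> aT P k = Zro C (ShO C k X) (ShO C 1 (Trg C h))"
    using \<delta> S by simp
  then obtain \<eta> where \<eta>: "Src C \<eta> = GE P (k + 1)" "Trg C \<eta> = ShO C 1 (Trg C h)"
    "\<eta> \<cdot> fT P k = ShM C 1 \<delta>"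
    using weak_cokernel[OF D(5)[of k], of "ShM C 1 \<delta>"] \<delta> S by (metis add.right_inverse shift_obj_0 shift_obj_plus src_trg_shift)
  have "\<eta> = Zro C (GE P (k + 1)) (ShO C 1 (Trg C h))"
    using orth[of \<eta> "Trg C h"] \<eta>(1,2) ty D by simp
  then have "ShM C 1 \<delta> = Zro C (LE P k) (ShO C 1 (Trg C h))"
    using \<eta>(3) S by simp
  then have "\<delta> = Zro C (Src C \<delta>) (Trg C \<delta>)" by (rule shift_eq_zero)
  then show "g = h" using \<delta> ty sub_eq_zero[of g h] unfolding \<delta>_def by simp
qed

text \<open>The obstruction to extending \<open>aT P' k \<cdot> g[k]\<close> along
  \<open>aT P k\<close> is a morphism from weight \<open>\<ge> 0\<close> to \<open>Wle[1]\<close>.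
  The extension \<open>u k\<close> need not be unique, but the square with \<open>sT\<close> lives
  one shift lower, where a morphism is determined by its restriction to the shift of
  \<open>X\<close>. Independent choices of the \<open>u k\<close> are therefore automatically
  compatible.\<close>

lemma ex_tower_lift:
  assumes P: "weight_postnikov_tower C Wle Wge X P" and P': "weight_postnikov_tower C Wle Wge X' P'"
    and g: "g \<in> Mor C X X'"
  shows "\<exists>u m. tower_lift C P P' g u m"
proof -
  note S = tower_simps[OF P] and D = towerD[OF P] and S' = tower_simps[OF P'] and D' = towerD[OF P']
  have g: "Src C g = X" "Trg C g = X'" using g by (simp_all add: mem_Mor)
  have "\<exists>u. Src C u = LE P k \<and> Trg C u = LE P' k \<and> u \<cdot> aT P k = aT P' k \<cdot> ShM C k g" for k
  proof -
    let ?h = "aT P' k \<cdot> ShM C k g"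
    have "ShM C 1 ?h \<cdot> bT P (k + 1) = Zro C (GE P (k + 1)) (ShO C 1 (LE P' k))"
      using orth[of "ShM C 1 ?h \<cdot> bT P (k + 1)" "LE P' k"] S D S' D' g by (simp add: add.commute)
    then show ?thesis
      using weak_cokernel_left[OF D(5)[of k], of ?h] S S' g by (metis src_trg_comp src_trg_shift)
  qed
  then obtain u where u: "\<And>k. Src C (u k) = LE P k" "\<And>k. Trg C (u k) = LE P' k"
    "\<And>k. u k \<cdot> aT P k = aT P' k \<cdot> ShM C k g" by metis
  have us: "u (k - 1) \<cdot> sT P k = sT P' k \<cdot> ShM C (- 1) (u k)" for k
  proof (rule tower_mor_ext[OF P, of _ k])
    have "(u (k - 1) \<cdot> sT P k) \<cdot> ShM C (- 1) (aT P k) = aT P' (k - 1) \<cdot> ShM C (k - 1) g"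
      using D(8)[of k] u(3)[of "k - 1"] by (simp add: u S)
    also have "\<dots> = sT P' k \<cdot> ShM C (- 1) (aT P' k \<cdot> ShM C k g)"
      using comp_eq_left[OF D'(8)[of k], of "ShM C (k - 1) g"] by (simp add: S' g algebra_simps)
    also have "\<dots> = (sT P' k \<cdot> ShM C (- 1) (u k)) \<cdot> ShM C (- 1) (aT P k)"
      using arg_cong[OF u(3)[of k], of "ShM C (- 1)"] by (simp add: u(1,2) S S' g)
    finally show "(u (k - 1) \<cdot> sT P k) \<cdot> ShM C (- 1) (aT P k) =
      (sT P' k \<cdot> ShM C (- 1) (u k)) \<cdot> ShM C (- 1) (aT P k)" .
  qed (simp_all add: u S S' D')
  have "\<exists>m. Src C m = GR P k \<and> Trg C m = GR P' k \<and> m \<cdot> cT P k = cT P' k \<cdot> u (k - 1) \<and>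
    u k \<cdot> dT P k = dT P' k \<cdot> m" for k
  proof -
    \<comment> \<open>The first vertical map is \<open>u k [-1]\<close>, so its shift in the third
      square of TR3 is \<open>u k\<close> itself.\<close>
    have "\<exists>\<gamma> \<in> Mor C (Src C (dT P k)) (Src C (dT P' k)). \<gamma> \<cdot> cT P k = cT P' k \<cdot> u (k - 1) \<and>
      ShM C 1 (ShM C (- 1) (u k)) \<cdot> dT P k = dT P' k \<cdot> \<gamma>"
      by (rule TR3[OF D(6) D'(6)]) (simp_all add: mem_Mor u S S' us)
    then show ?thesis by (auto simp: mem_Mor S S')
  qed
  then obtain m where m: "\<And>k. Src C (m k) = GR P k" "\<And>k. Trg C (m k) = GR P' k"
    "\<And>k. m k \<cdot> cT P k = cT P' k \<cdot> u (k - 1)" "\<And>k. u k \<cdot> dT P k = dT P' k \<cdot> m k" by metis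
  show ?thesis
    by (rule exI[of _ u], rule exI[of _ m]) (simp add: tower_lift_def mem_Mor u us m)
qed

lemma tower_liftD:
  assumes "tower_lift C P P' g u m"
  shows "Src C (u k) = LE P k" "Trg C (u k) = LE P' k" "Src C (m k) = GR P k" "Trg C (m k) = GR P' k"
    "u k \<cdot> aT P k = aT P' k \<cdot> ShM C k g" "u (k - 1) \<cdot> sT P k = sT P' k \<cdot> ShM C (- 1) (u k)"
    "m k \<cdot> cT P k = cT P' k \<cdot> u (k - 1)" "u k \<cdot> dT P k = dT P' k \<cdot> m k"
  using assms unfolding tower_lift_def mem_Mor by blast+

text \<open>
  In each degree, two lifts of the same morphism differ by a null-homotopic term. The homotopies
  obtained in different degrees need not be compatible with each other, but the effect on the
  cohomology of the complex \<open>H(GR P k)\<close> only depends on one degree at a time.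
\<close>

lemma tower_lift_difference:
  assumes P: "weight_postnikov_tower C Wle Wge X P" and P': "weight_postnikov_tower C Wle Wge X' P'"
    and L: "tower_lift C P P' g u m" "tower_lift C P P' g u' m'"
  obtains \<theta> \<kappa> where "Src C \<theta> = GR P (k + 1)" "Trg C \<theta> = GR P' k" "Src C \<kappa> = GR P k" "Trg C \<kappa> = GR P' (k - 1)"
    "m k = Add C (m' k) (Add C (\<theta> \<cdot> weight_complex_diff C P k) (weight_complex_diff C P' (k - 1) \<cdot> \<kappa>))"
proof -
  note S = tower_simps[OF P] and D = towerD[OF P] and S' = tower_simps[OF P'] and D' = towerD[OF P']
  note L1 = tower_liftD[OF L(1)] and L2 = tower_liftD[OF L(2)]
  define \<delta> where "\<delta> = Add C (u k) (Neg C (u' k))"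
  define \<epsilon> where "\<epsilon> = Add C (m k) (Neg C (m' k))"
  have \<delta>: "Src C \<delta> = LE P k" "Trg C \<delta> = LE P' k" by (simp_all add: \<delta>_def L1 L2)
  have \<epsilon>: "Src C \<epsilon> = GR P k" "Trg C \<epsilon> = GR P' k" by (simp_all add: \<epsilon>_def L1 L2)
  have \<delta>a: "\<delta> \<cdot> aT P k = Zro C (ShO C k X) (LE P' k)"
  proof -
    have "Src C (aT P' k \<cdot> ShM C k g) = ShO C k X" "Trg C (aT P' k \<cdot> ShM C k g) = LE P' k"
      using L1(5)[of k] L1(1,2) S by (metis src_trg_comp)+
    then show ?thesis by (simp add: \<delta>_def L1(1,2,5) L2(1,2,5) S)
  qed
  have \<delta>d: "\<delta> \<cdot> dT P k = dT P' k \<cdot> \<epsilon>"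
    by (simp add: \<delta>_def \<epsilon>_def L1(1-4,8) L2(1-4,8) S S')
  \<comment> \<open>Three applications of a triangle: the difference kills \<open>X[k]\<close>, so
    it factors through \<open>GE P (k + 1)\<close>; by orthogonality the factor lifts along
    \<open>dT P' k\<close>; again by orthogonality this lift extends along
    \<open>yT P (k + 1)\<close> to \<open>GR P (k + 1)\<close>.\<close>
  obtain \<eta> where \<eta>: "Src C \<eta> = GE P (k + 1)" "Trg C \<eta> = LE P' k" "\<eta> \<cdot> fT P k = \<delta>"
    using weak_cokernel[OF D(5)[of k] _ \<delta>a] \<delta> S by metis
  have "Neg C (ShM C 1 (sT P' k)) \<cdot> \<eta> = Zro C (GE P (k + 1)) (ShO C 1 (LE P' (k - 1)))"
    using orth[of "Neg C (ShM C 1 (sT P' k)) \<cdot> \<eta>" "LE P' (k - 1)"] \<eta>(1,2) S' D D' by simp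
  then obtain \<theta>0 where \<theta>0: "Src C \<theta>0 = GE P (k + 1)" "Trg C \<theta>0 = GR P' k" "dT P' k \<cdot> \<theta>0 = \<eta>"
    using weak_kernel[OF dist_rotate[OF dist_rotate[OF D'(6)[of k]]], of \<eta>] \<eta>(1,2) S'
    by (metis (no_types) add.right_inverse shift_obj_0 shift_obj_plus src_trg_neg(1) src_trg_shift(1))
  have "\<theta>0 \<cdot> tT P (k + 1) = Zro C (ShO C (- 1) (GE P (k + 2))) (GR P' k)"
    using orth_shift[of "\<theta>0 \<cdot> tT P (k + 1)" "GE P (k + 2)"] \<theta>0(1,2) S D D' by (simp add: add.assoc)
  then obtain \<theta> where \<theta>: "Src C \<theta> = GR P (k + 1)" "Trg C \<theta> = GR P' k" "\<theta> \<cdot> yT P (k + 1) = \<theta>0"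
    using weak_cokernel[OF dist_rotate[OF D(7)[of "k + 1"]], of \<theta>0] \<theta>0(1,2) S
    by (metis)
  have y: "yT P (k + 1) \<cdot> (fT P k \<cdot> dT P k) = weight_complex_diff C P k"
    using D(10)[of "k + 1"] by (simp add: weight_complex_diff_def S)
  have wcd: "Src C (weight_complex_diff C P k) = GR P k" "Trg C (weight_complex_diff C P k) = GR P (k + 1)"
    by (simp_all add: weight_complex_diff_def S)
  \<comment> \<open>What is left after removing the first homotopy term is killed by
    \<open>dT P' k\<close>, so it comes through \<open>cT P' k\<close>. Orthogonality lifts the
    factor along \<open>dT P' (k - 1)\<close>, which completes the differential of the second
    term.\<close>
  define \<rho> where "\<rho> = Add C \<epsilon> (Neg C (\<theta> \<cdot> weight_complex_diff C P k))"
  have \<rho>: "Src C \<rho> = GR P k" "Trg C \<rho> = GR P' k" by (simp_all add: \<rho>_def \<epsilon> \<theta> wcd)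
  have "dT P' k \<cdot> (\<theta> \<cdot> weight_complex_diff C P k) = dT P' k \<cdot> (\<theta>0 \<cdot> (fT P k \<cdot> dT P k))"
    using comp_eq_left[OF \<theta>(3), of "fT P k \<cdot> dT P k"] \<theta>(1,2) S y by simp
  also have "\<dots> = \<delta> \<cdot> dT P k"
    using comp_eq_left[OF \<theta>0(3), of "fT P k \<cdot> dT P k"] comp_eq_left[OF \<eta>(3), of "dT P k"]
      \<theta>0(1,2) \<eta>(1,2) S S' by simp
  finally have dd: "dT P' k \<cdot> (\<theta> \<cdot> weight_complex_diff C P k) = dT P' k \<cdot> \<epsilon>" by (simp add: \<delta>d)
  have "dT P' k \<cdot> \<rho> = Zro C (GR P k) (LE P' k)"
    unfolding \<rho>_def using dd \<epsilon> \<theta>(1,2) wcd S' by simp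
  then obtain \<kappa>0 where \<kappa>0: "Src C \<kappa>0 = GR P k" "Trg C \<kappa>0 = LE P' (k - 1)" "cT P' k \<cdot> \<kappa>0 = \<rho>"
    using weak_kernel[OF dist_rotate[OF D'(6)[of k]], of \<rho>] \<rho> S' by metis
  have "Neg C (ShM C 1 (sT P' (k - 1))) \<cdot> \<kappa>0 = Zro C (GR P k) (ShO C 1 (LE P' (k - 2)))"
    using orth[of "Neg C (ShM C 1 (sT P' (k - 1))) \<cdot> \<kappa>0" "LE P' (k - 2)"] \<kappa>0(1,2) S' D D' by simp
  then obtain \<kappa> where \<kappa>: "Src C \<kappa> = GR P k" "Trg C \<kappa> = GR P' (k - 1)" "dT P' (k - 1) \<cdot> \<kappa> = \<kappa>0"
    using weak_kernel[OF dist_rotate[OF dist_rotate[OF D'(6)[of "k - 1"]]], of \<kappa>0] \<kappa>0(1,2) S'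
    by (metis (no_types) add.right_inverse shift_obj_0 shift_obj_plus src_trg_neg(1) src_trg_shift(1))
  have \<rho>': "\<rho> = weight_complex_diff C P' (k - 1) \<cdot> \<kappa>"
    using \<kappa> \<kappa>0(3) S' by (simp add: weight_complex_diff_def)
  have "m k = Add C (m' k) \<epsilon>"
    unfolding \<epsilon>_def by (rule add_sub[symmetric]) (simp_all add: L1 L2)
  moreover have "\<epsilon> = Add C (\<theta> \<cdot> weight_complex_diff C P k) \<rho>"
    unfolding \<rho>_def by (rule add_sub[symmetric]) (simp_all add: \<epsilon> \<theta> wcd)
  ultimately show thesis using that \<theta>(1,2) \<kappa>(1,2) \<rho>' by metis
qed

lemma tower_lift_id:
  assumes P: "weight_postnikov_tower C Wle Wge X P"
  shows "tower_lift C P P (Idm C X) (\<lambda>k. Idm C (LE P k)) (\<lambda>k. Idm C (GR P k))"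
  by (simp add: tower_lift_def mem_Mor tower_simps[OF P])

lemma tower_lift_comp:
  assumes P: "weight_postnikov_tower C Wle Wge X P" "weight_postnikov_tower C Wle Wge X' P'"
      "weight_postnikov_tower C Wle Wge X'' P''"
    and g: "g \<in> Mor C X X'" and h: "h \<in> Mor C X' X''"
    and L: "tower_lift C P P' g u m" "tower_lift C P' P'' h u' m'"
  shows "tower_lift C P P'' (h \<cdot> g) (\<lambda>k. u' k \<cdot> u k) (\<lambda>k. m' k \<cdot> m k)"
proof -
  note S = tower_simps[OF P(1)] tower_simps[OF P(2)] tower_simps[OF P(3)]
  note L1 = tower_liftD[OF L(1)] and L2 = tower_liftD[OF L(2)]
  have gh: "Src C g = X" "Trg C g = X'" "Src C h = X'" "Trg C h = X''"
    using g h by (simp_all add: mem_Mor)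
  show ?thesis
    unfolding tower_lift_def
  proof (intro allI conjI)
    fix k
    show "(u' k \<cdot> u k) \<cdot> aT P k = aT P'' k \<cdot> ShM C k (h \<cdot> g)"
      using comp_eq_left[OF L2(5)[of k], of "ShM C k g"] by (simp add: L1 L2(1,2) S gh)
    show "(u' (k - 1) \<cdot> u (k - 1)) \<cdot> sT P k = sT P'' k \<cdot> ShM C (- 1) (u' k \<cdot> u k)"
      using comp_eq_left[OF L2(6)[of k], of "ShM C (- 1) (u k)"] by (simp add: L1 L2(1,2) S)
    show "(m' k \<cdot> m k) \<cdot> cT P k = cT P'' k \<cdot> (u' (k - 1) \<cdot> u (k - 1))"
      using comp_eq_left[OF L2(7)[of k], of "u (k - 1)"] by (simp add: L1 L2(1-4) S)
    show "(u' k \<cdot> u k) \<cdot> dT P k = dT P'' k \<cdot> (m' k \<cdot> m k)"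
      using comp_eq_left[OF L2(8)[of k], of "m k"] by (simp add: L1 L2(1-4) S)
  qed (simp_all add: mem_Mor L1 L2)
qed

end

section \<open>The weight spectral sequence\<close>

lemma minus_one_diff: "- 1 - p = - p - (1::int)"
  by simp

text \<open>One functor \<open>H\<close> is fixed here; statements comparing several functors are
  made outside and interpret the locale once for each.\<close>

locale weight_cohomology = weight_structure C Wle Wge + A: abelian_category A
  for C :: "('o, 'm) tri_struct" (structure) and Wle Wge :: "'o set"
    and A :: "('a, 'b) preadd_struct" +
  fixes H :: "('o, 'm, 'a, 'b) functor_data"
  assumes cohomological: "cohomological_functor C A H"
begin

lemma FM_src_trg [simp]: "Src A (FM H f) = FO H (Trg C f)" "Trg A (FM H f) = FO H (Src C f)"
  using cohomological unfolding cohomological_functor_def contravariant_additive_functor_def mem_Mor Ball_def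
  by simp_all

lemma FM_id [simp]: "FM H (Idm C X) = Idm A (FO H X)"
  using cohomological unfolding cohomological_functor_def contravariant_additive_functor_def by simp

lemma FM_comp [simp]: "Trg C f = Src C g \<Longrightarrow> FM H (g \<cdot> f) = FM H f \<cdot>\<^bsub>A\<^esub> FM H g"
  using cohomological unfolding cohomological_functor_def contravariant_additive_functor_def mem_Mor Ball_def
  by simp

lemma FM_add [simp]:
  "\<lbrakk>Src C f = Src C g; Trg C f = Trg C g\<rbrakk> \<Longrightarrow> FM H (Add C f g) = Add A (FM H f) (FM H g)"
  using cohomological unfolding cohomological_functor_def contravariant_additive_functor_def mem_Mor Ball_def
  by simp

lemma FM_zero [simp]: "FM H (Zro C X Y) = Zro A (FO H Y) (FO H X)"
proof -
  have "Add A (FM H (Zro C X Y)) (FM H (Zro C X Y)) = FM H (Zro C X Y)"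
    by (simp flip: FM_add)
  then show ?thesis using A.zero_if_double[of "FM H (Zro C X Y)"] by simp
qed

lemma FM_neg [simp]: "FM H (Neg C f) = Neg A (FM H f)"
  by (rule A.neg_unique) (simp_all flip: FM_add)

lemma FM_exact:
  assumes "(u, v, w) \<in> Dist C"
  shows "exact_at A (FM H (ShM C n v)) (FM H (ShM C n u))"
    "exact_at A (FM H (ShM C n w)) (FM H (ShM C n v))"
    "exact_at A (FM H (ShM C (n + 1) u)) (FM H (ShM C n w))"
  using cohomological assms unfolding cohomological_functor_def by blast+

section \<open>The exact couple of a tower and its convergence\<close>

lemma weight_couple_simps:
  "Dc (weight_couple C H P) p q = FO H (ShO C (- q) (LE P (- p)))"
  "Ec (weight_couple C H P) p q = FO H (ShO C (- q) (GR P (- p)))"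
  "ic (weight_couple C H P) p q = FM H (ShM C (- q) (sT P (1 - p)))"
  "jc (weight_couple C H P) p q = FM H (ShM C (- q) (dT P (- p)))"
  "kc (weight_couple C H P) p q = FM H (ShM C (- q) (cT P (- p)))"
  by (simp_all add: weight_couple_def coh_shift_def)

text \<open>\<open>H\<close> reverses the triangle: \<open>sT\<close>, \<open>dT\<close> and
  \<open>cT\<close> become \<open>i\<close>, \<open>j\<close> and \<open>k\<close>. The three
  exactness conditions are the three positions in its long exact sequence.\<close>

lemma exact_weight_couple:
  assumes P: "weight_postnikov_tower C Wle Wge X P"
  shows "exact_couple A 1 (weight_couple C H P)"
  unfolding exact_couple_def mem_Mor
proof (intro allI conjI)
  note S = tower_simps[OF P] and D = towerD[OF P]
  fix p q
  show "exact_at A (ic (weight_couple C H P) (p + 1) (q - 1)) (jc (weight_couple C H P) p q)"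
    using FM_exact(3)[OF D(6)[of "- p"], of "- q"] by (simp add: weight_couple_simps)
  show "exact_at A (jc (weight_couple C H P) (p - 1 + 1) (q + 1 - 1)) (kc (weight_couple C H P) p q)"
    using FM_exact(2)[OF D(6)[of "- p"], of "- q"] by (simp add: weight_couple_simps)
  show "exact_at A (kc (weight_couple C H P) (p - 1) q) (ic (weight_couple C H P) p q)"
    using FM_exact(1)[OF D(6)[of "1 - p"], of "- q"] by (simp add: weight_couple_simps)
qed (simp_all add: weight_couple_simps tower_simps[OF P] algebra_simps)

text \<open>The differential is \<open>j\<close> at \<open>(p + 1, q)\<close> after \<open>k\<close>
  at \<open>(p, q)\<close>, which is \<open>H\<close> applied to \<open>dT P (-p - 1)\<close>
  followed by \<open>cT P (-p)\<close>.\<close>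

lemma weight_spec_seq_E1:
  assumes P: "weight_postnikov_tower C Wle Wge X P" and T: "weight_spec_seq C A H P T"
  shows "Eo T 1 p q = FO H (ShO C (- q) (GR P (- p)))"
    "dm T 1 p q = FM H (ShM C (- q) (weight_complex_diff C P (- 1 - p)))"
proof -
  note S = tower_simps[OF P]
  have "Eo T 1 = Ec (weight_couple C H P) \<and> (\<forall>p q. dm T 1 p q =
      jc (weight_couple C H P) (p + 1) q \<cdot>\<^bsub>A\<^esub> kc (weight_couple C H P) p q)"
    using T unfolding weight_spec_seq_def spec_seq_of_couple_def by (metis order_refl)
  then show "Eo T 1 p q = FO H (ShO C (- q) (GR P (- p)))"
    "dm T 1 p q = FM H (ShM C (- q) (weight_complex_diff C P (- 1 - p)))"
    by (simp_all add: weight_couple_simps weight_complex_diff_def S minus_one_diff)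
qed

lemma vanishes_FO: "vanishes_on A H (weight_class C W q) \<Longrightarrow> Y \<in> W \<Longrightarrow> is_zero_object A (FO H (ShO C (- q) Y))"
  by (simp add: vanishes_on_def weight_class_def)

text \<open>\<open>below\<close> controls large \<open>p\<close>, hence small weights, and
  \<open>above\<close> controls small \<open>p\<close>, hence large weights;
  \<open>couple_converges\<close> uses them separately.\<close>

lemma weight_spec_seq_converges:
  assumes P: "weight_postnikov_tower C Wle Wge X P" and T: "weight_spec_seq C A H P T"
    and below: "X \<in> weight_bounded C Wge \<or> (\<exists>q1. \<forall>q \<le> q1. vanishes_on A H (weight_class C Wle q))"
    and above: "X \<in> weight_bounded C Wle \<or> (\<exists>q0. \<forall>q \<ge> q0. vanishes_on A H (weight_class C Wge q))"
  shows "\<exists>F. converges_to A T (\<lambda>n. FO (coh_shift C H n) X) F \<and>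
    (\<forall>n p. is_weight_filtration C A (coh_shift C H n) P (- p) (F n p))"
proof -
  note S = tower_simps[OF P] and D = towerD[OF P]
  let ?K = "weight_couple C H P"
  \<comment> \<open>\<open>aT P (- p)\<close> starts at \<open>X[-p]\<close>, so after the shift by
    \<open>-q\<close> the map \<alpha> ends in degree \<open>p + q\<close>. Its image is by
    definition the weight filtration at \<open>-p\<close>.\<close>
  define \<alpha> where "\<alpha> p q = FM H (ShM C (- q) (aT P (- p)))" for p q
  define L where "L n = FO H (ShO C (- n) X)" for n
  have \<alpha>_ty: "Src A (\<alpha> p q) = Dc ?K p q" "Trg A (\<alpha> p q) = L (p + q)" for p q
    by (simp_all add: \<alpha>_def L_def weight_couple_simps S algebra_simps)
  have \<alpha>_ic: "\<alpha> (p - 1) (q + 1) \<cdot>\<^bsub>A\<^esub> ic ?K p q = \<alpha> p q" for p q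
  proof -
    have "\<alpha> (p - 1) (q + 1) \<cdot>\<^bsub>A\<^esub> ic ?K p q =
      FM H (ShM C (- q) (sT P (1 - p) \<cdot> ShM C (- 1) (aT P (1 - p))))"
      by (simp add: \<alpha>_def weight_couple_simps S algebra_simps)
    then show ?thesis unfolding D(8) by (simp add: \<alpha>_def)
  qed
  have "\<exists>m. is_image A m (\<alpha> p (n - p))" for n p
  proof -
    obtain m e where "is_mono A m" "is_epi A e" "m \<cdot>\<^bsub>A\<^esub> e = \<alpha> p (n - p)"
      "Src A e = Src A (\<alpha> p (n - p))" "Trg A e = Src A m" "Trg A m = Trg A (\<alpha> p (n - p))"
      by (rule A.ex_image)
    then show ?thesis unfolding is_image_def by (metis mem_Mor)
  qed
  then have "\<forall>n p. \<exists>m. is_image A m (\<alpha> p (n - p))" by blast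
  then obtain F where F: "\<And>n p. is_image A (F n p) (\<alpha> p (n - p))" unfolding choice_iff by blast
  have "converges_to A T L F"
  proof (rule A.couple_converges[where \<alpha> = \<alpha>, OF T[unfolded weight_spec_seq_def] \<alpha>_ty \<alpha>_ic])
    fix p q show "is_image A (F (p + q) p) (\<alpha> p q)" using F[of "p + q" p] by simp
  next
    fix n
    show "\<exists>p1. \<forall>p \<ge> p1. \<forall>q. p + q = n \<longrightarrow>
      ic ?K p q = Zro A (Dc ?K p q) (Dc ?K (p - 1) (q + 1)) \<and> \<alpha> p q = Zro A (Dc ?K p q) (L n)"
      using below
    proof
      assume "X \<in> weight_bounded C Wge"
      then obtain m where X: "X \<in> weight_class C Wge m" by (auto simp: weight_bounded_def)
      \<comment> \<open>\<open>sT P (1 - p)\<close> vanishes for \<open>1 - p < m\<close>, that is,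
        \<open>p \<ge> 2 - m\<close>; for \<open>aT P (- p)\<close> already
        \<open>p \<ge> 1 - m\<close> suffices.\<close>
      show ?thesis
      proof (intro exI[of _ "2 - m"] allI impI conjI)
        fix p q assume *: "2 - m \<le> p" "p + q = n"
        then have "sT P (1 - p) = Zro C (ShO C (- 1) (LE P (1 - p))) (LE P (- p))"
          using tower_bounded_below(2)[OF P X, of "1 - p"] by simp
        then show "ic ?K p q = Zro A (Dc ?K p q) (Dc ?K (p - 1) (q + 1))"
          by (simp add: weight_couple_simps algebra_simps)
        have "aT P (- p) = Zro C (ShO C (- p) X) (LE P (- p))"
          using tower_bounded_below(1)[OF P X, of "- p"] * by simp
        then show "\<alpha> p q = Zro A (Dc ?K p q) (L n)"
          using * by (auto simp: weight_couple_simps \<alpha>_def L_def algebra_simps)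
      qed
    next
      assume "\<exists>q1. \<forall>q \<le> q1. vanishes_on A H (weight_class C Wle q)"
      then obtain q1 where q1: "\<And>q. q \<le> q1 \<Longrightarrow> vanishes_on A H (weight_class C Wle q)" by blast
      \<comment> \<open>On the diagonal \<open>p + q = n\<close> the bound says
        \<open>q \<le> q1\<close>, so the whole \<open>D\<close>-term is zero.\<close>
      show ?thesis
      proof (intro exI[of _ "n - q1"] allI impI conjI)
        fix p q assume *: "n - q1 \<le> p" "p + q = n"
        then have Z: "is_zero_object A (Dc ?K p q)"
          using vanishes_FO[OF q1, of q "LE P (- p)"] D(1) by (simp add: weight_couple_simps)
        show "ic ?K p q = Zro A (Dc ?K p q) (Dc ?K (p - 1) (q + 1))"
          using A.zero_object_mor(1)[OF Z, of "ic ?K p q"] exact_coupleD(1,2)[OF exact_weight_couple[OF P]]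
          by simp
        show "\<alpha> p q = Zro A (Dc ?K p q) (L n)"
          using A.zero_object_mor(1)[OF Z, of "\<alpha> p q"] \<alpha>_ty * by simp
      qed
    qed
    show "\<exists>p0. \<forall>p \<le> p0. \<forall>q. p + q = n \<longrightarrow> is_epi A (\<alpha> p q) \<and>
      (\<forall>x. Trg A x = Dc ?K p q \<longrightarrow> \<alpha> p q \<cdot>\<^bsub>A\<^esub> x = Zro A (Src A x) (L n) \<longrightarrow>
        ic ?K p q \<cdot>\<^bsub>A\<^esub> x = Zro A (Src A x) (Dc ?K (p - 1) (q + 1)))"
    proof -
      \<comment> \<open>In the long exact sequence of the decomposition of \<open>X[-p]\<close>,
        \<alpha> is followed by \<open>H\<close> of \<open>bT P (1 - p)\<close>; it is epi as soon
        as the latter vanishes.\<close>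
      have epi: "is_epi A (\<alpha> p q)"
        if "FM H (ShM C (- q - 1) (bT P (1 - p))) =
          Zro A (FO H (ShO C (- p - q) X)) (FO H (ShO C (- q - 1) (GE P (1 - p))))" for p q
      proof -
        have "exact_at A (\<alpha> p q) (FM H (ShM C (- q - 1) (bT P (1 - p))))"
          using FM_exact(3)[OF D(5)[of "- p"], of "- q - 1"] by (simp add: \<alpha>_def)
        moreover have "FM H (ShM C (- q - 1) (bT P (1 - p))) \<cdot>\<^bsub>A\<^esub> Idm A (L (p + q)) =
          Zro A (L (p + q)) (FO H (ShO C (- q - 1) (GE P (1 - p))))"
          by (simp add: that L_def)
        ultimately obtain e x where "is_epi A e" "Trg A e = L (p + q)" "Src A x = Src A e"
          "Trg A x = Src A (\<alpha> p q)" "\<alpha> p q \<cdot>\<^bsub>A\<^esub> x = Idm A (L (p + q)) \<cdot>\<^bsub>A\<^esub> e"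
          by (rule A.exact_local_lift) (auto simp: L_def S algebra_simps)
        then show ?thesis using A.epi_cancel[of "\<alpha> p q" x] by simp
      qed
      \<comment> \<open>The kernel of \<alpha> is the image of \<open>H\<close> applied to
        \<open>fT P (- p)\<close>. Composing with \<open>i\<close> gives \<open>H\<close> of
        \<open>fT P (- p) \<cdot> sT P (1 - p)\<close>, so the vanishing of this one map is
        enough.\<close>
      have ker: "ic ?K p q \<cdot>\<^bsub>A\<^esub> x = Zro A (Src A x) (Dc ?K (p - 1) (q + 1))"
        if fs: "FM H (ShM C (- q) (fT P (- p) \<cdot> sT P (1 - p))) =
          Zro A (FO H (ShO C (- q) (GE P (1 - p)))) (Dc ?K (p - 1) (q + 1))"
          and x: "Trg A x = Dc ?K p q" "\<alpha> p q \<cdot>\<^bsub>A\<^esub> x = Zro A (Src A x) Z" for p q x Z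
      proof -
        have "exact_at A (FM H (ShM C (- q) (fT P (- p)))) (\<alpha> p q)"
          using FM_exact(1)[OF D(5)[of "- p"], of "- q"] by (simp add: \<alpha>_def)
        then obtain e z where z: "is_epi A e" "Trg A e = Src A x" "Src A z = Src A e"
          "Trg A z = FO H (ShO C (- q) (GE P (1 - p)))"
          "FM H (ShM C (- q) (fT P (- p))) \<cdot>\<^bsub>A\<^esub> z = x \<cdot>\<^bsub>A\<^esub> e"
          using x(2) by (rule A.exact_local_lift) (use x(1) \<alpha>_ty in \<open>simp_all add: S\<close>)
        have "(ic ?K p q \<cdot>\<^bsub>A\<^esub> x) \<cdot>\<^bsub>A\<^esub> e = ic ?K p q \<cdot>\<^bsub>A\<^esub> (FM H (ShM C (- q) (fT P (- p))) \<cdot>\<^bsub>A\<^esub> z)"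
          using z(2,5) x(1) by (simp add: weight_couple_simps S)
        also have "\<dots> = FM H (ShM C (- q) (fT P (- p) \<cdot> sT P (1 - p))) \<cdot>\<^bsub>A\<^esub> z"
          using z(3,4) by (simp add: weight_couple_simps S)
        also have "\<dots> = Zro A (Src A e) (Dc ?K (p - 1) (q + 1))"
          unfolding fs using z(3,4) by simp
        finally show ?thesis
          using A.epi_zero[OF z(1), of "ic ?K p q \<cdot>\<^bsub>A\<^esub> x"] z(2) x(1)
            exact_coupleD(1,2)[OF exact_weight_couple[OF P]] by simp
      qed
      show ?thesis
        using above
      proof
        assume "X \<in> weight_bounded C Wle"
        then obtain m where X: "X \<in> weight_class C Wle m" by (auto simp: weight_bounded_def)
        show ?thesis
        proof (intro exI[of _ "- m"] allI impI conjI)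
          fix p q assume *: "p \<le> - m" "p + q = n"
          have m: "m \<le> - p" using * by simp
          note B = tower_bounded_above[OF P X m]
          show "is_epi A (\<alpha> p q)"
            using B(1) by (intro epi) (simp add: algebra_simps)
          have "tT P (1 - p) = Zro C (ShO C (- 1) (GE P (2 - p))) (GE P (1 - p))"
            using B(3) by (simp add: algebra_simps)
          \<comment> \<open>The square of connecting morphisms rewrites the composite as
            \<open>tT P (1 - p)\<close> after the negative of a shift of
            \<open>fT P (1 - p)\<close>, and that \<open>tT\<close> is zero.\<close>
          then have "fT P (- p) \<cdot> sT P (1 - p) = Zro C (ShO C (- 1) (LE P (1 - p))) (GE P (1 - p))"
            using D(9)[of "1 - p"] by (simp add: S algebra_simps)
          then have fs: "FM H (ShM C (- q) (fT P (- p) \<cdot> sT P (1 - p))) =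
            Zro A (FO H (ShO C (- q) (GE P (1 - p)))) (Dc ?K (p - 1) (q + 1))"
            by (simp add: weight_couple_simps algebra_simps)
          fix x assume "Trg A x = Dc ?K p q" "\<alpha> p q \<cdot>\<^bsub>A\<^esub> x = Zro A (Src A x) (L n)"
          then show "ic ?K p q \<cdot>\<^bsub>A\<^esub> x = Zro A (Src A x) (Dc ?K (p - 1) (q + 1))"
            by (rule ker[OF fs])
        qed
      next
        assume "\<exists>q0. \<forall>q \<ge> q0. vanishes_on A H (weight_class C Wge q)"
        then obtain q0 where q0: "\<And>q. q \<ge> q0 \<Longrightarrow> vanishes_on A H (weight_class C Wge q)" by blast
        show ?thesis
        proof (intro exI[of _ "n - q0"] allI impI conjI)
          fix p q assume *: "p \<le> n - q0" "p + q = n"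
          have Z: "is_zero_object A (FO H (ShO C (- q) (GE P (1 - p))))"
            using vanishes_FO[OF q0, of q "GE P (1 - p)"] D(2) * by simp
          \<comment> \<open>The connecting map \<open>bT\<close> enters one degree higher than
            \<open>fT\<close>, so vanishing is used for \<open>q\<close> and for
            \<open>q + 1\<close>.\<close>
          have Z': "is_zero_object A (FO H (ShO C (- q - 1) (GE P (1 - p))))"
            using vanishes_FO[OF q0, of "q + 1" "GE P (1 - p)"] D(2) * by simp
          show "is_epi A (\<alpha> p q)"
            using A.zero_object_mor(2)[OF Z', of "FM H (ShM C (- q - 1) (bT P (1 - p)))"]
            by (intro epi) (simp add: S algebra_simps)
          have fs: "FM H (ShM C (- q) (fT P (- p) \<cdot> sT P (1 - p))) =
            Zro A (FO H (ShO C (- q) (GE P (1 - p)))) (Dc ?K (p - 1) (q + 1))"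
            using A.zero_object_mor(1)[OF Z, of "FM H (ShM C (- q) (fT P (- p) \<cdot> sT P (1 - p)))"]
            by (simp add: S weight_couple_simps algebra_simps)
          fix x assume "Trg A x = Dc ?K p q" "\<alpha> p q \<cdot>\<^bsub>A\<^esub> x = Zro A (Src A x) (L n)"
          then show "ic ?K p q \<cdot>\<^bsub>A\<^esub> x = Zro A (Src A x) (Dc ?K (p - 1) (q + 1))"
            by (rule ker[OF fs])
        qed
      qed
    qed
  qed
  moreover have "is_weight_filtration C A (coh_shift C H n) P (- p) (F n p)" for n p
    using F[of n p] by (simp add: is_weight_filtration_def coh_shift_def \<alpha>_def algebra_simps)
  moreover have "(\<lambda>n. FO (coh_shift C H n) X) = L" by (simp add: L_def coh_shift_def fun_eq_iff)
  ultimately show ?thesis by auto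
qed

section \<open>Maps induced by lifts and by transformations\<close>

lemma tower_lift_couple_morphism:
  assumes P1: "weight_postnikov_tower C Wle Wge X1 P1" and P2: "weight_postnikov_tower C Wle Wge X2 P2"
    and L: "tower_lift C P1 P2 g u m"
  shows "couple_morphism A 1 (weight_couple C H P2) (weight_couple C H P1)
    (\<lambda>p q. FM H (ShM C (- q) (u (- p)))) (\<lambda>p q. FM H (ShM C (- q) (m (- p))))"
  unfolding couple_morphism_def
proof (intro allI conjI)
  note S = tower_simps[OF P1] tower_simps[OF P2] and L1 = tower_liftD[OF L]
  let ?K1 = "weight_couple C H P1" and ?K2 = "weight_couple C H P2"
  fix p q
  have "FM H (ShM C (- q) (sT P2 (1 - p) \<cdot> ShM C (- 1) (u (1 - p)))) =
    FM H (ShM C (- q) (u (- p) \<cdot> sT P1 (1 - p)))"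
    using L1(6)[of "1 - p"] by simp
  then show "FM H (ShM C (- (q + 1)) (u (- (p - 1)))) \<cdot>\<^bsub>A\<^esub> ic ?K2 p q =
    ic ?K1 p q \<cdot>\<^bsub>A\<^esub> FM H (ShM C (- q) (u (- p)))"
    by (simp add: weight_couple_simps S L1(1,2) algebra_simps)
  have "FM H (ShM C (- q) (dT P2 (- p) \<cdot> m (- p))) = FM H (ShM C (- q) (u (- p) \<cdot> dT P1 (- p)))"
    using L1(8)[of "- p"] by simp
  then show "FM H (ShM C (- (q - 1 + 1)) (m (- (p + 1 - 1)))) \<cdot>\<^bsub>A\<^esub> jc ?K2 p q =
    jc ?K1 p q \<cdot>\<^bsub>A\<^esub> FM H (ShM C (- q) (u (- p)))"
    by (simp add: weight_couple_simps S L1(1-4))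
  have "FM H (ShM C (- q) (cT P2 (- p) \<cdot> u (- p - 1))) = FM H (ShM C (- q) (m (- p) \<cdot> cT P1 (- p)))"
    using L1(7)[of "- p"] by simp
  then show "FM H (ShM C (- q) (u (- (p + 1)))) \<cdot>\<^bsub>A\<^esub> kc ?K2 p q =
    kc ?K1 p q \<cdot>\<^bsub>A\<^esub> FM H (ShM C (- q) (m (- p)))"
    by (simp add: weight_couple_simps S L1(1-4) minus_one_diff)
qed (simp_all add: weight_couple_simps mem_Mor tower_liftD[OF L])

text \<open>Of the two homotopy terms, one begins with the differential of the source complex after
  applying \<open>H\<close> and so vanishes on cycles; the other ends with the differential of the
  target complex and is a boundary. Neither changes the class.\<close>

lemma tower_lift_induces:
  assumes P1: "weight_postnikov_tower C Wle Wge X1 P1" and P2: "weight_postnikov_tower C Wle Wge X2 P2"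
    and T1: "weight_spec_seq C A H P1 T1" and T2: "weight_spec_seq C A H P2 T2"
    and L: "tower_lift C P1 P2 g u m" and L': "tower_lift C P1 P2 g u' m'"
    and ind: "induces_on_next_page A T2 T1 1 p q (FM H (ShM C (- q) (m (- p)))) f"
  shows "induces_on_next_page A T2 T1 1 p q (FM H (ShM C (- q) (m' (- p)))) f"
proof -
  note L1 = tower_liftD[OF L] and L2 = tower_liftD[OF L']
  note E1 = weight_spec_seq_E1[OF P1 T1] and E2 = weight_spec_seq_E1[OF P2 T2]
  let ?w1 = "weight_complex_diff C P1 (- p)" and ?w2 = "weight_complex_diff C P2 (- p - 1)"
  have w: "Src C ?w1 = GR P1 (- p)" "Trg C ?w1 = GR P1 (1 - p)"
    "Src C ?w2 = GR P2 (- p - 1)" "Trg C ?w2 = GR P2 (- p)"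
    by (simp_all add: weight_complex_diff_def tower_simps[OF P1] tower_simps[OF P2])
  have S: "spectral_sequence A T1" "spectral_sequence A T2"
    using T1 T2 unfolding weight_spec_seq_def spec_seq_of_couple_def by blast+
  have z1: "is_kernel A (zm T1 1 p q) (dm T1 1 p q)" and z2: "is_kernel A (zm T2 1 p q) (dm T2 1 p q)"
    using S unfolding spectral_sequence_def by blast+
  have d1: "dm T1 1 (p - 1) q = FM H (ShM C (- q) ?w1)" "dm T2 1 p q = FM H (ShM C (- q) ?w2)"
    by (simp_all add: E1[unfolded One_nat_def] E2[unfolded One_nat_def] minus_one_diff)
  have d1': "dm T1 1 p q = FM H (ShM C (- q) (weight_complex_diff C P1 (- p - 1)))"
    by (simp add: E1[unfolded One_nat_def] minus_one_diff)
  obtain b where b: "Src A b = Eo T1 1 (p - 1) q" "Trg A b = Src A (zm T1 1 p q)"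
    "zm T1 1 p q \<cdot>\<^bsub>A\<^esub> b = FM H (ShM C (- q) ?w1)" "is_cokernel A (em T1 1 p q) b"
  proof -
    have "\<exists>l\<in>Mor A (Eo T1 1 (p - int 1) (q + int 1 - 1)) (Src A (zm T1 1 p q)).
      zm T1 1 p q \<cdot>\<^bsub>A\<^esub> l = dm T1 1 (p - int 1) (q + int 1 - 1) \<and> is_cokernel A (em T1 1 p q) l"
      using S(1) unfolding spectral_sequence_def by blast
    then show thesis using that d1(1) by (auto simp: mem_Mor)
  qed
  obtain l where l: "Src A l = Src A (zm T2 1 p q)" "Trg A l = Src A (zm T1 1 p q)"
    "zm T1 1 p q \<cdot>\<^bsub>A\<^esub> l = FM H (ShM C (- q) (m (- p))) \<cdot>\<^bsub>A\<^esub> zm T2 1 p q"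
    "f \<cdot>\<^bsub>A\<^esub> em T2 1 p q = em T1 1 p q \<cdot>\<^bsub>A\<^esub> l"
    using ind unfolding induces_on_next_page_def mem_Mor Bex_def by blast
  obtain \<theta> \<kappa> where \<theta>: "Src C \<theta> = GR P1 (- p + 1)" "Trg C \<theta> = GR P2 (- p)"
    "Src C \<kappa> = GR P1 (- p)" "Trg C \<kappa> = GR P2 (- p - 1)"
    "m' (- p) = Add C (m (- p)) (Add C (\<theta> \<cdot> ?w1) (?w2 \<cdot> \<kappa>))"
    by (rule tower_lift_difference[OF P1 P2 L' L])
  have tz: "Trg A (zm T2 1 p q) = FO H (ShO C (- q) (GR P2 (- p)))"
      "Trg A (zm T1 1 p q) = FO H (ShO C (- q) (GR P1 (- p)))"
    using A.kernelD(1)[OF z2] A.kernelD(1)[OF z1]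
    by (simp_all del: One_nat_def add: d1 d1' w weight_complex_diff_def tower_simps[OF P1] tower_simps[OF P2])
  have w2z: "FM H (ShM C (- q) ?w2) \<cdot>\<^bsub>A\<^esub> zm T2 1 p q =
      Zro A (Src A (zm T2 1 p q)) (FO H (ShO C (- q) (GR P2 (- p - 1))))"
    using A.kernelD(2)[OF z2] by (simp del: One_nat_def add: d1 w)
  \<comment> \<open>The restriction to cycles for \<open>m'\<close> is that for \<open>m\<close>
    plus the boundary part of the homotopy, written through \<open>b\<close> because
    \<open>zm T1 1 p q \<cdot> b\<close> is the incoming differential.\<close>
  let ?l = "Add A l (b \<cdot>\<^bsub>A\<^esub> (FM H (ShM C (- q) \<theta>) \<cdot>\<^bsub>A\<^esub> zm T2 1 p q))"
  have bs: "Src A b = FO H (ShO C (- q) (GR P1 (1 - p)))"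
    using b(1) by (simp del: One_nat_def add: E1(1))
  have \<theta>s: "Src C \<theta> = GR P1 (1 - p)" using \<theta>(1) by (simp del: One_nat_def add: algebra_simps)
  have "zm T1 1 p q \<cdot>\<^bsub>A\<^esub> ?l = FM H (ShM C (- q) (m' (- p))) \<cdot>\<^bsub>A\<^esub> zm T2 1 p q"
    using A.comp_eq_left[OF b(3), of "FM H (ShM C (- q) \<theta>) \<cdot>\<^bsub>A\<^esub> zm T2 1 p q"]
    by (simp del: One_nat_def add: \<theta>(2-5) \<theta>s L1(1-4) L2(1-4) w w2z l(1-3) b(2) bs tz)
  moreover have "f \<cdot>\<^bsub>A\<^esub> em T2 1 p q = em T1 1 p q \<cdot>\<^bsub>A\<^esub> ?l"
    using A.comp_eq_left[OF A.cokernelD(2)[OF b(4)], of "FM H (ShM C (- q) \<theta>) \<cdot>\<^bsub>A\<^esub> zm T2 1 p q"]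
      A.cokernelD(1)[OF b(4)]
    by (simp del: One_nat_def add: \<theta>(2) \<theta>s l(1,2,4) b(2) bs tz)
  moreover have "Src A ?l = Src A (zm T2 1 p q)" "Trg A ?l = Src A (zm T1 1 p q)"
    by (simp_all del: One_nat_def add: \<theta>(2) \<theta>s l(1,2) b(2) bs tz)
  ultimately show ?thesis
    using ind unfolding induces_on_next_page_def mem_Mor Bex_def
    by (auto simp del: One_nat_def simp: L1 L2)
qed

end

lemma natural_transformation_couple_morphism:
  assumes "weight_cohomology C Wle Wge A H1" "weight_cohomology C Wle Wge A H2"
    and \<tau>: "natural_transformation C A H1 H2 \<tau>" and P: "weight_postnikov_tower C Wle Wge X P"
  shows "couple_morphism A 1 (weight_couple C H1 P) (weight_couple C H2 P)
    (\<lambda>p q. \<tau> (ShO C (- q) (LE P (- p)))) (\<lambda>p q. \<tau> (ShO C (- q) (GR P (- p))))"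
proof -
  interpret H1: weight_cohomology C Wle Wge A H1 by fact
  interpret H2: weight_cohomology C Wle Wge A H2 by fact
  note S = tower_simps[OF P]
  have ty: "Src A (\<tau> Y) = FO H1 Y" "Trg A (\<tau> Y) = FO H2 Y" for Y
    using \<tau> unfolding natural_transformation_def mem_Mor by blast+
  have nat: "\<tau> (Src C f) \<cdot>\<^bsub>A\<^esub> FM H1 f = FM H2 f \<cdot>\<^bsub>A\<^esub> \<tau> (Trg C f)" for f
    using \<tau> unfolding natural_transformation_def by (metis mem_Mor)
  show ?thesis
    unfolding couple_morphism_def
  proof (intro allI conjI)
    fix p q
    show "\<tau> (ShO C (- (q + 1)) (LE P (- (p - 1)))) \<cdot>\<^bsub>A\<^esub> ic (weight_couple C H1 P) p q =
      ic (weight_couple C H2 P) p q \<cdot>\<^bsub>A\<^esub> \<tau> (ShO C (- q) (LE P (- p)))"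
      using nat[of "ShM C (- q) (sT P (1 - p))"]
      by (simp add: H1.weight_couple_simps H2.weight_couple_simps S algebra_simps)
    show "\<tau> (ShO C (- (q - 1 + 1)) (GR P (- (p + 1 - 1)))) \<cdot>\<^bsub>A\<^esub> jc (weight_couple C H1 P) p q =
      jc (weight_couple C H2 P) p q \<cdot>\<^bsub>A\<^esub> \<tau> (ShO C (- q) (LE P (- p)))"
      using nat[of "ShM C (- q) (dT P (- p))"]
      by (simp add: H1.weight_couple_simps H2.weight_couple_simps S)
    show "\<tau> (ShO C (- q) (LE P (- (p + 1)))) \<cdot>\<^bsub>A\<^esub> kc (weight_couple C H1 P) p q =
      kc (weight_couple C H2 P) p q \<cdot>\<^bsub>A\<^esub> \<tau> (ShO C (- q) (GR P (- p)))"
      using nat[of "ShM C (- q) (cT P (- p))"]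
      by (simp add: H1.weight_couple_simps H2.weight_couple_simps S minus_one_diff)
  qed (simp_all add: H1.weight_couple_simps H2.weight_couple_simps mem_Mor ty)
qed

definition transformation_map ::
  "('o, 'm, 'z) tri_struct_scheme \<Rightarrow> ('a, 'b, 'y) cat_struct_scheme \<Rightarrow> ('o, 'm) tower
    \<Rightarrow> ('a, 'b) spec_seq \<Rightarrow> ('a, 'b) spec_seq \<Rightarrow> ('o \<Rightarrow> 'b) \<Rightarrow> nat \<Rightarrow> int \<Rightarrow> int \<Rightarrow> 'b" where
  "transformation_map C A P T T' \<tau> = page_map A T T' (\<lambda>p q. \<tau> (ShO C (- q) (GR P (- p))))"

text \<open>An arbitrary lift is chosen, so the E_1 map is not canonical; the pages from E_2 on do
  not depend on the choice.\<close>

definition tower_map ::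
  "('o, 'm, 'z) tri_struct_scheme \<Rightarrow> ('a, 'b, 'y) cat_struct_scheme
    \<Rightarrow> ('o, 'm, 'a, 'b) functor_data \<Rightarrow> ('o, 'm) tower \<Rightarrow> ('a, 'b) spec_seq
    \<Rightarrow> ('o, 'm) tower \<Rightarrow> ('a, 'b) spec_seq \<Rightarrow> 'm \<Rightarrow> nat \<Rightarrow> int \<Rightarrow> int \<Rightarrow> 'b" where
  "tower_map C A H P1 T1 P2 T2 g = page_map A T2 T1
     (\<lambda>p q. FM H (ShM C (- q) ((SOME m. \<exists>u. tower_lift C P1 P2 g u m) (- p))))"

context weight_cohomology
begin

text \<open>The second part characterises the E_2 map by any lift at all, not just the chosen one.
  Functoriality rests on this freedom.\<close>

lemma tower_map_morphism:
  assumes P1: "weight_postnikov_tower C Wle Wge X1 P1" and P2: "weight_postnikov_tower C Wle Wge X2 P2"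
    and T1: "weight_spec_seq C A H P1 T1" and T2: "weight_spec_seq C A H P2 T2"
    and g: "g \<in> Mor C X1 X2"
  shows "spec_seq_morphism A 2 T2 T1 (tower_map C A H P1 T1 P2 T2 g)"
    and "tower_lift C P1 P2 g u m \<Longrightarrow> induces_on_next_page A T2 T1 1 p q
      (FM H (ShM C (- q) (m (- p)))) (tower_map C A H P1 T1 P2 T2 g 2 p q)"
proof -
  define m0 where "m0 = (SOME m. \<exists>u. tower_lift C P1 P2 g u m)"
  have "\<exists>m u. tower_lift C P1 P2 g u m" using ex_tower_lift[OF P1 P2 g] by blast
  then have "\<exists>u. tower_lift C P1 P2 g u m0" unfolding m0_def by (rule someI_ex)
  then obtain u0 where L0: "tower_lift C P1 P2 g u0 m0" by blast
  have mor: "spec_seq_morphism A 1 T2 T1 (tower_map C A H P1 T1 P2 T2 g)"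
    unfolding tower_map_def m0_def[symmetric]
    by (rule A.spec_seq_morphism_page_map[OF T2[unfolded weight_spec_seq_def]
          T1[unfolded weight_spec_seq_def] tower_lift_couple_morphism[OF P1 P2 L0]])
  then show "spec_seq_morphism A 2 T2 T1 (tower_map C A H P1 T1 P2 T2 g)"
    unfolding spec_seq_morphism_def by simp
  have "tower_map C A H P1 T1 P2 T2 g 1 p q = FM H (ShM C (- q) (m0 (- p)))"
    by (simp add: tower_map_def m0_def)
  then have "induces_on_next_page A T2 T1 1 p q (FM H (ShM C (- q) (m0 (- p))))
    (tower_map C A H P1 T1 P2 T2 g (1 + 1) p q)"
    using mor unfolding spec_seq_morphism_def by (metis order_refl)
  then show "induces_on_next_page A T2 T1 1 p q
      (FM H (ShM C (- q) (m (- p)))) (tower_map C A H P1 T1 P2 T2 g 2 p q)"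
    if "tower_lift C P1 P2 g u m"
    using tower_lift_induces[OF P1 P2 T1 T2 L0 that] unfolding one_add_one by blast
qed

lemma weight_spec_seq_spectral: "weight_spec_seq C A H P T \<Longrightarrow> spectral_sequence A T"
  unfolding weight_spec_seq_def spec_seq_of_couple_def by blast

section \<open>Functor laws and independence of the tower\<close>

lemma tower_map_id:
  assumes P: "weight_postnikov_tower C Wle Wge X P" and T: "weight_spec_seq C A H P T" and r: "r \<ge> 2"
  shows "tower_map C A H P T P T (Idm C X) r p q = Idm A (Eo T r p q)"
proof -
  have X: "Idm C X \<in> Mor C X X" by (simp add: mem_Mor)
  note S = weight_spec_seq_spectral[OF T]
  have "tower_map C A H P T P T (Idm C X) 2 p q = Idm A (Eo T 2 p q)" for p q
  proof (rule A.induces_unique[OF S S])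
    show "induces_on_next_page A T T 1 p q (Idm A (Eo T 1 p q)) (tower_map C A H P T P T (Idm C X) 2 p q)"
      using tower_map_morphism(2)[OF P P T T X tower_lift_id[OF P], of p q]
      by (simp add: weight_spec_seq_E1[OF P T, unfolded One_nat_def])
    show "induces_on_next_page A T T 1 p q (Idm A (Eo T 1 p q)) (Idm A (Eo T 2 p q))"
      using A.induces_id[OF S, of 1 p q] by (simp add: numeral_2_eq_2)
  qed simp
  then show ?thesis
    using A.spec_seq_morphism_unique[OF S S _ tower_map_morphism(1)[OF P P T T X] A.spec_seq_morphism_id[OF S]] r
    by simp
qed

text \<open>Composites of lifts are lifts of the composite, so both sides are induced on E_2 by one
  and the same E_1 map. The order is reversed since \<open>H\<close> is contravariant.\<close>

lemma tower_map_comp: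
  assumes P: "weight_postnikov_tower C Wle Wge X1 P1" "weight_postnikov_tower C Wle Wge X2 P2"
      "weight_postnikov_tower C Wle Wge X3 P3"
    and T: "weight_spec_seq C A H P1 T1" "weight_spec_seq C A H P2 T2" "weight_spec_seq C A H P3 T3"
    and g: "g \<in> Mor C X1 X2" and h: "h \<in> Mor C X2 X3" and r: "r \<ge> 2"
  shows "tower_map C A H P1 T1 P3 T3 (h \<cdot> g) r p q =
    tower_map C A H P1 T1 P2 T2 g r p q \<cdot>\<^bsub>A\<^esub> tower_map C A H P2 T2 P3 T3 h r p q"
proof -
  note S = weight_spec_seq_spectral[OF T(1)] weight_spec_seq_spectral[OF T(2)] weight_spec_seq_spectral[OF T(3)]
  have gh: "h \<cdot> g \<in> Mor C X1 X3" using g h by (simp add: mem_Mor)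
  obtain u m where L1: "tower_lift C P1 P2 g u m" using ex_tower_lift[OF P(1,2) g] by blast
  obtain u' m' where L2: "tower_lift C P2 P3 h u' m'" using ex_tower_lift[OF P(2,3) h] by blast
  note L3 = tower_lift_comp[OF P g h L1 L2]
  let ?G = "tower_map C A H P1 T1 P2 T2 g" and ?H = "tower_map C A H P2 T2 P3 T3 h"
  have base: "tower_map C A H P1 T1 P3 T3 (h \<cdot> g) 2 p q = ?G 2 p q \<cdot>\<^bsub>A\<^esub> ?H 2 p q" for p q
  proof (rule A.induces_unique[OF S(3,1)])
    show "induces_on_next_page A T3 T1 1 p q (FM H (ShM C (- q) (m' (- p) \<cdot> m (- p))))
      (tower_map C A H P1 T1 P3 T3 (h \<cdot> g) 2 p q)"
      by (rule tower_map_morphism(2)[OF P(1,3) T(1,3) gh L3])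
    show "induces_on_next_page A T3 T1 1 p q (FM H (ShM C (- q) (m' (- p) \<cdot> m (- p)))) (?G 2 p q \<cdot>\<^bsub>A\<^esub> ?H 2 p q)"
      using A.induces_comp[OF S(3,2,1) _ tower_map_morphism(2)[OF P(2,3) T(2,3) h L2]
          tower_map_morphism(2)[OF P(1,2) T(1,2) g L1], of p q]
      by (simp add: tower_liftD[OF L1] tower_liftD[OF L2])
  qed simp
  show ?thesis
    using A.spec_seq_morphism_unique[OF S(3,1) _ tower_map_morphism(1)[OF P(1,3) T(1,3) gh]
        A.spec_seq_morphism_comp[OF S(3,2,1) _ tower_map_morphism(1)[OF P(2,3) T(2,3) h]
          tower_map_morphism(1)[OF P(1,2) T(1,2) g]]] base r
    by simp
qed

text \<open>Lifts of the identity of \<open>X\<close> in the two directions compose to lifts of the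
  identity, so their page maps are mutually inverse.\<close>

lemma tower_map_iso:
  assumes P: "weight_postnikov_tower C Wle Wge X P1" "weight_postnikov_tower C Wle Wge X P2"
    and T: "weight_spec_seq C A H P1 T1" "weight_spec_seq C A H P2 T2" and r: "r \<ge> 2"
  shows "is_isomorphism A (tower_map C A H P1 T1 P2 T2 (Idm C X) r p q)"
proof -
  have X: "Idm C X \<in> Mor C X X" by (simp add: mem_Mor)
  let ?f = "tower_map C A H P1 T1 P2 T2 (Idm C X) r p q"
    and ?g = "tower_map C A H P2 T2 P1 T1 (Idm C X) r p q"
  have ty: "?f \<in> Mor A (Eo T2 r p q) (Eo T1 r p q)" "?g \<in> Mor A (Eo T1 r p q) (Eo T2 r p q)"
    using tower_map_morphism(1)[OF P T X] tower_map_morphism(1)[OF P(2,1) T(2,1) X] r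
    unfolding spec_seq_morphism_def by blast+
  have "?f \<cdot>\<^bsub>A\<^esub> ?g = Idm A (Eo T1 r p q)" "?g \<cdot>\<^bsub>A\<^esub> ?f = Idm A (Eo T2 r p q)"
    using tower_map_comp[OF P P(1) T T(1) X X r] tower_map_comp[OF P(2,1,2) T(2,1,2) X X r]
      tower_map_id[OF P(1) T(1) r] tower_map_id[OF P(2) T(2) r] by simp_all
  then show ?thesis
    using ty unfolding is_isomorphism_def by (metis mem_Mor)
qed

end

lemma transformation_map_morphism:
  assumes H: "weight_cohomology C Wle Wge A H1" "weight_cohomology C Wle Wge A H2"
    and P: "weight_postnikov_tower C Wle Wge X P"
    and T: "weight_spec_seq C A H1 P T1" "weight_spec_seq C A H2 P T2"
    and \<tau>: "natural_transformation C A H1 H2 \<tau>"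
  shows "spec_seq_morphism A 1 T1 T2 (transformation_map C A P T1 T2 \<tau>)"
proof -
  interpret H1: weight_cohomology C Wle Wge A H1 by fact
  show ?thesis
    unfolding transformation_map_def
    by (rule H1.A.spec_seq_morphism_page_map[OF T[unfolded weight_spec_seq_def]
          natural_transformation_couple_morphism[OF H \<tau> P]])
qed

lemma transformation_map_id:
  assumes H: "weight_cohomology C Wle Wge A H" and P: "weight_postnikov_tower C Wle Wge X P"
    and T: "weight_spec_seq C A H P T" and r: "r \<ge> 1"
  shows "transformation_map C A P T T (\<lambda>Y. Idm A (FO H Y)) r p q = Idm A (Eo T r p q)"
proof -
  interpret weight_cohomology C Wle Wge A H by fact
  note S = weight_spec_seq_spectral[OF T]
  have "natural_transformation C A H H (\<lambda>Y. Idm A (FO H Y))"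
    by (auto simp: natural_transformation_def mem_Mor)
  note mor = transformation_map_morphism[OF H H P T T this]
  show ?thesis
    by (rule A.spec_seq_morphism_unique[OF S S order_refl mor A.spec_seq_morphism_id[OF S order_refl] _ r])
      (simp add: transformation_map_def weight_spec_seq_E1[OF P T, unfolded One_nat_def])
qed

text \<open>No lift is chosen: the E_1 map is the transformation itself, so the law holds there and
  propagates from the first page on.\<close>

lemma transformation_map_comp:
  assumes H: "weight_cohomology C Wle Wge A H1" "weight_cohomology C Wle Wge A H2"
      "weight_cohomology C Wle Wge A H3"
    and P: "weight_postnikov_tower C Wle Wge X P"
    and T: "weight_spec_seq C A H1 P T1" "weight_spec_seq C A H2 P T2" "weight_spec_seq C A H3 P T3"
    and \<tau>: "natural_transformation C A H1 H2 \<tau>" and \<sigma>: "natural_transformation C A H2 H3 \<sigma>"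
    and r: "r \<ge> 1"
  shows "transformation_map C A P T1 T3 (\<lambda>Y. \<sigma> Y \<cdot>\<^bsub>A\<^esub> \<tau> Y) r p q =
    transformation_map C A P T2 T3 \<sigma> r p q \<cdot>\<^bsub>A\<^esub> transformation_map C A P T1 T2 \<tau> r p q"
proof -
  interpret H1: weight_cohomology C Wle Wge A H1 by fact
  interpret H2: weight_cohomology C Wle Wge A H2 by fact
  interpret H3: weight_cohomology C Wle Wge A H3 by fact
  note S = H1.weight_spec_seq_spectral[OF T(1)] H2.weight_spec_seq_spectral[OF T(2)]
    H3.weight_spec_seq_spectral[OF T(3)]
  have ty: "Src A (\<tau> Y) = FO H1 Y" "Trg A (\<tau> Y) = FO H2 Y" "Src A (\<sigma> Y) = FO H2 Y" "Trg A (\<sigma> Y) = FO H3 Y" for Y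
    using \<tau> \<sigma> unfolding natural_transformation_def mem_Mor by blast+
  have nat: "\<tau> (Src C f) \<cdot>\<^bsub>A\<^esub> FM H1 f = FM H2 f \<cdot>\<^bsub>A\<^esub> \<tau> (Trg C f)"
    "\<sigma> (Src C f) \<cdot>\<^bsub>A\<^esub> FM H2 f = FM H3 f \<cdot>\<^bsub>A\<^esub> \<sigma> (Trg C f)" for f
    using \<tau> \<sigma> unfolding natural_transformation_def by (metis mem_Mor)+
  have "(\<sigma> (Src C f) \<cdot>\<^bsub>A\<^esub> \<tau> (Src C f)) \<cdot>\<^bsub>A\<^esub> FM H1 f = FM H3 f \<cdot>\<^bsub>A\<^esub> (\<sigma> (Trg C f) \<cdot>\<^bsub>A\<^esub> \<tau> (Trg C f))" for f
    using H1.A.comp_eq_left[OF nat(2)[of f], of "\<tau> (Trg C f)"] by (simp add: ty nat(1))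
  then have "natural_transformation C A H1 H3 (\<lambda>Y. \<sigma> Y \<cdot>\<^bsub>A\<^esub> \<tau> Y)"
    unfolding natural_transformation_def by (auto simp: mem_Mor ty)
  note mor = transformation_map_morphism[OF H(1,3) P T(1,3) this]
    H1.A.spec_seq_morphism_comp[OF S order_refl transformation_map_morphism[OF H(1,2) P T(1,2) \<tau>]
      transformation_map_morphism[OF H(2,3) P T(2,3) \<sigma>]]
  show ?thesis
    by (rule H1.A.spec_seq_morphism_unique[OF S(1,3) order_refl mor _ r]) (simp add: transformation_map_def)
qed

theorem theorem2p4p2:
  fixes C :: "('o, 'm) tri_struct" and Wle Wge :: "'o set"
    and A :: "('a, 'b) preadd_struct" and H :: "('o, 'm, 'a, 'b) functor_data"
    and X :: 'o and P :: "('o, 'm) tower"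
  assumes "weight_structure C Wle Wge"
    and "abelian_category A"
    and "cohomological_functor C A H"
    and "weight_postnikov_tower C Wle Wge X P"
  shows
    "(exact_couple A 1 (weight_couple C H P)
     \<and> (\<exists>T. weight_spec_seq C A H P T)
     \<and> (\<forall>T. weight_spec_seq C A H P T \<longrightarrow> spectral_sequence A T \<and>
          (\<forall>p q. Eo T 1 p q = FO (coh_shift C H q) (GR P (- p)) \<and>
                 dm T 1 p q = FM (coh_shift C H q) (weight_complex_diff C P (- 1 - p)))))
     \<and>
     (\<forall>T. weight_spec_seq C A H P T \<and>
       (X \<in> weight_bounded C Wge \<inter> weight_bounded C Wle
        \<or> (\<exists>q0. \<forall>q \<ge> q0. vanishes_on A H (weight_class C Wge q)) \<and>
          (\<exists>q1. \<forall>q \<le> q1. vanishes_on A H (weight_class C Wle q))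
        \<or> X \<in> weight_bounded C Wle \<and>
          (\<exists>q1. \<forall>q \<le> q1. vanishes_on A H (weight_class C Wle q))
        \<or> X \<in> weight_bounded C Wge \<and>
          (\<exists>q0. \<forall>q \<ge> q0. vanishes_on A H (weight_class C Wge q)))
       \<longrightarrow> (\<exists>F. converges_to A T (\<lambda>n. FO (coh_shift C H n) X) F \<and>
                (\<forall>n p. is_weight_filtration C A (coh_shift C H n) P (- p) (F n p))))
     \<and>
     (\<exists>\<Phi>.
       (\<forall>H1 H2 T1 T2 \<tau>.
          cohomological_functor C A H1 \<and> cohomological_functor C A H2 \<and>
          weight_spec_seq C A H1 P T1 \<and> weight_spec_seq C A H2 P T2 \<and>
          natural_transformation C A H1 H2 \<tau> \<longrightarrow>
          spec_seq_morphism A 1 T1 T2 (\<Phi> T1 T2 \<tau>) \<and>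
          (\<forall>p q. \<Phi> T1 T2 \<tau> 1 p q = \<tau> (ShO C (- q) (GR P (- p)))))
       \<and> (\<forall>H1 T1. cohomological_functor C A H1 \<and> weight_spec_seq C A H1 P T1 \<longrightarrow>
            (\<forall>r \<ge> 1. \<forall>p q. \<Phi> T1 T1 (\<lambda>Y. Idm A (FO H1 Y)) r p q = Idm A (Eo T1 r p q)))
       \<and> (\<forall>H1 H2 H3 T1 T2 T3 \<sigma> \<tau>.
            cohomological_functor C A H1 \<and> cohomological_functor C A H2 \<and>
            cohomological_functor C A H3 \<and> weight_spec_seq C A H1 P T1 \<and>
            weight_spec_seq C A H2 P T2 \<and> weight_spec_seq C A H3 P T3 \<and>
            natural_transformation C A H1 H2 \<tau> \<and> natural_transformation C A H2 H3 \<sigma> \<longrightarrow>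
            (\<forall>r \<ge> 1. \<forall>p q. \<Phi> T1 T3 (\<lambda>Y. \<sigma> Y \<cdot>\<^bsub>A\<^esub> \<tau> Y) r p q
                             = \<Phi> T2 T3 \<sigma> r p q \<cdot>\<^bsub>A\<^esub> \<Phi> T1 T2 \<tau> r p q)))
     \<and>
     (\<exists>\<Psi>.
       (\<forall>X1 X2 P1 P2 T1 T2 g.
          weight_postnikov_tower C Wle Wge X1 P1 \<and> weight_spec_seq C A H P1 T1 \<and>
          weight_postnikov_tower C Wle Wge X2 P2 \<and> weight_spec_seq C A H P2 T2 \<and>
          g \<in> Mor C X1 X2 \<longrightarrow>
          spec_seq_morphism A 2 T2 T1 (\<Psi> P1 T1 P2 T2 g) \<and>
          (\<exists>u m. tower_lift C P1 P2 g u m) \<and>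
          (\<forall>u m. tower_lift C P1 P2 g u m \<longrightarrow>
             (\<forall>p q. induces_on_next_page A T2 T1 1 p q
                      (FM (coh_shift C H q) (m (- p))) (\<Psi> P1 T1 P2 T2 g 2 p q))))
       \<and> (\<forall>X1 P1 T1. weight_postnikov_tower C Wle Wge X1 P1 \<and> weight_spec_seq C A H P1 T1 \<longrightarrow>
            (\<forall>r \<ge> 2. \<forall>p q. \<Psi> P1 T1 P1 T1 (Idm C X1) r p q = Idm A (Eo T1 r p q)))
       \<and> (\<forall>X1 X2 X3 P1 P2 P3 T1 T2 T3 g h.
            weight_postnikov_tower C Wle Wge X1 P1 \<and> weight_spec_seq C A H P1 T1 \<and>
            weight_postnikov_tower C Wle Wge X2 P2 \<and> weight_spec_seq C A H P2 T2 \<and>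
            weight_postnikov_tower C Wle Wge X3 P3 \<and> weight_spec_seq C A H P3 T3 \<and>
            g \<in> Mor C X1 X2 \<and> h \<in> Mor C X2 X3 \<longrightarrow>
            (\<forall>r \<ge> 2. \<forall>p q. \<Psi> P1 T1 P3 T3 (h \<cdot>\<^bsub>C\<^esub> g) r p q
                             = \<Psi> P1 T1 P2 T2 g r p q \<cdot>\<^bsub>A\<^esub> \<Psi> P2 T2 P3 T3 h r p q))
       \<and> (\<forall>X1 P1 P2 T1 T2.
            weight_postnikov_tower C Wle Wge X1 P1 \<and> weight_spec_seq C A H P1 T1 \<and>
            weight_postnikov_tower C Wle Wge X1 P2 \<and> weight_spec_seq C A H P2 T2 \<longrightarrow>
            (\<forall>r \<ge> 2. \<forall>p q. is_isomorphism A (\<Psi> P1 T1 P2 T2 (Idm C X1) r p q))))"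
proof -
  interpret weight_structure C Wle Wge by (rule assms(1))
  interpret A: abelian_category A by (rule assms(2))
  \<comment> \<open>Stated for every functor, because naturality in \<open>H\<close> ranges over all
    cohomological functors on the same categories.\<close>
  have WH: "weight_cohomology C Wle Wge A H'" if "cohomological_functor C A H'" for H'
    by unfold_locales (rule that)
  interpret weight_cohomology C Wle Wge A H by (rule WH[OF assms(3)])
  note P = assms(4)
  show ?thesis
    apply (intro conjI)
    subgoal by (rule exact_weight_couple[OF P])
    subgoal using A.ex_spec_seq_of_couple[OF exact_weight_couple[OF P]] unfolding weight_spec_seq_def by metis
    subgoal using weight_spec_seq_spectral weight_spec_seq_E1[OF P] by (simp add: coh_shift_def)
    subgoal using weight_spec_seq_converges[OF P] by blast
    subgoal
      apply (rule exI[of _ "transformation_map C A P"])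
      apply (intro conjI allI impI; (elim conjE)?)
      subgoal by (rule transformation_map_morphism[OF WH WH P])
      subgoal by (simp add: transformation_map_def)
      subgoal by (rule transformation_map_id[OF WH P])
      subgoal by (rule transformation_map_comp[OF WH WH WH P])
      done
    subgoal
      apply (rule exI[of _ "tower_map C A H"])
      apply (intro conjI allI impI; (elim conjE)?)
      subgoal by (rule tower_map_morphism(1))
      subgoal by (rule ex_tower_lift)
      subgoal using tower_map_morphism(2) by (simp add: coh_shift_def)
      subgoal by (rule tower_map_id)
      subgoal by (rule tower_map_comp)
      subgoal by (rule tower_map_iso)
      done
    done
qed

end
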